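(* Let $(\Omega,\mathsf{F},\mathbb{P})$ and $(E,\mathsf{E},\mu)$ be probability spaces and let $(\mathcal{H},d)$ be a separable Hilbert-Hadamard space. Let $(\xi_i)_{i\ge1}$ be an i.i.d. sequence of random variables $\xi_i:\Omega\to E$ with distribution $\mu$. Let $A:E\to\mathcal{M}(\mathcal{H})$ be an integrable random monotone vector field such that, $\mathbb{P}$-almost surely, the inductive mean vector fields $\underline{A}_n:=\frac1n\overrightarrow{\sum}_{i=1,\dots,n}A(\xi_i)$ satisfy the surjectivity condition (for all $n$). Then \[ \frac1n\overrightarrow{\sum_{i=1,\dots,n}}A(\xi_i)\to^R\int A(e)\,d\mu(e)\quad\mathbb{P}\text{-a.s. as }n\to\infty, \] that is, there is a set $\Omega'\subseteq\Omega$ of measure one such that $J^{\underline{A}_n(\omega)}_\lambda(x)\to J^{\underline{A}}_\lambda(x)$ as $n\to\infty$ for all $\omega\in\Omega'$, $x\in\mathcal{H}$ and $\lambda>0$, where $\underline{A}:=\int A(e)\,d\mu(e)$.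
   Context: A geodesic in a metric space $(\mathcal{H},d)$ is an isometric embedding $\gamma:[0,l]\to\mathcal{H}$; it issues from $\gamma(0)$. A Hadamard space is a complete metric space in which any two points are joined by a geodesic and such that (CN) $d^2(\gamma(tl),x)\le(1-t)d^2(\gamma(0),x)+td^2(\gamma(l),x)-t(1-t)d^2(\gamma(0),\gamma(l))$ for all $x\in\mathcal{H}$, $t\in[0,1]$ and geodesics $\gamma:[0,l]\to\mathcal{H}$. Geodesics are unique; $(1-t)x\oplus ty$ is the point $\gamma(tl)$ on the geodesic from $x$ to $y$; $\gamma_{x,y}$ is the geodesic from $x$ to $y$. A Hadamard space is flat if (CN) always holds with equality. Tangent cones: for nonconstant geodesics $\gamma,\eta$ issuing from $x$, $\angle_x(\gamma,\eta)=\lim_{s,t\to0^+}\bar\angle_x(\gamma(s),\eta(t))$, where $\bar\angle_x(y,z)$ is the angle at $\bar x$ of the Euclidean comparison triangle of $x,y,z$. Let $\Sigma'_x\mathcal{H}$ be the metric space of classes (angle $0$) of such geodesics and $\Sigma_x\mathcal{H}$ its completion. $T_x\mathcal{H}$ is the Euclidean cone over $\Sigma_x\mathcal{H}$: the classes $t\gamma$ of pairs $(\gamma,t)\in\Sigma_x\mathcal{H}\times[0,\infty)$ (all pairs with $t=0$ identified to $0_x$), with metric $d_x(t\gamma,s\eta)=\sqrt{t^2+s^2-2ts\cos\angle_x(\gamma,\eta)}$, which is itself a Hadamard space (separable if $\mathcal{H}$ is). Write $\lambda(t\gamma)=(\lambda t)\gamma$ for $\lambda\ge0$, $g_x(t\gamma,s\eta)=ts\cos\angle_x(\gamma,\eta)$,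 $T\mathcal{H}=\bigcup_xT_x\mathcal{H}$, and $\log_xa:=d(x,a)\gamma_{x,a}$ for $a\ne x$, $\log_xx:=0_x$. A Hilbert-Hadamard space is a Hadamard space all of whose tangent cones are flat. A monotone vector field is a map $A:\mathcal{H}\to2^{T\mathcal{H}}$ with $A(x)\subseteq T_x\mathcal{H}$ and $g_x(u,\log_xy)\le-g_y(v,\log_yx)$ whenever $u\in A(x)$, $v\in A(y)$. For $\lambda>0$ its resolvent is $J^A_\lambda(x):=\{z\in\mathcal{H}\mid\frac1\lambda\log_zx\in A(z)\}$, which has at most one element; $A$ satisfies the surjectivity condition if $J^A_\lambda(x)\ne\emptyset$ for all $x\in\mathcal{H},\lambda>0$ (then $J^A_\lambda$ is regarded as a map $\mathcal{H}\to\mathcal{H}$). $\mathcal{M}(\mathcal{H})$ is the set of monotone vector fields satisfying the surjectivity condition. A map $A:E\to\mathcal{M}(\mathcal{H})$, written $A(e,x):=A(e)(x)$, is a random monotone vector field if $e\mapsto J^{A(e)}_\lambda(x)$ is $\mathsf{E}$/Borel measurable for all $x\in\mathcal{H}$, $\lambda>0$. Integrals: for a measurable map $\phi$ from a probability space into a separable Hadamard space $(K,\rho)$ with $\int\rho(\phi,z)\,d\mu<\infty$ for some/any $z$, $\int\phi\,d\mu:=\mathrm{argmin}_{z\in K}\int(\rho^2(z,\phi)-\rho^2(y,\phi))\,d\mu$ (unique, independent of $y\in K$). For set-valued $\Phi:E\to2^K$, $\int\Phi\,d\mu:=\{\int\phi\,d\mu\}$ where $\phi$ ranges over all measurable selections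 $\phi(e)\in\Phi(e)$ for all $e\in E$ which are integrable, i.e. satisfy $\int\rho(\phi,z)\,d\mu<\infty$ for some/any $z\in K$. The integral vector field is $\left(\int A(e)\,d\mu(e)\right)(x):=\int A(e,x)\,d\mu(e)\subseteq T_x\mathcal{H}$, with $K=T_x\mathcal{H}$. $A$ is integrable if $\int A(e)\,d\mu(e)$ satisfies the surjectivity condition (it is automatically monotone here). Inductive means: for points, $s_1:=x_1$, $s_n:=(1-\frac1n)s_{n-1}\oplus\frac1nx_n$ and $\frac1n\overrightarrow{\sum}_{i=1,\dots,n}x_i:=s_n$. For sets $B_1,\dots,B_n$, $\frac1n\overrightarrow{\sum}_{i=1,\dots,n}B_i:=\{\frac1n\overrightarrow{\sum}_{i=1,\dots,n}x_i\mid x_i\in B_i\}$. For vector fields $A_i$, $\left(\frac1n\overrightarrow{\sum}_{i=1,\dots,n}A_i\right)(x):=\frac1n\overrightarrow{\sum}_{i=1,\dots,n}A_i(x)$, formed in $T_x\mathcal{H}$. $A_n\to^RA$ means $J^{A_n}_\lambda(x)\to J^A_\lambda(x)$ for all $x\in\mathcal{H}$ and $\lambda>0$. *)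

theory Defs
  imports "HOL-Probability.Probability"
begin

section \<open>Geodesics and Hadamard spaces\<close>

text \<open>
  Metric spaces are given by a carrier set and a distance function, as in the locale
  \<^locale>\<open>Metric_space\<close>. Tangent cones are metric spaces that depend on a point, so they need
  explicit carriers, and the same notions are used for the base space and its tangent cones.

  A geodesic is a map on \<open>{0..l}\<close>. It is required to be \<^const>\<open>undefined\<close> elsewhere, so that
  equal geodesics are equal as HOL functions and \<open>geod\<close> below is well defined by uniqueness.
\<close>

definition geodesic :: "'a set \<Rightarrow> ('a \<Rightarrow> 'a \<Rightarrow> real) \<Rightarrow> real \<Rightarrow> (real \<Rightarrow> 'a) \<Rightarrow> bool" where
  "geodesic M d l \<gamma> \<longleftrightarrow> 0 \<le> l \<and> \<gamma> \<in> {0..l} \<rightarrow>\<^sub>E M \<and>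
     (\<forall>s\<in>{0..l}. \<forall>t\<in>{0..l}. d (\<gamma> s) (\<gamma> t) = \<bar>s - t\<bar>)"

definition hadamard_space :: "'a set \<Rightarrow> ('a \<Rightarrow> 'a \<Rightarrow> real) \<Rightarrow> bool" where
  "hadamard_space M d \<longleftrightarrow>
     Metric_space M d \<and> Metric_space.mcomplete M d \<and>
     (\<forall>x\<in>M. \<forall>y\<in>M. \<exists>l \<gamma>. geodesic M d l \<gamma> \<and> \<gamma> 0 = x \<and> \<gamma> l = y) \<and>
     (\<forall>l \<gamma>. \<forall>x\<in>M. \<forall>t\<in>{0..1}. geodesic M d l \<gamma> \<longrightarrow>
        (d (\<gamma> (t * l)) x)\<^sup>2 \<le> (1 - t) * (d (\<gamma> 0) x)\<^sup>2 + t * (d (\<gamma> l) x)\<^sup>2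
                              - t * (1 - t) * (d (\<gamma> 0) (\<gamma> l))\<^sup>2)"

definition flat_space :: "'a set \<Rightarrow> ('a \<Rightarrow> 'a \<Rightarrow> real) \<Rightarrow> bool" where
  "flat_space M d \<longleftrightarrow>
     (\<forall>l \<gamma>. \<forall>x\<in>M. \<forall>t\<in>{0..1}. geodesic M d l \<gamma> \<longrightarrow>
        (d (\<gamma> (t * l)) x)\<^sup>2 = (1 - t) * (d (\<gamma> 0) x)\<^sup>2 + t * (d (\<gamma> l) x)\<^sup>2
                              - t * (1 - t) * (d (\<gamma> 0) (\<gamma> l))\<^sup>2)"

definition geod :: "'a set \<Rightarrow> ('a \<Rightarrow> 'a \<Rightarrow> real) \<Rightarrow> 'a \<Rightarrow> 'a \<Rightarrow> real \<Rightarrow> 'a" where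
  "geod M d x y = (THE \<gamma>. geodesic M d (d x y) \<gamma> \<and> \<gamma> 0 = x \<and> \<gamma> (d x y) = y)"

text \<open>\<open>geo_comb M d t x y\<close> is \<open>(1 - t) x \<oplus> t y\<close>.\<close>

definition geo_comb :: "'a set \<Rightarrow> ('a \<Rightarrow> 'a \<Rightarrow> real) \<Rightarrow> real \<Rightarrow> 'a \<Rightarrow> 'a \<Rightarrow> 'a" where
  "geo_comb M d t x y = geod M d x y (t * d x y)"


section \<open>Quotient metric spaces and completions\<close>

text \<open>
  Metric identification of a pseudometric \<open>\<delta>\<close> on \<open>S\<close>. All distances on derived carriers are set to
  \<open>0\<close> off the carrier, since \<^locale>\<open>Metric_space\<close> asks for non-negativity and symmetry on the
  whole type.
\<close>

definition mquot :: "'b set \<Rightarrow> ('b \<Rightarrow> 'b \<Rightarrow> real) \<Rightarrow> 'b set set" where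
  "mquot S \<delta> = S // {(p, q). p \<in> S \<and> q \<in> S \<and> \<delta> p q = 0}"

definition mclass :: "'b set \<Rightarrow> ('b \<Rightarrow> 'b \<Rightarrow> real) \<Rightarrow> 'b \<Rightarrow> 'b set" where
  "mclass S \<delta> p = {(p, q). p \<in> S \<and> q \<in> S \<and> \<delta> p q = 0} `` {p}"

definition mquot_dist :: "'b set \<Rightarrow> ('b \<Rightarrow> 'b \<Rightarrow> real) \<Rightarrow> 'b set \<Rightarrow> 'b set \<Rightarrow> real" where
  "mquot_dist S \<delta> X Y =
     (if X \<in> mquot S \<delta> \<and> Y \<in> mquot S \<delta> then THE r. \<exists>p\<in>X. \<exists>q\<in>Y. r = \<delta> p q else 0)"

text \<open>The completion as the space of Cauchy sequences modulo vanishing limit distance.\<close>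

definition cauchy_seqs :: "'b set \<Rightarrow> ('b \<Rightarrow> 'b \<Rightarrow> real) \<Rightarrow> (nat \<Rightarrow> 'b) set" where
  "cauchy_seqs K \<rho> = {\<sigma>. Metric_space.MCauchy K \<rho> \<sigma>}"

definition lim_dist :: "('b \<Rightarrow> 'b \<Rightarrow> real) \<Rightarrow> (nat \<Rightarrow> 'b) \<Rightarrow> (nat \<Rightarrow> 'b) \<Rightarrow> real" where
  "lim_dist \<rho> \<sigma> \<tau> = lim (\<lambda>n. \<rho> (\<sigma> n) (\<tau> n))"

definition completion :: "'b set \<Rightarrow> ('b \<Rightarrow> 'b \<Rightarrow> real) \<Rightarrow> (nat \<Rightarrow> 'b) set set" where
  "completion K \<rho> = mquot (cauchy_seqs K \<rho>) (lim_dist \<rho>)"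

definition completion_dist ::
    "'b set \<Rightarrow> ('b \<Rightarrow> 'b \<Rightarrow> real) \<Rightarrow> (nat \<Rightarrow> 'b) set \<Rightarrow> (nat \<Rightarrow> 'b) set \<Rightarrow> real" where
  "completion_dist K \<rho> = mquot_dist (cauchy_seqs K \<rho>) (lim_dist \<rho>)"

definition completion_embed :: "'b set \<Rightarrow> ('b \<Rightarrow> 'b \<Rightarrow> real) \<Rightarrow> 'b \<Rightarrow> (nat \<Rightarrow> 'b) set" where
  "completion_embed K \<rho> a = mclass (cauchy_seqs K \<rho>) (lim_dist \<rho>) (\<lambda>_. a)"


section \<open>Angles and spaces of directions\<close>

text \<open>
  \<open>comparison_angle d x y z\<close> is the angle at \<open>x'\<close> of a Euclidean triangle \<open>x', y', z'\<close> with the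
  same side lengths as \<open>x, y, z\<close>.
\<close>

definition comparison_angle :: "('a \<Rightarrow> 'a \<Rightarrow> real) \<Rightarrow> 'a \<Rightarrow> 'a \<Rightarrow> 'a \<Rightarrow> real" where
  "comparison_angle d x y z =
     (THE \<theta>. \<exists>x' y' z' :: real^2.
        dist x' y' = d x y \<and> dist x' z' = d x z \<and> dist y' z' = d y z \<and>
        \<theta> = arccos (((y' - x') \<bullet> (z' - x')) / (norm (y' - x') * norm (z' - x'))))"

text \<open>A geodesic of unspecified length is a pair of its length and the map.\<close>

type_synonym 'a geo = "real \<times> (real \<Rightarrow> 'a)"

definition geodesics_from :: "'a set \<Rightarrow> ('a \<Rightarrow> 'a \<Rightarrow> real) \<Rightarrow> 'a \<Rightarrow> 'a geo set" where
  "geodesics_from M d x = {(l, \<gamma>). geodesic M d l \<gamma> \<and> \<gamma> 0 = x \<and> 0 < l}"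

definition geo_angle :: "('a \<Rightarrow> 'a \<Rightarrow> real) \<Rightarrow> 'a \<Rightarrow> 'a geo \<Rightarrow> 'a geo \<Rightarrow> real" where
  "geo_angle d x p q =
     Lim (at_right 0 \<times>\<^sub>F at_right 0) (\<lambda>(s, t). comparison_angle d x (snd p s) (snd q t))"

definition pre_directions :: "'a set \<Rightarrow> ('a \<Rightarrow> 'a \<Rightarrow> real) \<Rightarrow> 'a \<Rightarrow> 'a geo set set" where
  "pre_directions M d x = mquot (geodesics_from M d x) (geo_angle d x)"

definition pre_directions_dist ::
    "'a set \<Rightarrow> ('a \<Rightarrow> 'a \<Rightarrow> real) \<Rightarrow> 'a \<Rightarrow> 'a geo set \<Rightarrow> 'a geo set \<Rightarrow> real" where
  "pre_directions_dist M d x = mquot_dist (geodesics_from M d x) (geo_angle d x)"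

type_synonym 'a direction = "(nat \<Rightarrow> 'a geo set) set"

definition directions :: "'a set \<Rightarrow> ('a \<Rightarrow> 'a \<Rightarrow> real) \<Rightarrow> 'a \<Rightarrow> 'a direction set" where
  "directions M d x = completion (pre_directions M d x) (pre_directions_dist M d x)"

definition angle ::
    "'a set \<Rightarrow> ('a \<Rightarrow> 'a \<Rightarrow> real) \<Rightarrow> 'a \<Rightarrow> 'a direction \<Rightarrow> 'a direction \<Rightarrow> real" where
  "angle M d x = completion_dist (pre_directions M d x) (pre_directions_dist M d x)"

text \<open>The direction of the geodesic from \<open>x\<close> to \<open>a\<close>, for \<open>a \<noteq> x\<close>.\<close>

definition direction_to :: "'a set \<Rightarrow> ('a \<Rightarrow> 'a \<Rightarrow> real) \<Rightarrow> 'a \<Rightarrow> 'a \<Rightarrow> 'a direction" where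
  "direction_to M d x a =
     completion_embed (pre_directions M d x) (pre_directions_dist M d x)
       (mclass (geodesics_from M d x) (geo_angle d x) (d x a, geod M d x a))"


section \<open>Tangent cones\<close>

text \<open>
  Normal forms for the classes of pairs \<open>(\<gamma>, t)\<close> with \<open>t \<ge> 0\<close>: all pairs with \<open>t = 0\<close> are
  identified to the apex. The apex is always present, also if there are no directions.
\<close>

datatype 'a tangent = Apex | Ray (ray_dir: "'a direction") (ray_len: real)

definition tpoint :: "real \<Rightarrow> 'a direction \<Rightarrow> 'a tangent" where
  "tpoint t \<gamma> = (if t = 0 then Apex else Ray \<gamma> t)"

fun tlen :: "'a tangent \<Rightarrow> real" where
  "tlen Apex = 0"
| "tlen (Ray \<gamma> t) = t"

definition tscale :: "real \<Rightarrow> 'a tangent \<Rightarrow> 'a tangent" where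
  "tscale c u = (case u of Apex \<Rightarrow> Apex | Ray \<gamma> t \<Rightarrow> tpoint (c * t) \<gamma>)"

definition tangent_cone :: "'a set \<Rightarrow> ('a \<Rightarrow> 'a \<Rightarrow> real) \<Rightarrow> 'a \<Rightarrow> 'a tangent set" where
  "tangent_cone M d x = insert Apex {tpoint t \<gamma> | t \<gamma>. 0 \<le> t \<and> \<gamma> \<in> directions M d x}"

fun tinner ::
    "'a set \<Rightarrow> ('a \<Rightarrow> 'a \<Rightarrow> real) \<Rightarrow> 'a \<Rightarrow> 'a tangent \<Rightarrow> 'a tangent \<Rightarrow> real" where
  "tinner M d x (Ray \<gamma> t) (Ray \<eta> s) = t * s * cos (angle M d x \<gamma> \<eta>)"
| "tinner M d x _ _ = 0"

definition tdist ::
    "'a set \<Rightarrow> ('a \<Rightarrow> 'a \<Rightarrow> real) \<Rightarrow> 'a \<Rightarrow> 'a tangent \<Rightarrow> 'a tangent \<Rightarrow> real" where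
  "tdist M d x u v =
     (if u \<in> tangent_cone M d x \<and> v \<in> tangent_cone M d x
      then sqrt ((tlen u)\<^sup>2 + (tlen v)\<^sup>2 - 2 * tinner M d x u v) else 0)"

definition tlog :: "'a set \<Rightarrow> ('a \<Rightarrow> 'a \<Rightarrow> real) \<Rightarrow> 'a \<Rightarrow> 'a \<Rightarrow> 'a tangent" where
  "tlog M d x a = (if a = x then Apex else tpoint (d x a) (direction_to M d x a))"

definition hilbert_hadamard_space :: "'a set \<Rightarrow> ('a \<Rightarrow> 'a \<Rightarrow> real) \<Rightarrow> bool" where
  "hilbert_hadamard_space M d \<longleftrightarrow>
     hadamard_space M d \<and> (\<forall>x\<in>M. flat_space (tangent_cone M d x) (tdist M d x))"


section \<open>Monotone vector fields and resolvents\<close>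

text \<open>The values of a vector field outside the carrier \<open>M\<close> are irrelevant.\<close>

type_synonym 'a vfield = "'a \<Rightarrow> 'a tangent set"

definition monotone_vfield :: "'a set \<Rightarrow> ('a \<Rightarrow> 'a \<Rightarrow> real) \<Rightarrow> 'a vfield \<Rightarrow> bool" where
  "monotone_vfield M d A \<longleftrightarrow>
     (\<forall>x\<in>M. A x \<subseteq> tangent_cone M d x) \<and>
     (\<forall>x\<in>M. \<forall>y\<in>M. \<forall>u\<in>A x. \<forall>v\<in>A y.
        tinner M d x u (tlog M d x y) \<le> - tinner M d y v (tlog M d y x))"

definition resolvent_set ::
    "'a set \<Rightarrow> ('a \<Rightarrow> 'a \<Rightarrow> real) \<Rightarrow> 'a vfield \<Rightarrow> real \<Rightarrow> 'a \<Rightarrow> 'a set" where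
  "resolvent_set M d A r x = {z \<in> M. tscale (1 / r) (tlog M d z x) \<in> A z}"

definition resolvent :: "'a set \<Rightarrow> ('a \<Rightarrow> 'a \<Rightarrow> real) \<Rightarrow> 'a vfield \<Rightarrow> real \<Rightarrow> 'a \<Rightarrow> 'a" where
  "resolvent M d A r x = the_elem (resolvent_set M d A r x)"

definition surjectivity_condition :: "'a set \<Rightarrow> ('a \<Rightarrow> 'a \<Rightarrow> real) \<Rightarrow> 'a vfield \<Rightarrow> bool" where
  "surjectivity_condition M d A \<longleftrightarrow> (\<forall>x\<in>M. \<forall>r>0. resolvent_set M d A r x \<noteq> {})"

definition resolvent_converges ::
    "'a set \<Rightarrow> ('a \<Rightarrow> 'a \<Rightarrow> real) \<Rightarrow> (nat \<Rightarrow> 'a vfield) \<Rightarrow> 'a vfield \<Rightarrow> bool" where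
  "resolvent_converges M d An A \<longleftrightarrow>
     (\<forall>x\<in>M. \<forall>r>0. limitin (Metric_space.mtopology M d)
        (\<lambda>n. resolvent M d (An n) r x) (resolvent M d A r x) sequentially)"


section \<open>Random vector fields and their integrals\<close>

definition mborel :: "'b set \<Rightarrow> ('b \<Rightarrow> 'b \<Rightarrow> real) \<Rightarrow> 'b measure" where
  "mborel K \<rho> = sigma K {U. openin (Metric_space.mtopology K \<rho>) U}"

definition random_monotone_vfield ::
    "'a set \<Rightarrow> ('a \<Rightarrow> 'a \<Rightarrow> real) \<Rightarrow> 'e measure \<Rightarrow> ('e \<Rightarrow> 'a vfield) \<Rightarrow> bool" where
  "random_monotone_vfield M d \<mu> A \<longleftrightarrow>
     (\<forall>e\<in>space \<mu>. monotone_vfield M d (A e) \<and> surjectivity_condition M d (A e)) \<and>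
     (\<forall>x\<in>M. \<forall>r>0. (\<lambda>e. resolvent M d (A e) r x) \<in> \<mu> \<rightarrow>\<^sub>M mborel M d)"

definition integrable_map ::
    "'b set \<Rightarrow> ('b \<Rightarrow> 'b \<Rightarrow> real) \<Rightarrow> 'e measure \<Rightarrow> ('e \<Rightarrow> 'b) \<Rightarrow> bool" where
  "integrable_map K \<rho> \<mu> \<phi> \<longleftrightarrow>
     \<phi> \<in> \<mu> \<rightarrow>\<^sub>M mborel K \<rho> \<and> (\<exists>z\<in>K. integrable \<mu> (\<lambda>e. \<rho> (\<phi> e) z))"

definition map_integral ::
    "'b set \<Rightarrow> ('b \<Rightarrow> 'b \<Rightarrow> real) \<Rightarrow> 'e measure \<Rightarrow> ('e \<Rightarrow> 'b) \<Rightarrow> 'b" where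
  "map_integral K \<rho> \<mu> \<phi> =
     (THE z. \<forall>y\<in>K. is_arg_min (\<lambda>z. \<integral>e. (\<rho> z (\<phi> e))\<^sup>2 - (\<rho> y (\<phi> e))\<^sup>2 \<partial>\<mu>) (\<lambda>z. z \<in> K) z)"

definition multi_integral ::
    "'b set \<Rightarrow> ('b \<Rightarrow> 'b \<Rightarrow> real) \<Rightarrow> 'e measure \<Rightarrow> ('e \<Rightarrow> 'b set) \<Rightarrow> 'b set" where
  "multi_integral K \<rho> \<mu> \<Phi> =
     {map_integral K \<rho> \<mu> \<phi> | \<phi>. integrable_map K \<rho> \<mu> \<phi> \<and> (\<forall>e\<in>space \<mu>. \<phi> e \<in> \<Phi> e)}"

definition integral_vfield ::
    "'a set \<Rightarrow> ('a \<Rightarrow> 'a \<Rightarrow> real) \<Rightarrow> 'e measure \<Rightarrow> ('e \<Rightarrow> 'a vfield) \<Rightarrow> 'a vfield" where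
  "integral_vfield M d \<mu> A x =
     multi_integral (tangent_cone M d x) (tdist M d x) \<mu> (\<lambda>e. A e x)"

definition integrable_vfield ::
    "'a set \<Rightarrow> ('a \<Rightarrow> 'a \<Rightarrow> real) \<Rightarrow> 'e measure \<Rightarrow> ('e \<Rightarrow> 'a vfield) \<Rightarrow> bool" where
  "integrable_vfield M d \<mu> A \<longleftrightarrow> surjectivity_condition M d (integral_vfield M d \<mu> A)"


section \<open>Inductive means\<close>

text \<open>Sequences are indexed from \<open>1\<close>; the means for \<open>n = 0\<close> have no meaning.\<close>

primrec ind_mean :: "'b set \<Rightarrow> ('b \<Rightarrow> 'b \<Rightarrow> real) \<Rightarrow> (nat \<Rightarrow> 'b) \<Rightarrow> nat \<Rightarrow> 'b" where
  "ind_mean K \<rho> x 0 = undefined"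
| "ind_mean K \<rho> x (Suc n) =
     (if n = 0 then x 1
      else geo_comb K \<rho> (1 / real (Suc n)) (ind_mean K \<rho> x n) (x (Suc n)))"

definition ind_mean_set ::
    "'b set \<Rightarrow> ('b \<Rightarrow> 'b \<Rightarrow> real) \<Rightarrow> (nat \<Rightarrow> 'b set) \<Rightarrow> nat \<Rightarrow> 'b set" where
  "ind_mean_set K \<rho> B n = {ind_mean K \<rho> x n | x. \<forall>i\<in>{1..n}. x i \<in> B i}"

definition ind_mean_vfield ::
    "'a set \<Rightarrow> ('a \<Rightarrow> 'a \<Rightarrow> real) \<Rightarrow> (nat \<Rightarrow> 'a vfield) \<Rightarrow> nat \<Rightarrow> 'a vfield" where
  "ind_mean_vfield M d A n x =
     ind_mean_set (tangent_cone M d x) (tdist M d x) (\<lambda>i. A i x) n"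

end

theory Submission
  imports Defs
begin

text \<open>
  Let \<open>z\<close> be the resolvent of the integral field at \<open>(y, m)\<close>. Then \<open>w = (1/m) log\<^sub>z y\<close> is the
  barycenter of a measurable selection \<open>\<phi>(e) \<in> A(e, z)\<close>, and the inductive means \<open>v\<^sub>n\<close> of
  \<open>\<phi>(\<xi>\<^sub>1), \<dots>, \<phi>(\<xi>\<^sub>n)\<close> lie in the \<open>n\<close>-th mean field at \<open>z\<close>. Comparing the resolvent \<open>z\<^sub>n\<close> of
  the \<open>n\<close>-th mean field with \<open>z\<close> by monotonicity, and bounding the inner products of logarithms below by
  Euclidean ones, gives \<open>d(z\<^sub>n, z) \<le> m d\<^sub>z(w, v\<^sub>n)\<close>, and the right side tends to \<open>0\<close> by the strong law of
  large numbers in \<open>T\<^sub>z\<close>. The same comparison at nearby \<open>(x, l)\<close> is stable, so a countable dense set of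
  parameters suffices, and the limit is identified on a single \<open>\<omega>\<close> that is good for
  \<open>(x, l)\<close> as well.

  The strong law holds in any separable flat Hadamard space. There the functions
  \<open>x \<mapsto> \<rho>(p, x)\<^sup>2 - \<rho>(q, x)\<^sup>2\<close> are affine and \<open>2 \<rho>(p, q)\<close>-Lipschitz, so that inductive means are ordinary
  averages. Finitely valued variables reduce to convergence of frequencies, and the general case follows
  by approximation in \<open>L\<^sup>1\<close> with a maximal inequality.

  That a tangent cone is geodesic follows since its distance is the limit of
  \<open>\<rho>(\<gamma>(a\<epsilon>), \<eta>(b\<epsilon>)) / \<epsilon>\<close> and the logarithm does not increase distances: rescaled logarithms
  of convex combinations of \<open>\<gamma>(a\<epsilon>)\<close> and \<open>\<eta>(b\<epsilon>)\<close> satisfy (CN) up to an error that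
  vanishes with \<open>\<epsilon>\<close>.
\<close>


section \<open>Hadamard spaces and flat Hadamard spaces\<close>

text \<open>No vector space structure is built on flat spaces. The functions
  \<open>\<Delta> p q\<close> play the part of continuous linear functionals, and a distance is
  recovered by testing with the functional that belongs to the pair itself. The null set of the
  strong law depends on the tangent cone and on the selection, hence on the parameters, so that no
  single \<omega> is known to serve all of them directly. Stability in the parameters is therefore
  made deterministic, with a radius that does not depend on \<omega>; and nearness of two resolvents
  of the integral field, a statement free of \<omega>, may then be proved on any one convenient
  \<omega>. In the strong law the approximation error must be small for all n at once, which is what
  the maximal inequality provides. In tangent cones the obstacle is that the quality of an
  approximate convex combination depends on the test point, so the existence of geodesics is reduced
  to a condition with two test points at a time.\<close>

locale hadamard = Metric_space K \<rho> for K :: "'b set" and \<rho> :: "'b \<Rightarrow> 'b \<Rightarrow> real" +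
  assumes complete: "mcomplete"
    and geodesic_exists: "\<And>x y. x \<in> K \<Longrightarrow> y \<in> K \<Longrightarrow> \<exists>l \<gamma>. geodesic K \<rho> l \<gamma> \<and> \<gamma> 0 = x \<and> \<gamma> l = y"
    and CN: "\<And>l \<gamma> x t. geodesic K \<rho> l \<gamma> \<Longrightarrow> x \<in> K \<Longrightarrow> t \<in> {0..1} \<Longrightarrow>
      (\<rho> (\<gamma> (t * l)) x)\<^sup>2 \<le> (1 - t) * (\<rho> (\<gamma> 0) x)\<^sup>2 + t * (\<rho> (\<gamma> l) x)\<^sup>2
        - t * (1 - t) * (\<rho> (\<gamma> 0) (\<gamma> l))\<^sup>2"
begin

abbreviation ang where "ang \<equiv> angle K \<rho>"
abbreviation Dirs where "Dirs \<equiv> directions K \<rho>"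
abbreviation inn where "inn \<equiv> tinner K \<rho>"
abbreviation lg where "lg \<equiv> tlog K \<rho>"

lemma geodesic_length:
  assumes "geodesic K \<rho> l \<gamma>"
  shows "\<rho> (\<gamma> 0) (\<gamma> l) = l"
  using assms unfolding geodesic_def by force

text \<open>Apply (CN) along \<open>\<gamma>\<close> to the point \<open>\<eta> s\<close>. With
  \<open>s = t * l\<close> the right side is \<open>(1 - t) * t^2 * l^2 + t * (1 - t)^2 * l^2 - t *
  (1 - t) * l^2\<close>, which vanishes.\<close>

lemma geodesic_unique:
  assumes "geodesic K \<rho> l \<gamma>" "geodesic K \<rho> l' \<eta>" "\<gamma> 0 = \<eta> 0" "\<gamma> l = \<eta> l'"
  shows "\<gamma> = \<eta>"
proof
  fix s
  have l: "l' = l" using geodesic_length[OF assms(1)] geodesic_length[OF assms(2)] assms(3,4) by simp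
  have l0: "0 \<le> l" using assms(1) by (simp add: geodesic_def)
  show "\<gamma> s = \<eta> s"
  proof (cases "s \<in> {0..l}")
    case False
    then show ?thesis using assms(1,2) unfolding geodesic_def l by (auto simp: PiE_def extensional_def)
  next
    case True
    \<comment> \<open>If \<open>l = 0\<close>, the quotient is \<open>0\<close> by convention and
      \<open>t * l = s\<close> still holds.\<close>
    define t where "t = s / l"
    have t: "t \<in> {0..1}" "t * l = s"
      using True l0 unfolding t_def by (auto simp: divide_le_eq_1)
    have in_K: "\<gamma> s \<in> K" "\<eta> s \<in> K" using assms(1,2) True unfolding geodesic_def l by auto
    have d: "\<rho> (\<gamma> 0) (\<eta> s) = s" "\<rho> (\<gamma> l) (\<eta> s) = l - s"
      using assms(2) True unfolding geodesic_def l assms(3) assms(4) by force+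
    have "(\<rho> (\<gamma> (t * l)) (\<eta> s))\<^sup>2 \<le> (1 - t) * s\<^sup>2 + t * (l - s)\<^sup>2 - t * (1 - t) * l\<^sup>2"
      using CN[OF assms(1) in_K(2) t(1)] d
        geodesic_length[OF assms(1)] by simp
    also have "\<dots> = 0" unfolding t(2)[symmetric] by algebra
    finally show ?thesis using in_K t(2) by simp
  qed
qed

lemma geod_geodesic:
  assumes "x \<in> K" "y \<in> K"
  shows "geodesic K \<rho> (\<rho> x y) (geod K \<rho> x y) \<and> geod K \<rho> x y 0 = x \<and> geod K \<rho> x y (\<rho> x y) = y"
proof -
  obtain l \<gamma> where g: "geodesic K \<rho> l \<gamma>" "\<gamma> 0 = x" "\<gamma> l = y" using geodesic_exists assms by blast
  then have "l = \<rho> x y" using geodesic_length by force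
  with g have g: "geodesic K \<rho> (\<rho> x y) \<gamma> \<and> \<gamma> 0 = x \<and> \<gamma> (\<rho> x y) = y" by simp
  then show ?thesis unfolding geod_def by (rule theI[where a = \<gamma>]) (use g geodesic_unique[of _ _ _ \<gamma>] in auto)
qed

lemma comb_in [simp]:
  assumes "x \<in> K" "y \<in> K" "0 \<le> t" "t \<le> 1"
  shows "geo_comb K \<rho> t x y \<in> K"
proof -
  have "t * \<rho> x y \<in> {0..\<rho> x y}" using assms by (auto simp: mult_left_le_one_le)
  then show ?thesis using geod_geodesic[OF assms(1,2)] unfolding geo_comb_def geodesic_def by blast
qed

end

section \<open>Affine functions on flat Hadamard spaces and their averages\<close>

locale flat_hadamard = hadamard K \<rho> for K :: "'b set" and \<rho> +
  assumes flat: "flat_space K \<rho>"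
begin

lemma comb_dist:
  assumes "x \<in> K" "y \<in> K" "p \<in> K" "0 \<le> t" "t \<le> 1"
  shows "(\<rho> p (geo_comb K \<rho> t x y))\<^sup>2
    = (1 - t) * (\<rho> p x)\<^sup>2 + t * (\<rho> p y)\<^sup>2 - t * (1 - t) * (\<rho> x y)\<^sup>2"
  using flat[unfolded flat_space_def, rule_format, OF assms(3), of t, OF _
      conjunct1[OF geod_geodesic[OF assms(1,2)]]] assms(4,5) geod_geodesic[OF assms(1,2)]
  unfolding geo_comb_def by (simp add: commute)

text \<open>The distance of a point of the segment from \<open>a\<close> to \<open>d\<close> to the corresponding point of the
  segment from \<open>b\<close> to \<open>c\<close> has a nonnegative square, which is a quadratic form.\<close>

lemma quasilinear_aux:
  assumes "a \<in> K" "b \<in> K" "c \<in> K" "d \<in> K" "0 \<le> t" "t \<le> 1"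
  shows "(\<rho> (geo_comb K \<rho> t a d) (geo_comb K \<rho> t b c))\<^sup>2 = (1 - t)\<^sup>2 * (\<rho> a b)\<^sup>2 + t\<^sup>2 * (\<rho> c d)\<^sup>2
    + t * (1 - t) * ((\<rho> a c)\<^sup>2 + (\<rho> b d)\<^sup>2 - (\<rho> a d)\<^sup>2 - (\<rho> b c)\<^sup>2)"
proof -
  let ?u = "geo_comb K \<rho> t a d" and ?v = "geo_comb K \<rho> t b c"
  have "(\<rho> ?u ?v)\<^sup>2 = (1 - t) * (\<rho> ?u b)\<^sup>2 + t * (\<rho> ?u c)\<^sup>2 - t * (1 - t) * (\<rho> b c)\<^sup>2"
    using assms by (simp add: comb_dist)
  moreover have "(\<rho> ?u b)\<^sup>2 = (1 - t) * (\<rho> a b)\<^sup>2 + t * (\<rho> b d)\<^sup>2 - t * (1 - t) * (\<rho> a d)\<^sup>2"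
    "(\<rho> ?u c)\<^sup>2 = (1 - t) * (\<rho> a c)\<^sup>2 + t * (\<rho> c d)\<^sup>2 - t * (1 - t) * (\<rho> a d)\<^sup>2"
    using comb_dist[of a d b t] comb_dist[of a d c t] assms by (simp_all add: commute)
  ultimately show ?thesis by algebra
qed

text \<open>In a Hilbert space the left side is twice the inner product of \<open>a - b\<close> and
  \<open>c - d\<close>, so this is the Cauchy-Schwarz inequality for quasilinearization in the sense
  of Berg and Nikolaev.\<close>

lemma quasilinear_Cauchy_Schwarz:
  assumes "a \<in> K" "b \<in> K" "c \<in> K" "d \<in> K"
  shows "(\<rho> a d)\<^sup>2 + (\<rho> b c)\<^sup>2 - (\<rho> a c)\<^sup>2 - (\<rho> b d)\<^sup>2 \<le> 2 * \<rho> a b * \<rho> c d"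
proof (cases "a = b \<or> c = d")
  case True
  then show ?thesis using assms by auto
next
  case False
  let ?p = "\<rho> a b" and ?q = "\<rho> c d"
  define X where "X = (\<rho> a c)\<^sup>2 + (\<rho> b d)\<^sup>2 - (\<rho> a d)\<^sup>2 - (\<rho> b c)\<^sup>2"
  have pq: "?p > 0" "?q > 0" using False assms nonneg by (simp_all add: order_less_le)
  \<comment> \<open>This parameter gives \<open>(1 - t) * ?p = t * ?q\<close>: the two vectors enter
    the quadratic form with equal length, which makes its nonnegativity sharp.\<close>
  define t where "t = ?p / (?p + ?q)"
  have t: "0 \<le> t" "t \<le> 1" "1 - t = ?q / (?p + ?q)" using pq unfolding t_def by (auto simp: field_simps)
  have "0 \<le> (1 - t)\<^sup>2 * ?p\<^sup>2 + t\<^sup>2 * ?q\<^sup>2 + t * (1 - t) * X"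
    using quasilinear_aux[OF assms t(1,2)] unfolding X_def by (metis zero_le_power2)
  also have "\<dots> = ?p * ?q / (?p + ?q)\<^sup>2 * (2 * ?p * ?q + X)"
    unfolding t(3) unfolding t_def
    by (simp add: power_divide power2_eq_square add_divide_distrib distrib_left algebra_simps)
  finally have "0 \<le> 2 * ?p * ?q + X"
    using mult_le_cancel_left_pos[of "?p * ?q / (?p + ?q)\<^sup>2" 0 "2 * ?p * ?q + X"] pq by simp
  then show ?thesis unfolding X_def by simp
qed

text \<open>In a Hilbert space this is the linear functional of \<open>2 (q - p)\<close>, evaluated
  at \<open>x\<close>, plus a constant.\<close>

definition \<Delta> :: "'b \<Rightarrow> 'b \<Rightarrow> 'b \<Rightarrow> real" where
  "\<Delta> p q x = (\<rho> p x)\<^sup>2 - (\<rho> q x)\<^sup>2"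

lemma Delta_comb:
  assumes "x \<in> K" "y \<in> K" "p \<in> K" "q \<in> K" "0 \<le> t" "t \<le> 1"
  shows "\<Delta> p q (geo_comb K \<rho> t x y) = (1 - t) * \<Delta> p q x + t * \<Delta> p q y"
  using assms unfolding \<Delta>_def by (simp add: comb_dist algebra_simps)

lemma Delta_Lipschitz:
  assumes "p \<in> K" "q \<in> K" "x \<in> K" "y \<in> K"
  shows "\<bar>\<Delta> p q x - \<Delta> p q y\<bar> \<le> 2 * \<rho> p q * \<rho> x y"
  using quasilinear_Cauchy_Schwarz[of p q y x] quasilinear_Cauchy_Schwarz[of p q x y] assms
  unfolding \<Delta>_def by (auto simp: commute abs_le_iff)

lemma Delta_diff_eq:
  assumes "x \<in> K" "y \<in> K"
  shows "\<Delta> y x x - \<Delta> y x y = 2 * (\<rho> x y)\<^sup>2"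
  using assms unfolding \<Delta>_def by (simp add: commute)

text \<open>The functional of the pair attains the distance: its increment between the two points is
  \<open>2 * (\<rho> x y)^2\<close>. One factor \<open>\<rho> x y\<close> cancels against the
  Lipschitz constant, which turns estimates of \<open>\<Delta>\<close> into estimates of
  distances.\<close>

lemma dist_le_if_Delta_le:
  assumes "x \<in> K" "y \<in> K" "\<Delta> y x x - \<Delta> y x y \<le> 2 * \<rho> x y * r" "0 \<le> r"
  shows "\<rho> x y \<le> r"
proof (cases "x = y")
  case False
  then have "\<rho> x y > 0" using assms nonneg by (simp add: order_less_le)
  then show ?thesis using assms(3) Delta_diff_eq[OF assms(1,2)] by (simp add: power2_eq_square)
qed (use assms in simp)

lemma ind_mean_Delta:
  assumes "n \<ge> 1" "\<And>i. i \<in> {1..n} \<Longrightarrow> x i \<in> K"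
  shows "ind_mean K \<rho> x n \<in> K \<and>
    (\<forall>p\<in>K. \<forall>q\<in>K. \<Delta> p q (ind_mean K \<rho> x n) = (\<Sum>i=1..n. \<Delta> p q (x i)) / real n)"
  using assms
proof (induction n rule: nat_induct_at_least)
  case base
  then show ?case by simp
next
  case (Suc n)
  let ?t = "1 / real (Suc n)"
  have IH: "ind_mean K \<rho> x n \<in> K" "\<And>p q. p \<in> K \<Longrightarrow> q \<in> K \<Longrightarrow>
      \<Delta> p q (ind_mean K \<rho> x n) = (\<Sum>i=1..n. \<Delta> p q (x i)) / real n"
    using Suc by auto
  have xS: "x (Suc n) \<in> K" using Suc by simp
  have t: "0 \<le> ?t" "?t \<le> 1" by auto
  have eq: "ind_mean K \<rho> x (Suc n) = geo_comb K \<rho> ?t (ind_mean K \<rho> x n) (x (Suc n))"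
    using Suc.hyps by simp
  have "(1 - ?t) * (S / real n) + ?t * D = (S + D) / real (Suc n)" for S D :: real
  proof -
    have "1 - ?t = real n / real (Suc n)" by (simp add: field_simps)
    then show ?thesis using Suc.hyps by (simp add: add_divide_distrib)
  qed
  then show ?case unfolding eq using IH xS t by (simp add: Delta_comb)
qed

lemma ind_mean_in:
  assumes "n \<ge> 1" "\<And>i. i \<in> {1..n} \<Longrightarrow> x i \<in> K"
  shows "ind_mean K \<rho> x n \<in> K"
  using ind_mean_Delta[of n x] assms by blast

text \<open>Both means are plain averages under the functional of the pair of means, so Lipschitz
  bounds add up term by term.\<close>

lemma dist_ind_mean_le:
  assumes "n \<ge> 1" "\<And>i. i \<in> {1..n} \<Longrightarrow> x i \<in> K" "\<And>i. i \<in> {1..n} \<Longrightarrow> y i \<in> K"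
  shows "\<rho> (ind_mean K \<rho> x n) (ind_mean K \<rho> y n) \<le> (\<Sum>i=1..n. \<rho> (x i) (y i)) / real n"
proof -
  let ?s = "ind_mean K \<rho> x n" and ?t = "ind_mean K \<rho> y n"
  have s: "?s \<in> K" "?t \<in> K" using ind_mean_in assms by auto
  have "\<Delta> ?t ?s ?s - \<Delta> ?t ?s ?t = (\<Sum>i=1..n. \<Delta> ?t ?s (x i) - \<Delta> ?t ?s (y i)) / real n"
    using ind_mean_Delta[of n x] ind_mean_Delta[of n y] assms s
    by (simp add: sum_subtractf diff_divide_distrib)
  also have "\<dots> \<le> (\<Sum>i=1..n. 2 * \<rho> ?s ?t * \<rho> (x i) (y i)) / real n"
    using Delta_Lipschitz[OF s(2,1)] assms by (intro divide_right_mono sum_mono) (auto simp: commute abs_le_iff)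
  also have "\<dots> = 2 * \<rho> ?s ?t * ((\<Sum>i=1..n. \<rho> (x i) (y i)) / real n)"
    by (simp add: sum_distrib_left)
  finally show ?thesis
    by (rule dist_le_if_Delta_le[OF s]) (auto intro!: divide_nonneg_nonneg sum_nonneg)
qed

text \<open>The weights are not normalized, so that the induction can pass to a subset; the new
  point is then mixed in with its share \<open>c k\<close> of the total.\<close>

lemma finite_barycenter:
  assumes "finite F" "F \<subseteq> K" "\<And>k. k \<in> F \<Longrightarrow> 0 \<le> c k" "sum c F > 0"
  shows "\<exists>w\<in>K. \<forall>p\<in>K. \<forall>q\<in>K. sum c F * \<Delta> p q w = (\<Sum>k\<in>F. c k * \<Delta> p q k)"
  using assms
proof (induction F rule: finite_induct)
  case (insert k F)
  let ?C = "sum c (insert k F)"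
  have k: "k \<in> K" and c: "0 \<le> c k" "0 \<le> sum c F" using insert by (auto intro: sum_nonneg)
  show ?case
  proof (cases "sum c F > 0")
    case True
    then obtain w where w: "w \<in> K" "\<And>p q. p \<in> K \<Longrightarrow> q \<in> K \<Longrightarrow> sum c F * \<Delta> p q w = (\<Sum>k\<in>F. c k * \<Delta> p q k)"
      using insert by auto
    define t where "t = c k / ?C"
    have C: "?C = c k + sum c F" using insert by simp
    have t: "0 \<le> t" "t \<le> 1" "?C * t = c k" "?C * (1 - t) = sum c F"
      using True c unfolding t_def C by (auto simp: field_simps)
    show ?thesis
    proof (intro bexI ballI)
      fix p q assume pq: "p \<in> K" "q \<in> K"
      have "?C * \<Delta> p q (geo_comb K \<rho> t w k) = (?C * (1 - t)) * \<Delta> p q w + (?C * t) * \<Delta> p q k"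
        using w(1) k pq t(1,2) by (simp add: Delta_comb algebra_simps)
      then show "?C * \<Delta> p q (geo_comb K \<rho> t w k) = (\<Sum>k\<in>insert k F. c k * \<Delta> p q k)"
        unfolding t using w(2)[OF pq] insert by simp
    qed (use w k t in simp)
  next
    case False
    \<comment> \<open>All weight sits on \<open>k\<close>, so \<open>k\<close> itself is the
      barycenter; the induction hypothesis asks for positive total weight and is silent
      here.\<close>
    then have z: "sum c F = 0" using c by simp
    then have "\<forall>k\<in>F. c k = 0" using insert by (subst (asm) sum_nonneg_eq_0_iff) auto
    then show ?thesis using insert z by (intro bexI[of _ k]) (auto simp: algebra_simps)
  qed
qed simp

end

section \<open>Metric quotients and completions\<close>

text \<open>Serves both quotients behind the space of directions: geodesics under the angle, and
  Cauchy sequences under the limit distance.\<close>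

locale pseudometric =
  fixes S :: "'b set" and \<delta> :: "'b \<Rightarrow> 'b \<Rightarrow> real"
  assumes \<delta>_nonneg: "p \<in> S \<Longrightarrow> q \<in> S \<Longrightarrow> 0 \<le> \<delta> p q"
    and \<delta>_refl: "p \<in> S \<Longrightarrow> \<delta> p p = 0"
    and \<delta>_sym: "p \<in> S \<Longrightarrow> q \<in> S \<Longrightarrow> \<delta> p q = \<delta> q p"
    and \<delta>_triangle: "p \<in> S \<Longrightarrow> q \<in> S \<Longrightarrow> r \<in> S \<Longrightarrow> \<delta> p r \<le> \<delta> p q + \<delta> q r"
begin

lemma mclass_eq: "p \<in> S \<Longrightarrow> mclass S \<delta> p = {q \<in> S. \<delta> p q = 0}"
  unfolding mclass_def by auto

lemma mquot_eq: "mquot S \<delta> = mclass S \<delta> ` S"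
  unfolding mquot_def mclass_def quotient_def by auto

lemma mclass_in: "p \<in> S \<Longrightarrow> mclass S \<delta> p \<in> mquot S \<delta>"
  unfolding mquot_eq by blast

lemma mem_mclass_self: "p \<in> S \<Longrightarrow> p \<in> mclass S \<delta> p"
  by (simp add: mclass_eq \<delta>_refl)

lemma \<delta>_cong:
  assumes "p \<in> S" "q \<in> S" "p' \<in> S" "q' \<in> S" "\<delta> p p' = 0" "\<delta> q q' = 0"
  shows "\<delta> p q = \<delta> p' q'"
proof -
  have "\<delta> p q \<le> \<delta> p p' + (\<delta> p' q' + \<delta> q' q)"
    using \<delta>_triangle[of p p' q] \<delta>_triangle[of p' q' q] assms by linarith
  moreover have "\<delta> p' q' \<le> \<delta> p' p + (\<delta> p q + \<delta> q q')"
    using \<delta>_triangle[of p' p q'] \<delta>_triangle[of p q q'] assms by linarith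
  ultimately show ?thesis using assms \<delta>_sym[of p p'] \<delta>_sym[of q q'] by simp
qed

lemma mclass_eq_iff:
  assumes "p \<in> S" "q \<in> S"
  shows "mclass S \<delta> p = mclass S \<delta> q \<longleftrightarrow> \<delta> p q = 0"
proof
  assume "mclass S \<delta> p = mclass S \<delta> q"
  then show "\<delta> p q = 0" using mem_mclass_self[OF assms(2)] assms by (auto simp: mclass_eq)
next
  assume "\<delta> p q = 0"
  then have "\<delta> p r = \<delta> q r" if "r \<in> S" for r
    using \<delta>_cong[of p r q r] that assms \<delta>_refl by simp
  then show "mclass S \<delta> p = mclass S \<delta> q" using assms by (auto simp: mclass_eq)
qed

lemma mquot_dist_mclass:
  assumes "p \<in> S" "q \<in> S"
  shows "mquot_dist S \<delta> (mclass S \<delta> p) (mclass S \<delta> q) = \<delta> p q"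
proof -
  have *: "\<delta> p' q' = \<delta> p q" if "p' \<in> mclass S \<delta> p" "q' \<in> mclass S \<delta> q" for p' q'
    by (rule \<delta>_cong[symmetric]) (use that assms in \<open>simp_all add: mclass_eq\<close>)
  have "(THE r. \<exists>p'\<in>mclass S \<delta> p. \<exists>q'\<in>mclass S \<delta> q. r = \<delta> p' q') = \<delta> p q"
  proof (rule the_equality)
    show "\<exists>p'\<in>mclass S \<delta> p. \<exists>q'\<in>mclass S \<delta> q. \<delta> p q = \<delta> p' q'"
      using mem_mclass_self assms by blast
  qed (auto simp: *)
  then show ?thesis unfolding mquot_dist_def by (simp add: mclass_in assms)
qed

lemma Metric_space_mquot: "Metric_space (mquot S \<delta>) (mquot_dist S \<delta>)"
proof
  show "0 \<le> mquot_dist S \<delta> X Y" for X Y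
    by (cases "X \<in> mquot S \<delta> \<and> Y \<in> mquot S \<delta>")
      (auto simp: mquot_eq mquot_dist_mclass \<delta>_nonneg, auto simp: mquot_dist_def mquot_eq)
  show "mquot_dist S \<delta> X Y = mquot_dist S \<delta> Y X" for X Y
  proof (cases "X \<in> mquot S \<delta> \<and> Y \<in> mquot S \<delta>")
    case True
    then show ?thesis by (auto simp: mquot_eq mquot_dist_mclass \<delta>_sym)
  qed (auto simp: mquot_dist_def)
  show "(mquot_dist S \<delta> X Y = 0) = (X = Y)" if XY: "X \<in> mquot S \<delta>" "Y \<in> mquot S \<delta>" for X Y
  proof -
    obtain p where "p \<in> S" "X = mclass S \<delta> p" using XY(1) unfolding mquot_eq by blast
    moreover obtain q where "q \<in> S" "Y = mclass S \<delta> q" using XY(2) unfolding mquot_eq by blast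
    ultimately show ?thesis by (simp add: mquot_dist_mclass mclass_eq_iff)
  qed
  show "mquot_dist S \<delta> X Z \<le> mquot_dist S \<delta> X Y + mquot_dist S \<delta> Y Z"
    if "X \<in> mquot S \<delta>" "Y \<in> mquot S \<delta>" "Z \<in> mquot S \<delta>" for X Y Z
    using that unfolding mquot_eq by (auto simp only: mquot_dist_mclass intro!: \<delta>_triangle)
qed

end

section \<open>Completion by Cauchy sequences\<close>

context Metric_space begin

abbreviation CS where "CS \<equiv> cauchy_seqs M d"
abbreviation cls where "cls \<equiv> mclass (cauchy_seqs M d) (lim_dist d)"
abbreviation cdist where "cdist \<equiv> completion_dist M d"
abbreviation emb where "emb \<equiv> completion_embed M d"

lemma cauchy_seqs_iff:
  "\<sigma> \<in> CS \<longleftrightarrow> range \<sigma> \<subseteq> M \<and> (\<forall>\<epsilon>>0. \<exists>N. \<forall>n n'. N \<le> n \<longrightarrow> N \<le> n' \<longrightarrow> d (\<sigma> n) (\<sigma> n') < \<epsilon>)"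
  unfolding cauchy_seqs_def MCauchy_def by simp

lemma lim_dist_tendsto:
  assumes "\<sigma> \<in> CS" "\<tau> \<in> CS"
  shows "(\<lambda>n. d (\<sigma> n) (\<tau> n)) \<longlonglongrightarrow> lim_dist d \<sigma> \<tau>"
proof -
  have "Cauchy (\<lambda>n. d (\<sigma> n) (\<tau> n))"
  proof (rule metric_CauchyI)
    fix e :: real assume "0 < e"
    then obtain N1 N2 where N: "\<forall>n n'. N1 \<le> n \<longrightarrow> N1 \<le> n' \<longrightarrow> d (\<sigma> n) (\<sigma> n') < e / 2"
      "\<forall>n n'. N2 \<le> n \<longrightarrow> N2 \<le> n' \<longrightarrow> d (\<tau> n) (\<tau> n') < e / 2"
      using assms unfolding cauchy_seqs_iff by (meson half_gt_zero)
    have M: "\<sigma> n \<in> M" "\<tau> n \<in> M" for n using assms unfolding cauchy_seqs_iff by auto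
    show "\<exists>K. \<forall>m\<ge>K. \<forall>n\<ge>K. dist (d (\<sigma> m) (\<tau> m)) (d (\<sigma> n) (\<tau> n)) < e"
    proof (intro exI[of _ "max N1 N2"] allI impI)
      fix m n assume "max N1 N2 \<le> m" "max N1 N2 \<le> n"
      then have "d (\<sigma> m) (\<sigma> n) < e / 2" "d (\<tau> m) (\<tau> n) < e / 2" using N by auto
      moreover have "d (\<sigma> m) (\<tau> m) \<le> d (\<sigma> m) (\<sigma> n) + d (\<sigma> n) (\<tau> n) + d (\<tau> m) (\<tau> n)"
        "d (\<sigma> n) (\<tau> n) \<le> d (\<sigma> m) (\<sigma> n) + d (\<sigma> m) (\<tau> m) + d (\<tau> m) (\<tau> n)"
        using triangle[of "\<sigma> m" "\<sigma> n" "\<tau> m"] triangle[of "\<sigma> n" "\<tau> n" "\<tau> m"]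
          triangle[of "\<sigma> n" "\<sigma> m" "\<tau> n"] triangle[of "\<sigma> m" "\<tau> m" "\<tau> n"] M
        by (auto simp: commute)
      ultimately show "dist (d (\<sigma> m) (\<tau> m)) (d (\<sigma> n) (\<tau> n)) < e"
        by (simp add: dist_real_def abs_less_iff)
    qed
  qed
  then show ?thesis unfolding lim_dist_def using Cauchy_convergent convergent_LIMSEQ_iff by blast
qed

lemma pseudometric_cauchy_seqs: "pseudometric (CS) (lim_dist d)"
proof
  fix \<sigma> \<tau> \<upsilon> assume \<sigma>: "\<sigma> \<in> CS"
  have "d (\<sigma> n) (\<sigma> n) = 0" for n using \<sigma> unfolding cauchy_seqs_iff by (auto intro!: mdist_zero)
  then show "lim_dist d \<sigma> \<sigma> = 0" unfolding lim_dist_def by simp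
  assume \<tau>: "\<tau> \<in> CS"
  show "0 \<le> lim_dist d \<sigma> \<tau>" by (rule LIMSEQ_le_const[OF lim_dist_tendsto[OF \<sigma> \<tau>]]) auto
  show "lim_dist d \<sigma> \<tau> = lim_dist d \<tau> \<sigma>" unfolding lim_dist_def by (simp add: commute)
  assume \<upsilon>: "\<upsilon> \<in> CS"
  show "lim_dist d \<sigma> \<upsilon> \<le> lim_dist d \<sigma> \<tau> + lim_dist d \<tau> \<upsilon>"
  proof (rule LIMSEQ_le[OF lim_dist_tendsto[OF \<sigma> \<upsilon>]])
    show "(\<lambda>n. d (\<sigma> n) (\<tau> n) + d (\<tau> n) (\<upsilon> n)) \<longlonglongrightarrow> lim_dist d \<sigma> \<tau> + lim_dist d \<tau> \<upsilon>"
      by (intro tendsto_add lim_dist_tendsto \<sigma> \<tau> \<upsilon>)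
    have "\<sigma> n \<in> M" "\<tau> n \<in> M" "\<upsilon> n \<in> M" for n using \<sigma> \<tau> \<upsilon> unfolding cauchy_seqs_iff by auto
    then show "\<exists>N. \<forall>n\<ge>N. d (\<sigma> n) (\<upsilon> n) \<le> d (\<sigma> n) (\<tau> n) + d (\<tau> n) (\<upsilon> n)"
      using triangle by blast
  qed
qed

interpretation cs: pseudometric "CS" "lim_dist d"
  by (rule pseudometric_cauchy_seqs)

lemma Metric_space_completion: "Metric_space (completion M d) (cdist)"
  unfolding completion_def completion_dist_def by (rule cs.Metric_space_mquot)

lemma const_in_cauchy_seqs: "a \<in> M \<Longrightarrow> (\<lambda>_. a) \<in> CS"
  unfolding cauchy_seqs_iff by auto

lemma completion_embed_in: "a \<in> M \<Longrightarrow> emb a \<in> completion M d"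
  unfolding completion_embed_def completion_def by (intro cs.mclass_in const_in_cauchy_seqs)

lemma completion_dist_embed:
  "a \<in> M \<Longrightarrow> b \<in> M \<Longrightarrow> cdist (emb a) (emb b) = d a b"
  unfolding completion_embed_def completion_dist_def
  by (simp add: cs.mquot_dist_mclass const_in_cauchy_seqs) (simp add: lim_dist_def)

lemma completion_embed_tendsto:
  assumes "\<sigma> \<in> CS"
  shows "(\<lambda>n. cdist (emb (\<sigma> n)) (cls \<sigma>)) \<longlonglongrightarrow> 0"
proof (rule LIMSEQ_I)
  fix e :: real assume "0 < e"
  then obtain N where N: "\<forall>n n'. N \<le> n \<longrightarrow> N \<le> n' \<longrightarrow> d (\<sigma> n) (\<sigma> n') < e / 2"
    using assms unfolding cauchy_seqs_iff by (meson half_gt_zero)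
  have M: "\<sigma> n \<in> M" for n using assms unfolding cauchy_seqs_iff by auto
  have "lim_dist d (\<lambda>_. \<sigma> n) \<sigma> \<le> e / 2" if "n \<ge> N" for n
    by (rule LIMSEQ_le_const2[OF lim_dist_tendsto[OF const_in_cauchy_seqs[OF M] assms]])
      (use N that in \<open>auto intro: less_imp_le\<close>)
  then have "norm (cdist (emb (\<sigma> n)) (cls \<sigma>) - 0) < e"
    if "n \<ge> N" for n
    unfolding completion_embed_def completion_dist_def
    using that \<open>0 < e\<close> cs.\<delta>_nonneg[OF const_in_cauchy_seqs[OF M] assms, of n]
    by (simp add: cs.mquot_dist_mclass const_in_cauchy_seqs M assms) fastforce
  then show "\<exists>N. \<forall>n\<ge>N. norm (cdist (emb (\<sigma> n)) (cls \<sigma>) - 0) < e"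
    by blast
qed

lemma completion_dense:
  assumes "X \<in> completion M d" "0 < e"
  shows "\<exists>a\<in>M. cdist (emb a) X < e"
proof -
  obtain \<sigma> where \<sigma>: "\<sigma> \<in> CS" "X = cls \<sigma>"
    using assms(1) unfolding completion_def cs.mquot_eq by blast
  have "\<forall>\<^sub>F n in sequentially. cdist (emb (\<sigma> n)) X < e"
    using order_tendstoD(2)[OF completion_embed_tendsto[OF \<sigma>(1)] assms(2)] unfolding \<sigma>(2) .
  then obtain n where "cdist (emb (\<sigma> n)) X < e"
    using eventually_happens'[OF sequentially_bot] by blast
  moreover have "\<sigma> n \<in> M" using \<sigma>(1) unfolding cauchy_seqs_iff by auto
  ultimately show ?thesis by blast
qed

text \<open>Replace the n-th term by an embedded point at distance less than
  \<open>1 / (n + 1)\<close>. These points form a Cauchy sequence of the original space, and its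
  class is the limit.\<close>

lemma mcomplete_completion: "Metric_space.mcomplete (completion M d) (cdist)"
proof -
  interpret C: Metric_space "completion M d" "cdist" by (rule Metric_space_completion)
  show ?thesis unfolding C.mcomplete_def
  proof (intro allI impI)
    fix X assume X: "C.MCauchy X"
    then have XC: "X n \<in> completion M d" for n unfolding C.MCauchy_def by auto
    obtain \<sigma> where \<sigma>: "\<And>n. \<sigma> n \<in> M"
      "\<And>n. cdist (emb (\<sigma> n)) (X n) < 1 / real (Suc n)"
    proof -
      have "\<forall>n. \<exists>a. a \<in> M \<and> cdist (emb a) (X n) < 1 / real (Suc n)"
        using completion_dense[OF XC] by (metis of_nat_0_less_iff zero_less_Suc zero_less_divide_1_iff)
      then show ?thesis using that by metis
    qed
    let ?e = "\<lambda>n. emb (\<sigma> n)"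
    have e: "?e n \<in> completion M d" for n using \<sigma> completion_embed_in by blast
    have 0: "(\<lambda>n. cdist (?e n) (X n)) \<longlonglongrightarrow> 0"
      by (rule tendsto_sandwich[OF _ _ tendsto_const LIMSEQ_inverse_real_of_nat])
        (use \<sigma> in \<open>auto intro!: always_eventually less_imp_le simp: inverse_eq_divide\<close>)
    have "\<sigma> \<in> CS" unfolding cauchy_seqs_iff
    proof (intro conjI allI impI)
      fix \<epsilon> :: real assume "0 < \<epsilon>"
      then have "0 < \<epsilon> / 3" by simp
      then obtain N1 where N1: "\<And>n n'. N1 \<le> n \<Longrightarrow> N1 \<le> n' \<Longrightarrow> cdist (X n) (X n') < \<epsilon> / 3"
        using X unfolding C.MCauchy_def by blast
      obtain N2 where N2: "\<And>n. N2 \<le> n \<Longrightarrow> cdist (?e n) (X n) < \<epsilon> / 3"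
        using order_tendstoD(2)[OF 0 \<open>0 < \<epsilon> / 3\<close>] unfolding eventually_sequentially by blast
      show "\<exists>N. \<forall>n n'. N \<le> n \<longrightarrow> N \<le> n' \<longrightarrow> d (\<sigma> n) (\<sigma> n') < \<epsilon>"
      proof (intro exI[of _ "max N1 N2"] allI impI)
        fix n n' assume "max N1 N2 \<le> n" "max N1 N2 \<le> n'"
        then have "cdist (X n) (X n') < \<epsilon> / 3" "cdist (?e n) (X n) < \<epsilon> / 3"
          "cdist (?e n') (X n') < \<epsilon> / 3" using N1 N2 by auto
        moreover have "d (\<sigma> n) (\<sigma> n') = cdist (?e n) (?e n')"
          using \<sigma> completion_dist_embed by simp
        moreover have "\<dots> \<le> cdist (?e n) (X n) + cdist (X n) (X n')
            + cdist (?e n') (X n')"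
          using C.triangle[OF e[of n] XC[of n] e[of n']] C.triangle[OF XC[of n] XC[of n'] e[of n']]
          by (simp add: C.commute)
        ultimately show "d (\<sigma> n) (\<sigma> n') < \<epsilon>" by linarith
      qed
    qed (use \<sigma> in auto)
    then have *: "(\<lambda>n. cdist (?e n) (cls \<sigma>)) \<longlonglongrightarrow> 0"
      and L: "cls \<sigma> \<in> completion M d"
      unfolding completion_def by (auto intro: completion_embed_tendsto cs.mclass_in)
    have "(\<lambda>n. cdist (X n) (cls \<sigma>)) \<longlonglongrightarrow> 0"
    proof (rule tendsto_sandwich[OF _ _ tendsto_const])
      show "(\<lambda>n. cdist (?e n) (X n) +
          cdist (?e n) (cls \<sigma>)) \<longlonglongrightarrow> 0"
        using tendsto_add[OF 0 *] by simp
      show "\<forall>\<^sub>F n in sequentially. cdist (X n) (cls \<sigma>)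
          \<le> cdist (?e n) (X n) + cdist (?e n) (cls \<sigma>)"
        using C.triangle[OF XC e L] by (simp add: C.commute)
    qed auto
    then have "limitin C.mtopology X (cls \<sigma>) sequentially"
      unfolding C.limitin_metric_dist_null using L XC by simp
    then show "\<exists>x. limitin C.mtopology X x sequentially" by blast
  qed
qed

end

section \<open>Comparison angles\<close>

text \<open>If \<open>\<gamma>\<close> exceeded \<open>\<alpha> + \<beta>\<close>, this sum would be
  below \<open>pi\<close>, and sectors of angles \<open>\<alpha>\<close> and \<open>\<beta>\<close>
  could be laid side by side in the plane. A straight segment across both would then be shorter than
  the side that the law of cosines assigns to \<open>\<gamma>\<close>, against the assumed
  inequality.\<close>

lemma angle_le_add_if_cone_triangle:
  fixes \<alpha> \<beta> \<gamma> :: real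
  assumes rng: "\<alpha> \<in> {0..pi}" "\<beta> \<in> {0..pi}" "\<gamma> \<in> {0..pi}"
    and tri: "\<And>a b c. 0 \<le> a \<Longrightarrow> 0 \<le> b \<Longrightarrow> 0 \<le> c \<Longrightarrow> sqrt (a\<^sup>2 + c\<^sup>2 - 2 * a * c * cos \<gamma>)
      \<le> sqrt (a\<^sup>2 + b\<^sup>2 - 2 * a * b * cos \<alpha>) + sqrt (b\<^sup>2 + c\<^sup>2 - 2 * b * c * cos \<beta>)"
  shows "\<gamma> \<le> \<alpha> + \<beta>"
proof (rule ccontr)
  assume "\<not> ?thesis"
  then have lt: "\<alpha> + \<beta> < \<gamma>" by simp
  show False
  proof (cases "\<alpha> = 0 \<or> \<beta> = 0")
    \<comment> \<open>The layout of the other case degenerates when a sine vanishes. Here unit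
      lengths suffice, as one summand on the right is zero.\<close>
    case True
    have "cos \<gamma> < cos (\<alpha> + \<beta>)" using lt rng by (intro cos_monotone_0_pi) auto
    then have "sqrt (2 - 2 * cos (\<alpha> + \<beta>)) < sqrt (2 - 2 * cos \<gamma>)" by simp
    also have "\<dots> \<le> sqrt (2 - 2 * cos \<alpha>) + sqrt (2 - 2 * cos \<beta>)" using tri[of 1 1 1] by simp
    finally show False using True by auto
  next
    case False
    text \<open>In a planar layout, \<open>B\<close> is the midpoint of points \<open>A\<close>, \<open>C\<close> on the outer rays that are
      equally far from the middle ray.\<close>
    let ?a = "sin \<beta>" and ?c = "sin \<alpha>" and ?b = "sin (\<alpha> + \<beta>) / 2"
    \<comment> \<open>The squared length of the whole segment by the law of cosines at the angle
      \<open>\<alpha> + \<beta>\<close>; each half then has squared length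
      \<open>h / 4\<close>.\<close>
    define h where "h = ?a\<^sup>2 + ?c\<^sup>2 - 2 * ?a * ?c * cos (\<alpha> + \<beta>)"
    have pos: "0 < ?a" "0 < ?c" "0 \<le> ?b"
      using False rng lt by (auto intro!: sin_gt_zero sin_ge_zero)
    have sq: "(cos \<alpha>)\<^sup>2 = 1 - (sin \<alpha>)\<^sup>2" "(cos \<beta>)\<^sup>2 = 1 - (sin \<beta>)\<^sup>2"
      using sin_cos_squared_add[of \<alpha>] sin_cos_squared_add[of \<beta>] by linarith+
    have AB: "?a\<^sup>2 + ?b\<^sup>2 - 2 * ?a * ?b * cos \<alpha> = h / 4" "?b\<^sup>2 + ?c\<^sup>2 - 2 * ?b * ?c * cos \<beta> = h / 4"
    proof -
      have r: "2 * ?b = sin \<alpha> * cos \<beta> + cos \<alpha> * sin \<beta>" by (simp add: sin_add)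
      have alg: "4 * (sb\<^sup>2 + r\<^sup>2 - 2 * sb * r * ca) = sb\<^sup>2 + sa\<^sup>2 - 2 * sb * sa * (ca * cb - sa * sb)"
        if "ca\<^sup>2 = 1 - sa\<^sup>2" "cb\<^sup>2 = 1 - sb\<^sup>2" "2 * r = sa * cb + ca * sb" for sa sb ca cb r :: real
        using that by algebra
      have quarter: "X = h / 4" if "4 * X = h" for X :: real using that by simp
      show "?a\<^sup>2 + ?b\<^sup>2 - 2 * ?a * ?b * cos \<alpha> = h / 4"
        unfolding h_def cos_add by (rule quarter[unfolded h_def cos_add, OF alg[OF sq r]])
      have "4 * (?b\<^sup>2 + ?c\<^sup>2 - 2 * ?b * ?c * cos \<beta>) = h"
        unfolding h_def cos_add using alg[OF sq(2,1), of ?b] r by (simp add: algebra_simps)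
      then show "?b\<^sup>2 + ?c\<^sup>2 - 2 * ?b * ?c * cos \<beta> = h / 4" by (rule quarter)
    qed
    have h0: "0 \<le> h"
    proof -
      have "h = (?a - ?c)\<^sup>2 + 2 * ?a * ?c * (1 - cos (\<alpha> + \<beta>))"
        unfolding h_def by (simp add: power2_eq_square algebra_simps)
      then show ?thesis using pos by simp
    qed
    have "sqrt (?a\<^sup>2 + ?c\<^sup>2 - 2 * ?a * ?c * cos \<gamma>) \<le> sqrt (h / 4) + sqrt (h / 4)"
      using tri[of ?a ?b ?c] pos unfolding AB by simp
    also have "\<dots> = sqrt h" by (simp add: real_sqrt_divide)
    finally have "?a * ?c * cos (\<alpha> + \<beta>) \<le> ?a * ?c * cos \<gamma>"
      unfolding h_def by simp
    then have "cos (\<alpha> + \<beta>) \<le> cos \<gamma>" using pos by simp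
    moreover have "cos \<gamma> < cos (\<alpha> + \<beta>)" using lt rng by (intro cos_monotone_0_pi) auto
    ultimately show False by simp
  qed
qed

lemma euclidean_comparison_triangle:
  fixes a b c :: real
  assumes "0 < a" "0 < b" "\<bar>a - b\<bar> \<le> c" "c \<le> a + b"
  shows "\<exists>x y z :: real^2. dist x y = a \<and> dist x z = b \<and> dist y z = c"
proof -
  define k where "k = (a\<^sup>2 + b\<^sup>2 - c\<^sup>2) / (2 * a * b)"
  define s where "s = sqrt (1 - k\<^sup>2)"
  have "(a - b)\<^sup>2 \<le> c\<^sup>2" "c\<^sup>2 \<le> (a + b)\<^sup>2"
    using assms power_mono[of "\<bar>a - b\<bar>" c 2] power_mono[of c "a + b" 2] by auto
  then have "\<bar>k\<bar> \<le> 1" using assms unfolding k_def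
    by (simp add: abs_le_iff divide_le_eq le_divide_eq power2_eq_square algebra_simps)
  then have ks: "k\<^sup>2 + s\<^sup>2 = 1" unfolding s_def by (simp add: abs_square_le_1)
  define e1 e2 :: "real^2" where "e1 = axis 1 1" and "e2 = axis 2 1"
  have e: "e1 \<bullet> e1 = 1" "e2 \<bullet> e2 = 1" "e1 \<bullet> e2 = 0" "e2 \<bullet> e1 = 0"
    unfolding e1_def e2_def by (simp_all add: inner_axis_axis)
  let ?y = "a *\<^sub>R e1" and ?z = "(b * k) *\<^sub>R e1 + (b * s) *\<^sub>R e2"
  have "dist 0 ?y = a" using assms e by (simp add: norm_eq_sqrt_inner)
  moreover have "(norm ?z)\<^sup>2 = b\<^sup>2"
  proof -
    have "(norm ?z)\<^sup>2 = b\<^sup>2 * (k\<^sup>2 + s\<^sup>2)" unfolding power2_norm_eq_inner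
      by (simp add: inner_simps e power2_eq_square algebra_simps)
    then show ?thesis using ks by simp
  qed
  then have "dist 0 ?z = b" using assms by (simp add: power2_eq_iff_nonneg)
  moreover have "(norm (?y - ?z))\<^sup>2 = c\<^sup>2"
  proof -
    have "(norm (?y - ?z))\<^sup>2 = a\<^sup>2 + b\<^sup>2 * (k\<^sup>2 + s\<^sup>2) - 2 * a * b * k" unfolding power2_norm_eq_inner
      by (simp add: inner_simps e power2_eq_square algebra_simps)
    also have "\<dots> = c\<^sup>2" unfolding ks using assms by (simp add: k_def)
    finally show ?thesis .
  qed
  then have "dist ?y ?z = c" using assms unfolding dist_norm by (simp add: power2_eq_iff_nonneg)
  ultimately show ?thesis by blast
qed

lemma eventually_at_right_0_prod:
  fixes s0 t0 :: real
  assumes "0 < s0" "0 < t0"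
  shows "\<forall>\<^sub>F (s, t) in at_right 0 \<times>\<^sub>F at_right 0. 0 < s \<and> s \<le> s0 \<and> 0 < t \<and> t \<le> t0"
proof -
  have "\<forall>\<^sub>F s in at_right 0. 0 < s \<and> s \<le> r" if "0 < r" for r :: real
    using eventually_at_right_real[OF that] by (rule eventually_mono) auto
  from eventually_prodI[OF this[OF assms(1)] this[OF assms(2)]] show ?thesis
    by (rule eventually_mono) auto
qed

context hadamard begin

text \<open>The law of cosines at \<open>x\<close>. Cosines are algebraic in the distances, so
  \<open>arccos\<close> can be postponed to the limit. If \<open>y\<close> or \<open>z\<close>
  equals a point \<open>x\<close> of \<open>K\<close>, division by zero gives the value
  \<open>0\<close>.\<close>

definition ccos :: "'b \<Rightarrow> 'b \<Rightarrow> 'b \<Rightarrow> real" where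
  "ccos x y z = ((\<rho> x y)\<^sup>2 + (\<rho> x z)\<^sup>2 - (\<rho> y z)\<^sup>2) / (2 * \<rho> x y * \<rho> x z)"

lemma abs_ccos_le_1:
  assumes "x \<in> K" "y \<in> K" "z \<in> K"
  shows "\<bar>ccos x y z\<bar> \<le> 1"
proof (cases "x = y \<or> x = z")
  case True
  then show ?thesis using assms unfolding ccos_def by auto
next
  case False
  then have pos: "0 < \<rho> x y" "0 < \<rho> x z" using assms by auto
  have "\<bar>\<rho> x y - \<rho> x z\<bar> \<le> \<rho> y z" "\<rho> y z \<le> \<rho> x y + \<rho> x z"
    using mdist_reverse_triangle[of y x z] triangle[of y x z] assms by (auto simp: commute)
  then have "(\<rho> x y - \<rho> x z)\<^sup>2 \<le> (\<rho> y z)\<^sup>2" "(\<rho> y z)\<^sup>2 \<le> (\<rho> x y + \<rho> x z)\<^sup>2"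
    using power_mono[of "\<bar>\<rho> x y - \<rho> x z\<bar>" "\<rho> y z" 2] power_mono[of "\<rho> y z" "\<rho> x y + \<rho> x z" 2] by auto
  then show ?thesis using pos unfolding ccos_def
    by (simp add: abs_le_iff divide_le_eq le_divide_eq power2_eq_square algebra_simps)
qed

lemma comparison_angle_eq:
  assumes "x \<in> K" "y \<in> K" "z \<in> K" "x \<noteq> y" "x \<noteq> z"
  shows "comparison_angle \<rho> x y z = arccos (ccos x y z)"
proof -
  have pos: "0 < \<rho> x y" "0 < \<rho> x z" using assms by auto
  have *: "arccos (((y' - x') \<bullet> (z' - x')) / (norm (y' - x') * norm (z' - x'))) = arccos (ccos x y z)"
    if "dist x' y' = \<rho> x y" "dist x' z' = \<rho> x z" "dist y' z' = \<rho> y z" for x' y' z' :: "real^2"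
  proof -
    have "norm (y' - x') = \<rho> x y" "norm (z' - x') = \<rho> x z" "norm ((y' - x') - (z' - x')) = \<rho> y z"
      using that by (simp_all add: dist_norm norm_minus_commute)
    then show ?thesis unfolding ccos_def by (simp add: dot_norm_neg[of "y' - x'" "z' - x'"] divide_divide_eq_left mult_ac)
  qed
  obtain x' y' z' :: "real^2" where "dist x' y' = \<rho> x y" "dist x' z' = \<rho> x z" "dist y' z' = \<rho> y z"
  proof -
    have "\<bar>\<rho> x y - \<rho> x z\<bar> \<le> \<rho> y z" "\<rho> y z \<le> \<rho> x y + \<rho> x z"
      using mdist_reverse_triangle[of y x z] triangle[of y x z] assms by (auto simp: commute)
    from euclidean_comparison_triangle[OF pos this] show ?thesis using that by blast
  qed
  then show ?thesis unfolding comparison_angle_def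
    by (intro the_equality, intro exI[of _ x'] exI[of _ y'] exI[of _ z']) (auto simp: *)
qed

lemma geodesics_fromD:
  assumes "p \<in> geodesics_from K \<rho> x"
  shows "0 < fst p" "snd p 0 = x" "geodesic K \<rho> (fst p) (snd p)"
    and "\<And>s. 0 \<le> s \<Longrightarrow> s \<le> fst p \<Longrightarrow> snd p s \<in> K"
    and "\<And>s t. 0 \<le> s \<Longrightarrow> s \<le> fst p \<Longrightarrow> 0 \<le> t \<Longrightarrow> t \<le> fst p \<Longrightarrow> \<rho> (snd p s) (snd p t) = \<bar>s - t\<bar>"
    and "\<And>s. 0 \<le> s \<Longrightarrow> s \<le> fst p \<Longrightarrow> \<rho> x (snd p s) = s"
proof -
  obtain l \<gamma> where p: "p = (l, \<gamma>)" "geodesic K \<rho> l \<gamma>" "\<gamma> 0 = x" "0 < l"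
    using assms unfolding geodesics_from_def by auto
  show "0 < fst p" "snd p 0 = x" "geodesic K \<rho> (fst p) (snd p)" using p by auto
  show "\<And>s. 0 \<le> s \<Longrightarrow> s \<le> fst p \<Longrightarrow> snd p s \<in> K" using p unfolding geodesic_def by auto
  show *: "\<And>s t. 0 \<le> s \<Longrightarrow> s \<le> fst p \<Longrightarrow> 0 \<le> t \<Longrightarrow> t \<le> fst p \<Longrightarrow> \<rho> (snd p s) (snd p t) = \<bar>s - t\<bar>"
    using p unfolding geodesic_def by auto
  show "\<And>s. 0 \<le> s \<Longrightarrow> s \<le> fst p \<Longrightarrow> \<rho> x (snd p s) = s"
    using *[of 0] p by auto
qed

text \<open>Comparison angles do not grow when a point slides towards the vertex. This is (CN) for
  the piece of the geodesic from \<open>x\<close> to \<open>snd p s\<close>, evaluated at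
  \<open>s'\<close> and rearranged.\<close>

lemma ccos_antimono_left:
  assumes p: "p \<in> geodesics_from K \<rho> x" and z: "z \<in> K" "z \<noteq> x" and x: "x \<in> K"
    and s: "0 < s'" "s' \<le> s" "s \<le> fst p"
  shows "ccos x (snd p s) z \<le> ccos x (snd p s') z"
proof -
  define \<theta> where "\<theta> = s' / s"
  have \<theta>: "0 < \<theta>" "\<theta> \<le> 1" "\<theta> * s = s'" using s unfolding \<theta>_def by auto
  \<comment> \<open>The initial piece of \<open>p\<close>, set to \<open>undefined\<close> outside
    its interval because \<open>geodesic\<close> demands it.\<close>
  let ?\<eta> = "\<lambda>r. if r \<in> {0..s} then snd p r else undefined"
  have "geodesic K \<rho> s ?\<eta>"
    unfolding geodesic_def using geodesics_fromD[OF p] s by auto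
  from CN[OF this z(1), of \<theta>] have CN': "(\<rho> (snd p s') z)\<^sup>2
      \<le> (1 - \<theta>) * (\<rho> x z)\<^sup>2 + \<theta> * (\<rho> (snd p s) z)\<^sup>2 - \<theta> * (1 - \<theta>) * s\<^sup>2"
    using \<theta> s geodesics_fromD[OF p] by simp
  let ?b = "\<rho> x z"
  have b: "0 < ?b" using z x by auto
  have "ccos x (snd p s) z = (\<theta> * (s\<^sup>2 + ?b\<^sup>2 - (\<rho> (snd p s) z)\<^sup>2)) / (2 * s' * ?b)"
    unfolding ccos_def \<theta>(3)[symmetric] using geodesics_fromD(6)[OF p, of s] s \<theta>(1) by simp
  also have "\<dots> \<le> (s'\<^sup>2 + ?b\<^sup>2 - (\<rho> (snd p s') z)\<^sup>2) / (2 * s' * ?b)"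
  proof (rule divide_right_mono)
    have "s'\<^sup>2 = \<theta>\<^sup>2 * s\<^sup>2" using \<theta>(3) by (simp add: power_mult_distrib[symmetric])
    then show "\<theta> * (s\<^sup>2 + ?b\<^sup>2 - (\<rho> (snd p s) z)\<^sup>2) \<le> s'\<^sup>2 + ?b\<^sup>2 - (\<rho> (snd p s') z)\<^sup>2"
      using CN' by (simp add: algebra_simps power2_eq_square)
  qed (use s b in simp)
  also have "\<dots> = ccos x (snd p s') z"
    unfolding ccos_def using geodesics_fromD[OF p] s by simp
  finally show ?thesis .
qed

lemma ccos_sym: "ccos x y z = ccos x z y"
  unfolding ccos_def by (simp add: commute mult_ac add_ac)

lemma ccos_antimono:
  assumes p: "p \<in> geodesics_from K \<rho> x" and q: "q \<in> geodesics_from K \<rho> x" and x: "x \<in> K"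
    and s: "0 < s'" "s' \<le> s" "s \<le> fst p" and t: "0 < t'" "t' \<le> t" "t \<le> fst q"
  shows "ccos x (snd p s) (snd q t) \<le> ccos x (snd p s') (snd q t')"
proof -
  have ne: "snd p r \<noteq> x" if "0 < r" "r \<le> fst p" "p \<in> geodesics_from K \<rho> x" for r p
    using geodesics_fromD(6)[OF that(3), of r] that x by auto
  have "ccos x (snd p s) (snd q t) \<le> ccos x (snd p s') (snd q t)"
    using ccos_antimono_left[OF p _ _ x s] geodesics_fromD(4)[OF q, of t] ne[OF _ _ q, of t] t by auto
  also have "\<dots> \<le> ccos x (snd p s') (snd q t')"
    using ccos_antimono_left[OF q _ _ x t] geodesics_fromD(4)[OF p, of s'] ne[OF _ _ p, of s'] s
    by (auto simp: ccos_sym[of x "snd p s'"])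
  finally show ?thesis .
qed

text \<open>The cosine of the Alexandrov angle. Since \<open>ccos\<close> increases as the
  parameters decrease to \<open>0\<close>, the limit in the definition of the angle is a supremum,
  and its existence comes for free.\<close>

definition gcos :: "'b \<Rightarrow> 'b geo \<Rightarrow> 'b geo \<Rightarrow> real" where
  "gcos x p q = (SUP (s, t) \<in> {0<..fst p} \<times> {0<..fst q}. ccos x (snd p s) (snd q t))"

context
  fixes x p q
  assumes x: "x \<in> K" and p: "p \<in> geodesics_from K \<rho> x" and q: "q \<in> geodesics_from K \<rho> x"
begin

lemma ccos_geo_bounds:
  assumes "0 \<le> s" "s \<le> fst p" "0 \<le> t" "t \<le> fst q"
  shows "\<bar>ccos x (snd p s) (snd q t)\<bar> \<le> 1"
  using abs_ccos_le_1 x geodesics_fromD(4)[OF p] geodesics_fromD(4)[OF q] assms by simp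

lemma bdd_ccos: "bdd_above ((\<lambda>(s, t). ccos x (snd p s) (snd q t)) ` ({0<..fst p} \<times> {0<..fst q}))"
  using ccos_geo_bounds by (intro bdd_aboveI2[of _ _ 1]) (auto simp: abs_le_iff)

lemma ccos_le_gcos:
  assumes "0 < s" "s \<le> fst p" "0 < t" "t \<le> fst q"
  shows "ccos x (snd p s) (snd q t) \<le> gcos x p q"
  unfolding gcos_def using assms by (intro cSUP_upper2[OF bdd_ccos, of "(s, t)"]) auto

lemma gcos_tendsto:
  "((\<lambda>(s, t). ccos x (snd p s) (snd q t)) \<longlongrightarrow> gcos x p q) (at_right 0 \<times>\<^sub>F at_right 0)"
proof (rule order_tendstoI)
  fix a assume "a < gcos x p q"
  then obtain s0 t0 where st: "0 < s0" "s0 \<le> fst p" "0 < t0" "t0 \<le> fst q" "a < ccos x (snd p s0) (snd q t0)"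
    unfolding gcos_def using less_cSUP_iff[OF _ bdd_ccos] geodesics_fromD(1)[OF p] geodesics_fromD(1)[OF q] by auto
  from eventually_at_right_0_prod[OF st(1,3)] show "\<forall>\<^sub>F w in at_right 0 \<times>\<^sub>F at_right 0. a < (case w of (s, t) \<Rightarrow> ccos x (snd p s) (snd q t))"
    by (rule eventually_mono) (use st in \<open>auto intro: less_le_trans[OF _ ccos_antimono[OF p q x]]\<close>)
next
  fix a assume a: "gcos x p q < a"
  from eventually_at_right_0_prod[OF geodesics_fromD(1)[OF p] geodesics_fromD(1)[OF q]]
  show "\<forall>\<^sub>F w in at_right 0 \<times>\<^sub>F at_right 0. (case w of (s, t) \<Rightarrow> ccos x (snd p s) (snd q t)) < a"
    by (rule eventually_mono) (auto intro: le_less_trans[OF ccos_le_gcos a])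
qed

end

end

section \<open>Spaces of directions\<close>

context hadamard begin

definition dir :: "'b \<Rightarrow> 'b geo \<Rightarrow> 'b direction" where
  "dir x p = completion_embed (pre_directions K \<rho> x) (pre_directions_dist K \<rho> x)
     (mclass (geodesics_from K \<rho> x) (geo_angle \<rho> x) p)"

context
  fixes x assumes x: "x \<in> K"
begin

abbreviation G where "G \<equiv> geodesics_from K \<rho> x"

lemma abs_gcos_le_1:
  assumes "p \<in> G" "q \<in> G"
  shows "\<bar>gcos x p q\<bar> \<le> 1"
proof -
  have "gcos x p q \<le> 1" unfolding gcos_def
    using ccos_geo_bounds[OF x assms] geodesics_fromD(1)[OF assms(1)] geodesics_fromD(1)[OF assms(2)]
    by (intro cSUP_least) (auto simp: abs_le_iff)
  moreover have "- 1 \<le> ccos x (snd p (fst p)) (snd q (fst q))"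
    using ccos_geo_bounds[OF x assms, of "fst p" "fst q"]
      geodesics_fromD(1)[OF assms(1)] geodesics_fromD(1)[OF assms(2)] by (simp add: abs_le_iff)
  moreover have "\<dots> \<le> gcos x p q"
    using ccos_le_gcos[OF x assms, of "fst p" "fst q"]
      geodesics_fromD(1)[OF assms(1)] geodesics_fromD(1)[OF assms(2)] by simp
  ultimately show ?thesis by (simp add: abs_le_iff)
qed

lemma gcos_self:
  assumes "p \<in> G"
  shows "gcos x p p = 1"
proof -
  have "ccos x (snd p (fst p)) (snd p (fst p)) = 1"
    unfolding ccos_def using geodesics_fromD[OF assms] by (simp add: power2_eq_square)
  then have "1 \<le> gcos x p p"
    using ccos_le_gcos[OF x assms assms, of "fst p" "fst p"] geodesics_fromD(1)[OF assms] by simp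
  then show ?thesis using abs_gcos_le_1[OF assms assms] by simp
qed

lemma gcos_sym:
  assumes "p \<in> G" "q \<in> G"
  shows "gcos x p q = gcos x q p"
proof -
  have le: "gcos x p q \<le> gcos x q p" if "p \<in> G" "q \<in> G" for p q
    unfolding gcos_def[of _ p]
    using ccos_le_gcos[OF x that(2,1)] geodesics_fromD(1)[OF that(1)] geodesics_fromD(1)[OF that(2)]
    by (intro cSUP_least) (auto simp: ccos_sym[of x "snd p _"])
  show ?thesis using le[OF assms] le[OF assms(2,1)] by simp
qed

lemma geo_angle_eq:
  assumes "p \<in> G" "q \<in> G"
  shows "geo_angle \<rho> x p q = arccos (gcos x p q)"
  unfolding geo_angle_def
proof (rule tendsto_Lim)
  show "at_right (0::real) \<times>\<^sub>F at_right (0::real) \<noteq> bot" by (simp add: prod_filter_eq_bot)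
  note ev = eventually_at_right_0_prod[OF geodesics_fromD(1)[OF assms(1)] geodesics_fromD(1)[OF assms(2)]]
  have "((\<lambda>w. arccos (case w of (s, t) \<Rightarrow> ccos x (snd p s) (snd q t))) \<longlongrightarrow> arccos (gcos x p q))
      (at_right 0 \<times>\<^sub>F at_right 0)"
  proof (rule continuous_on_tendsto_compose[OF continuous_on_arccos' gcos_tendsto[OF x assms]])
    show "gcos x p q \<in> {-1..1}" using abs_gcos_le_1[OF assms] by auto
    show "\<forall>\<^sub>F w in at_right 0 \<times>\<^sub>F at_right 0. (case w of (s, t) \<Rightarrow> ccos x (snd p s) (snd q t)) \<in> {-1..1}"
      using ev by (rule eventually_mono) (use ccos_geo_bounds[OF x assms] in \<open>auto simp: abs_le_iff\<close>)
  qed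
  then show "((\<lambda>(s, t). comparison_angle \<rho> x (snd p s) (snd q t)) \<longlongrightarrow> arccos (gcos x p q))
      (at_right 0 \<times>\<^sub>F at_right 0)"
  proof (rule Lim_transform_eventually)
    have ne: "snd p s \<in> K \<and> x \<noteq> snd p s" if "p \<in> G" "0 < s" "s \<le> fst p" for p s
      using geodesics_fromD(4,6)[OF that(1), of s] that x by auto
    show "\<forall>\<^sub>F w in at_right 0 \<times>\<^sub>F at_right 0. arccos (case w of (s, t) \<Rightarrow> ccos x (snd p s) (snd q t))
        = (case w of (s, t) \<Rightarrow> comparison_angle \<rho> x (snd p s) (snd q t))"
      using ev by (rule eventually_mono) (use ne[OF assms(1)] ne[OF assms(2)] x in \<open>auto simp: comparison_angle_eq\<close>)
  qed
qed

lemma eventually_scaled_le: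
  fixes a l :: real
  assumes "0 \<le> a" "0 < l"
  shows "\<forall>\<^sub>F \<epsilon> in at_right 0. 0 < \<epsilon> \<and> 0 \<le> a * \<epsilon> \<and> a * \<epsilon> \<le> l"
proof -
  have "0 < l / (a + 1)" using assms by simp
  from eventually_at_right_real[OF this] show ?thesis
  proof (rule eventually_mono)
    fix \<epsilon> assume e: "\<epsilon> \<in> {0<..<l / (a + 1)}"
    then have "(a + 1) * \<epsilon> < l" using assms by (simp add: field_simps)
    then show "0 < \<epsilon> \<and> 0 \<le> a * \<epsilon> \<and> a * \<epsilon> \<le> l" using e assms by (simp add: algebra_simps)
  qed
qed

text \<open>For small \<open>\<epsilon>\<close> the quotient equals the square root with
  \<open>ccos\<close> in place of \<open>gcos\<close>, by the law of cosines. The limit exhibits the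
  cone metric as a blow-up of \<open>\<rho>\<close>, through which inequalities for
  \<open>\<rho>\<close> reach the cone.\<close>

lemma dist_geo_tendsto:
  assumes p: "p \<in> G" and q: "q \<in> G" and "0 \<le> a" "0 \<le> b"
  shows "((\<lambda>\<epsilon>. \<rho> (snd p (a * \<epsilon>)) (snd q (b * \<epsilon>)) / \<epsilon>) \<longlongrightarrow> sqrt (a\<^sup>2 + b\<^sup>2 - 2 * a * b * gcos x p q)) (at_right 0)"
proof -
  note ev = eventually_conj[OF eventually_scaled_le[OF \<open>0 \<le> a\<close> geodesics_fromD(1)[OF p]]
      eventually_scaled_le[OF \<open>0 \<le> b\<close> geodesics_fromD(1)[OF q]]]
  \<comment> \<open>The limit defining \<open>gcos\<close> runs through positive parameters only, so
    a vanishing scale is computed directly.\<close>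
  consider "a = 0" | "b = 0" | "0 < a" "0 < b" using assms by linarith
  then show ?thesis
  proof cases
    case 1
    show ?thesis
      by (rule tendsto_eventually, rule eventually_mono[OF ev])
        (use 1 assms in \<open>simp add: geodesics_fromD(2)[OF p] geodesics_fromD(6)[OF q]\<close>)
  next
    case 2
    show ?thesis
      by (rule tendsto_eventually, rule eventually_mono[OF ev])
        (use 2 assms in \<open>simp add: geodesics_fromD(2)[OF q] commute[of _ x] geodesics_fromD(6)[OF p]\<close>)
  next
    case 3
    have at: "filterlim (\<lambda>\<epsilon>. c * \<epsilon>) (at_right 0) (at_right 0)" if "0 < c" for c :: real
      unfolding filterlim_at
    proof
      show "\<forall>\<^sub>F \<epsilon> in at_right 0. c * \<epsilon> \<in> {0<..} \<and> c * \<epsilon> \<noteq> 0"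
        using eventually_at_right_less[of 0] by (rule eventually_mono) (use that in auto)
      show "((\<lambda>\<epsilon>. c * \<epsilon>) \<longlongrightarrow> 0) (at_right 0)"
        using tendsto_mult_right_zero[OF tendsto_ident_at] by blast
    qed
    have "((\<lambda>\<epsilon>. ccos x (snd p (a * \<epsilon>)) (snd q (b * \<epsilon>))) \<longlongrightarrow> gcos x p q) (at_right 0)"
      using filterlim_compose[OF gcos_tendsto[OF x p q] filterlim_Pair[OF at[OF 3(1)] at[OF 3(2)]]] by simp
    then have "((\<lambda>\<epsilon>. sqrt (a\<^sup>2 + b\<^sup>2 - 2 * a * b * ccos x (snd p (a * \<epsilon>)) (snd q (b * \<epsilon>))))
        \<longlongrightarrow> sqrt (a\<^sup>2 + b\<^sup>2 - 2 * a * b * gcos x p q)) (at_right 0)"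
      by (intro tendsto_intros)
    then show ?thesis
    proof (rule Lim_transform_eventually, intro eventually_mono[OF ev])
      fix \<epsilon> assume e: "(0 < \<epsilon> \<and> 0 \<le> a * \<epsilon> \<and> a * \<epsilon> \<le> fst p) \<and> 0 < \<epsilon> \<and> 0 \<le> b * \<epsilon> \<and> b * \<epsilon> \<le> fst q"
      let ?r = "\<rho> (snd p (a * \<epsilon>)) (snd q (b * \<epsilon>))"
      have "2 * a * b * ccos x (snd p (a * \<epsilon>)) (snd q (b * \<epsilon>)) = ((a * \<epsilon>)\<^sup>2 + (b * \<epsilon>)\<^sup>2 - ?r\<^sup>2) / \<epsilon>\<^sup>2"
        unfolding ccos_def using e 3 by (simp add: geodesics_fromD(6)[OF p] geodesics_fromD(6)[OF q] power2_eq_square)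
      also have "\<dots> = a\<^sup>2 + b\<^sup>2 - (?r / \<epsilon>)\<^sup>2"
        using e by (simp add: field_simps)
      finally show "sqrt (a\<^sup>2 + b\<^sup>2 - 2 * a * b * ccos x (snd p (a * \<epsilon>)) (snd q (b * \<epsilon>))) = ?r / \<epsilon>"
        using e by simp
    qed
  qed
qed

lemma cone_triangle_geo:
  assumes p: "p \<in> G" and q: "q \<in> G" and r: "r \<in> G" and "0 \<le> a" "0 \<le> b" "0 \<le> c"
  shows "sqrt (a\<^sup>2 + c\<^sup>2 - 2 * a * c * gcos x p r)
    \<le> sqrt (a\<^sup>2 + b\<^sup>2 - 2 * a * b * gcos x p q) + sqrt (b\<^sup>2 + c\<^sup>2 - 2 * b * c * gcos x q r)"
proof (rule tendsto_le)
  show "((\<lambda>\<epsilon>. \<rho> (snd p (a * \<epsilon>)) (snd q (b * \<epsilon>)) / \<epsilon> + \<rho> (snd q (b * \<epsilon>)) (snd r (c * \<epsilon>)) / \<epsilon>) \<longlongrightarrow>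
    sqrt (a\<^sup>2 + b\<^sup>2 - 2 * a * b * gcos x p q) + sqrt (b\<^sup>2 + c\<^sup>2 - 2 * b * c * gcos x q r)) (at_right 0)"
    by (intro tendsto_add dist_geo_tendsto assms)
  show "((\<lambda>\<epsilon>. \<rho> (snd p (a * \<epsilon>)) (snd r (c * \<epsilon>)) / \<epsilon>) \<longlongrightarrow> sqrt (a\<^sup>2 + c\<^sup>2 - 2 * a * c * gcos x p r)) (at_right 0)"
    by (intro dist_geo_tendsto assms)
  show "\<forall>\<^sub>F \<epsilon> in at_right 0. \<rho> (snd p (a * \<epsilon>)) (snd r (c * \<epsilon>)) / \<epsilon>
      \<le> \<rho> (snd p (a * \<epsilon>)) (snd q (b * \<epsilon>)) / \<epsilon> + \<rho> (snd q (b * \<epsilon>)) (snd r (c * \<epsilon>)) / \<epsilon>"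
    using eventually_scaled_le[OF \<open>0 \<le> a\<close> geodesics_fromD(1)[OF p]]
      eventually_scaled_le[OF \<open>0 \<le> b\<close> geodesics_fromD(1)[OF q]]
      eventually_scaled_le[OF \<open>0 \<le> c\<close> geodesics_fromD(1)[OF r]]
  proof eventually_elim
    case (elim \<epsilon>)
    then show ?case unfolding add_divide_distrib[symmetric]
      by (intro divide_right_mono triangle geodesics_fromD(4)[OF p] geodesics_fromD(4)[OF q] geodesics_fromD(4)[OF r]) auto
  qed
qed simp

lemma cos_geo_angle:
  assumes "p \<in> G" "q \<in> G"
  shows "cos (geo_angle \<rho> x p q) = gcos x p q" "0 \<le> geo_angle \<rho> x p q" "geo_angle \<rho> x p q \<le> pi"
proof -
  have "- 1 \<le> gcos x p q" "gcos x p q \<le> 1" using abs_gcos_le_1[OF assms] by linarith+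
  then show "cos (geo_angle \<rho> x p q) = gcos x p q" "0 \<le> geo_angle \<rho> x p q" "geo_angle \<rho> x p q \<le> pi"
    unfolding geo_angle_eq[OF assms] by (simp_all add: arccos_lbound arccos_ubound)
qed

text \<open>The triangle inequality for angles is the blown-up triangle inequality of
  \<open>\<rho>\<close>, converted from sides to angles by
  \<open>angle_le_add_if_cone_triangle\<close>.\<close>

lemma pseudometric_geo_angle: "pseudometric G (geo_angle \<rho> x)"
proof
  fix p q r assume p: "p \<in> G"
  show "geo_angle \<rho> x p p = 0" by (simp add: geo_angle_eq p gcos_self)
  assume q: "q \<in> G"
  show "0 \<le> geo_angle \<rho> x p q" by (rule cos_geo_angle[OF p q])
  show "geo_angle \<rho> x p q = geo_angle \<rho> x q p" by (simp add: geo_angle_eq p q gcos_sym)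
  assume r: "r \<in> G"
  show "geo_angle \<rho> x p r \<le> geo_angle \<rho> x p q + geo_angle \<rho> x q r"
    by (rule angle_le_add_if_cone_triangle)
      (use cone_triangle_geo[OF p q r] in \<open>simp_all add: cos_geo_angle p q r\<close>)
qed

interpretation ps: pseudometric G "geo_angle \<rho> x" by (rule pseudometric_geo_angle)

lemma Metric_space_pre_directions: "Metric_space (pre_directions K \<rho> x) (pre_directions_dist K \<rho> x)"
  unfolding pre_directions_def pre_directions_dist_def by (rule ps.Metric_space_mquot)

interpretation pd: Metric_space "pre_directions K \<rho> x" "pre_directions_dist K \<rho> x"
  by (rule Metric_space_pre_directions)

lemma Metric_space_directions: "Metric_space (Dirs x) (ang x)"
  unfolding directions_def angle_def by (rule pd.Metric_space_completion)

lemma mcomplete_directions: "Metric_space.mcomplete (Dirs x) (ang x)"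
  unfolding directions_def angle_def by (rule pd.mcomplete_completion)

lemma mclass_in_pre_directions: "p \<in> G \<Longrightarrow> mclass G (geo_angle \<rho> x) p \<in> pre_directions K \<rho> x"
  unfolding pre_directions_def by (rule ps.mclass_in)

lemma dir_in: "p \<in> G \<Longrightarrow> dir x p \<in> Dirs x"
  unfolding dir_def directions_def by (intro pd.completion_embed_in mclass_in_pre_directions)

lemma angle_dir:
  assumes "p \<in> G" "q \<in> G"
  shows "ang x (dir x p) (dir x q) = geo_angle \<rho> x p q"
proof -
  have "ang x (dir x p) (dir x q)
      = pre_directions_dist K \<rho> x (mclass G (geo_angle \<rho> x) p) (mclass G (geo_angle \<rho> x) q)"
    unfolding angle_def dir_def by (intro pd.completion_dist_embed mclass_in_pre_directions assms)
  also have "\<dots> = geo_angle \<rho> x p q"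
    unfolding pre_directions_dist_def by (rule ps.mquot_dist_mclass[OF assms])
  finally show ?thesis .
qed

lemma dir_dense:
  assumes "X \<in> Dirs x" "0 < e"
  shows "\<exists>p\<in>G. ang x (dir x p) X < e"
proof -
  obtain a where "a \<in> pre_directions K \<rho> x"
    "completion_dist (pre_directions K \<rho> x) (pre_directions_dist K \<rho> x)
       (completion_embed (pre_directions K \<rho> x) (pre_directions_dist K \<rho> x) a) X < e"
    using pd.completion_dense[OF assms[unfolded directions_def]] by blast
  then show ?thesis unfolding angle_def dir_def pre_directions_def ps.mquot_eq by blast
qed

lemma dir_approx:
  assumes "X \<in> Dirs x"
  shows "\<exists>p. (\<forall>n. p n \<in> G) \<and> (\<lambda>n. ang x (dir x (p n)) X) \<longlonglongrightarrow> 0"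
proof -
  interpret D: Metric_space "Dirs x" "ang x" by (rule Metric_space_directions)
  have "\<forall>n. \<exists>p. p \<in> G \<and> ang x (dir x p) X < inverse (real (Suc n))"
    using dir_dense[OF assms] by (metis inverse_positive_iff_positive of_nat_0_less_iff zero_less_Suc)
  then obtain p where p: "\<And>n. p n \<in> G" "\<And>n. ang x (dir x (p n)) X < inverse (real (Suc n))" by metis
  moreover have "(\<lambda>n. ang x (dir x (p n)) X) \<longlonglongrightarrow> 0"
    by (rule tendsto_sandwich[OF _ _ tendsto_const LIMSEQ_inverse_real_of_nat])
      (use p(2) in \<open>auto intro!: always_eventually less_imp_le\<close>)
  ultimately show ?thesis by blast
qed

lemma angle_tendsto:
  assumes "X \<in> Dirs x" "Y \<in> Dirs x"
    and "\<And>n. Xn n \<in> Dirs x" "\<And>n. Yn n \<in> Dirs x"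
    and "(\<lambda>n. ang x (Xn n) X) \<longlonglongrightarrow> 0" "(\<lambda>n. ang x (Yn n) Y) \<longlonglongrightarrow> 0"
  shows "(\<lambda>n. ang x (Xn n) (Yn n)) \<longlonglongrightarrow> ang x X Y"
proof -
  interpret D: Metric_space "Dirs x" "ang x" by (rule Metric_space_directions)
  have "\<bar>ang x (Xn n) (Yn n) - ang x X Y\<bar> \<le> ang x (Xn n) X + ang x (Yn n) Y" for n
    using D.mdist_reverse_triangle[OF assms(3)[of n] assms(4)[of n] assms(1)]
      D.mdist_reverse_triangle[OF assms(4)[of n] assms(1,2)] by (simp add: D.commute)
  moreover have "(\<lambda>n. ang x (Xn n) X + ang x (Yn n) Y) \<longlonglongrightarrow> 0"
    using tendsto_add[OF assms(5,6)] by simp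
  ultimately have "(\<lambda>n. ang x (Xn n) (Yn n) - ang x X Y) \<longlonglongrightarrow> 0"
    by - (rule Lim_null_comparison, simp_all only: real_norm_def eventually_sequentially, blast)
  then show ?thesis by (simp add: LIM_zero_iff)
qed

lemma angle_range:
  assumes "X \<in> Dirs x" "Y \<in> Dirs x"
  shows "0 \<le> ang x X Y" "ang x X Y \<le> pi"
proof -
  interpret D: Metric_space "Dirs x" "ang x" by (rule Metric_space_directions)
  show "0 \<le> ang x X Y" by simp
  obtain p where p: "\<And>n. p n \<in> G" "(\<lambda>n. ang x (dir x (p n)) X) \<longlonglongrightarrow> 0" using dir_approx[OF assms(1)] by blast
  obtain q where q: "\<And>n. q n \<in> G" "(\<lambda>n. ang x (dir x (q n)) Y) \<longlonglongrightarrow> 0" using dir_approx[OF assms(2)] by blast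
  show "ang x X Y \<le> pi"
    by (rule LIMSEQ_le_const2[OF angle_tendsto[OF assms _ _ p(2) q(2)]])
      (use p q in \<open>auto simp: dir_in angle_dir cos_geo_angle\<close>)
qed

end
end

section \<open>Geodesics from approximate convex combinations\<close>

lemma (in Metric_space) tendsto_dist_right:
  assumes "\<And>n. c n \<in> M" "l \<in> M" "z \<in> M" "(\<lambda>n. d (c n) l) \<longlonglongrightarrow> 0"
  shows "(\<lambda>n. d (c n) z) \<longlonglongrightarrow> d l z"
proof -
  have "\<bar>d (c n) z - d l z\<bar> \<le> d (c n) l" for n
    using mdist_reverse_triangle[of "c n" z l] assms by (simp add: commute)
  then have "(\<lambda>n. d (c n) z - d l z) \<longlonglongrightarrow> 0"
    using assms(4) by - (rule Lim_null_comparison, simp_all only: real_norm_def eventually_sequentially, blast)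
  then show ?thesis by (simp add: LIM_zero_iff)
qed

text \<open>The right side \<open>N z\<close> behaves like the squared distance from
  \<open>z\<close> to the point sought. Testing at \<open>u\<close> and \<open>v\<close> gives a
  point \<open>c\<close> with \<open>N c \<le> \<delta>\<close>, since
  \<open>(1 - \<theta>) * N u + \<theta> * N v\<close> cancels the last term. Testing at
  \<open>c\<close> and \<open>z\<close> and passing through the common point gives
  \<open>d c z \<le> sqrt (N c + \<delta>) + sqrt (N z + \<delta>)\<close>. Hence points with small
  \<open>N\<close> form a Cauchy sequence, and the same bound yields the inequality for its limit at
  every \<open>z\<close>.\<close>

lemma (in Metric_space) approx_CN_point:
  assumes compl: mcomplete and u: "u \<in> M" and v: "v \<in> M" and \<theta>: "0 \<le> \<theta>" "\<theta> \<le> 1"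
    and AC: "\<And>\<delta> p q. 0 < \<delta> \<Longrightarrow> p \<in> M \<Longrightarrow> q \<in> M \<Longrightarrow> \<exists>c\<in>M. \<forall>z\<in>{p, q}.
      (d c z)\<^sup>2 \<le> (1 - \<theta>) * (d u z)\<^sup>2 + \<theta> * (d v z)\<^sup>2 - \<theta> * (1 - \<theta>) * (d u v)\<^sup>2 + \<delta>"
  shows "\<exists>c\<in>M. \<forall>z\<in>M. (d c z)\<^sup>2 \<le> (1 - \<theta>) * (d u z)\<^sup>2 + \<theta> * (d v z)\<^sup>2 - \<theta> * (1 - \<theta>) * (d u v)\<^sup>2"
proof -
  define N where "N z = (1 - \<theta>) * (d u z)\<^sup>2 + \<theta> * (d v z)\<^sup>2 - \<theta> * (1 - \<theta>) * (d u v)\<^sup>2" for z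
  have AC': "\<exists>c\<in>M. (d c p)\<^sup>2 \<le> N p + \<delta> \<and> (d c q)\<^sup>2 \<le> N q + \<delta>" if "0 < \<delta>" "p \<in> M" "q \<in> M" for \<delta> p q
    using AC[OF that] unfolding N_def by simp
  have near: "d c z \<le> sqrt (N c + \<delta>) + sqrt (N z + \<delta>) \<and> 0 \<le> N z + \<delta>"
    if H: "c \<in> M" "z \<in> M" "0 < \<delta>" for c z \<delta>
  proof -
    obtain c' where c': "c' \<in> M" "(d c' c)\<^sup>2 \<le> N c + \<delta>" "(d c' z)\<^sup>2 \<le> N z + \<delta>"
      using AC'[OF H(3,1,2)] by blast
    then have "d c' c \<le> sqrt (N c + \<delta>)" "d c' z \<le> sqrt (N z + \<delta>)" by (simp_all add: real_le_rsqrt)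
    then show ?thesis using triangle[of c c' z] c' H order_trans[OF zero_le_power2 c'(3)] by (simp add: commute)
  qed
  have "\<exists>c\<in>M. N c \<le> \<delta>" if H: "0 < \<delta>" for \<delta>
  proof -
    obtain c where c: "c \<in> M" "(d c u)\<^sup>2 \<le> N u + \<delta>" "(d c v)\<^sup>2 \<le> N v + \<delta>"
      using AC'[OF H u v] by blast
    have "N c \<le> (1 - \<theta>) * (N u + \<delta>) + \<theta> * (N v + \<delta>) - \<theta> * (1 - \<theta>) * (d u v)\<^sup>2"
      unfolding N_def[of c] using c \<theta> by (intro diff_right_mono add_mono mult_left_mono) (auto simp: commute)
    also have "\<dots> = \<delta>" unfolding N_def using u v by (simp add: commute algebra_simps power2_eq_square)
    finally show ?thesis using c by blast
  qed
  then have "\<forall>n. \<exists>c. c \<in> M \<and> N c \<le> inverse (real (Suc n))"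
    by (metis inverse_positive_iff_positive of_nat_0_less_iff zero_less_Suc)
  then obtain c where c: "\<And>n. c n \<in> M" "\<And>n. N (c n) \<le> inverse (real (Suc n))" by metis
  have small: "(\<lambda>n. sqrt (2 * inverse (real (Suc n)))) \<longlonglongrightarrow> 0"
    using tendsto_real_sqrt[OF tendsto_mult_right_zero[OF LIMSEQ_inverse_real_of_nat, of 2]] by simp
  have "MCauchy c" unfolding MCauchy_def
  proof (intro conjI allI impI)
    fix \<epsilon> :: real assume "0 < \<epsilon>"
    then have "0 < \<epsilon> / 2" by simp
    then obtain k where k: "sqrt (2 * inverse (real (Suc k))) < \<epsilon> / 2"
      using order_tendstoD(2)[OF small] unfolding eventually_sequentially by blast
    show "\<exists>N. \<forall>n n'. N \<le> n \<longrightarrow> N \<le> n' \<longrightarrow> d (c n) (c n') < \<epsilon>"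
    proof (intro exI allI impI)
      fix n n' assume n: "k \<le> n" "k \<le> n'"
      have "inverse (real (Suc n)) \<le> inverse (real (Suc k))" "inverse (real (Suc n')) \<le> inverse (real (Suc k))"
        using n by (intro le_imp_inverse_le; simp)+
      then have "N (c n) + inverse (real (Suc k)) \<le> 2 * inverse (real (Suc k))"
        "N (c n') + inverse (real (Suc k)) \<le> 2 * inverse (real (Suc k))"
        using c(2)[of n] c(2)[of n'] by linarith+
      then have "sqrt (N (c n) + inverse (real (Suc k))) \<le> sqrt (2 * inverse (real (Suc k)))"
        "sqrt (N (c n') + inverse (real (Suc k))) \<le> sqrt (2 * inverse (real (Suc k)))"
        by (simp_all only: real_sqrt_le_iff)
      moreover have "d (c n) (c n') \<le> sqrt (N (c n) + inverse (real (Suc k))) + sqrt (N (c n') + inverse (real (Suc k)))"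
        by (rule conjunct1[OF near[OF c(1) c(1)]]) simp
      ultimately show "d (c n) (c n') < \<epsilon>" using k by linarith
    qed
  qed (use c in auto)
  then obtain l where "limitin mtopology c l sequentially" using compl unfolding mcomplete_def by blast
  then have l: "l \<in> M" "(\<lambda>n. d (c n) l) \<longlonglongrightarrow> 0" using limitin_metric_dist_null by auto
  have "(d l z)\<^sup>2 \<le> N z" if z: "z \<in> M" for z
  proof -
    let ?i = "\<lambda>n. inverse (real (Suc n))"
    have Nz: "0 \<le> N z"
      by (rule LIMSEQ_le_const[of "\<lambda>n. N z + ?i n"])
        (use near[OF z z] tendsto_add[OF tendsto_const LIMSEQ_inverse_real_of_nat] in auto)
    have "d (c n) z \<le> sqrt (2 * ?i n) + sqrt (N z + ?i n)" for n
    proof -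
      have "sqrt (N (c n) + ?i n) \<le> sqrt (2 * ?i n)" using c(2)[of n] by (intro real_sqrt_le_mono) linarith
      moreover have "d (c n) z \<le> sqrt (N (c n) + ?i n) + sqrt (N z + ?i n)"
        by (rule conjunct1[OF near[OF c(1) z]]) simp
      ultimately show ?thesis by linarith
    qed
    moreover have "(\<lambda>n. sqrt (2 * ?i n) + sqrt (N z + ?i n)) \<longlonglongrightarrow> 0 + sqrt (N z + 0)"
      by (intro tendsto_add small tendsto_real_sqrt tendsto_const LIMSEQ_inverse_real_of_nat)
    ultimately have "d l z \<le> sqrt (N z)"
      using LIMSEQ_le[OF tendsto_dist_right[OF c(1) l(1) z l(2)]] by auto
    then show ?thesis using Nz by (metis nonneg power_mono real_sqrt_pow2)
  qed
  then show ?thesis using l(1) unfolding N_def by blast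
qed

text \<open>The inequality for the point at \<open>\<theta>\<close>, tested at the point at
  \<open>\<theta>'\<close>, bounds their distance above by
  \<open>(\<theta>' - \<theta>) * D\<close>. The lower bound is the triangle inequality along
  \<open>u\<close>, the two points and \<open>v\<close>.\<close>

lemma (in Metric_space) geodesic_if_approx_CN:
  assumes compl: mcomplete and u: "u \<in> M" and v: "v \<in> M"
    and AC: "\<And>\<theta> \<delta> p q. 0 \<le> \<theta> \<Longrightarrow> \<theta> \<le> 1 \<Longrightarrow> 0 < \<delta> \<Longrightarrow> p \<in> M \<Longrightarrow> q \<in> M \<Longrightarrow> \<exists>c\<in>M. \<forall>z\<in>{p, q}.
      (d c z)\<^sup>2 \<le> (1 - \<theta>) * (d u z)\<^sup>2 + \<theta> * (d v z)\<^sup>2 - \<theta> * (1 - \<theta>) * (d u v)\<^sup>2 + \<delta>"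
  shows "\<exists>l \<gamma>. geodesic M d l \<gamma> \<and> \<gamma> 0 = u \<and> \<gamma> l = v"
proof (cases "u = v")
  case True
  then have "geodesic M d 0 (\<lambda>s. if s = 0 then u else undefined)"
    unfolding geodesic_def using u by (auto simp: PiE_def extensional_def)
  then show ?thesis using True by fastforce
next
  case False
  define D where "D = d u v"
  have D: "0 < D" unfolding D_def using False u v by simp
  have "\<exists>c\<in>M. \<forall>z\<in>M. (d c z)\<^sup>2 \<le> (1 - \<theta>) * (d u z)\<^sup>2 + \<theta> * (d v z)\<^sup>2 - \<theta> * (1 - \<theta>) * D\<^sup>2"
    if "0 \<le> \<theta>" "\<theta> \<le> 1" for \<theta>
    unfolding D_def by (rule approx_CN_point[OF compl u v that AC[OF that]])
  then have "\<forall>\<theta>. \<exists>c. 0 \<le> \<theta> \<and> \<theta> \<le> 1 \<longrightarrow> c \<in> M \<and> (\<forall>z\<in>M. (d c z)\<^sup>2 \<le> (1 - \<theta>) * (d u z)\<^sup>2 + \<theta> * (d v z)\<^sup>2 - \<theta> * (1 - \<theta>) * D\<^sup>2)"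
    by meson
  then obtain c where c: "\<And>\<theta>. 0 \<le> \<theta> \<Longrightarrow> \<theta> \<le> 1 \<Longrightarrow> c \<theta> \<in> M"
    "\<And>\<theta> z. 0 \<le> \<theta> \<Longrightarrow> \<theta> \<le> 1 \<Longrightarrow> z \<in> M \<Longrightarrow>
      (d (c \<theta>) z)\<^sup>2 \<le> (1 - \<theta>) * (d u z)\<^sup>2 + \<theta> * (d v z)\<^sup>2 - \<theta> * (1 - \<theta>) * D\<^sup>2" by metis
  have cu: "(d u (c \<theta>))\<^sup>2 \<le> (\<theta> * D)\<^sup>2" and cv: "(d v (c \<theta>))\<^sup>2 \<le> ((1 - \<theta>) * D)\<^sup>2" if "0 \<le> \<theta>" "\<theta> \<le> 1" for \<theta>
    using c(2)[OF that u] c(2)[OF that v] u v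
    by (simp_all add: commute D_def[symmetric] power2_eq_square algebra_simps)
  have cu': "d u (c \<theta>) \<le> \<theta> * D" and cv': "d v (c \<theta>) \<le> (1 - \<theta>) * D" if "0 \<le> \<theta>" "\<theta> \<le> 1" for \<theta>
    using power2_le_imp_le[OF cu[OF that]] power2_le_imp_le[OF cv[OF that]] D that by auto
  have dist: "d (c \<theta>) (c \<theta>') = (\<theta>' - \<theta>) * D" if "0 \<le> \<theta>" "\<theta> \<le> \<theta>'" "\<theta>' \<le> 1" for \<theta> \<theta>'
  proof (rule antisym)
    have "(d (c \<theta>) (c \<theta>'))\<^sup>2 \<le> (1 - \<theta>) * (\<theta>' * D)\<^sup>2 + \<theta> * ((1 - \<theta>') * D)\<^sup>2 - \<theta> * (1 - \<theta>) * D\<^sup>2"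
      by (rule order_trans[OF c(2)]) (use that c cu[of \<theta>'] cv[of \<theta>'] in \<open>auto intro!: add_mono mult_left_mono\<close>)
    also have "\<dots> = ((\<theta>' - \<theta>) * D)\<^sup>2" by (simp add: power2_eq_square algebra_simps)
    finally show "d (c \<theta>) (c \<theta>') \<le> (\<theta>' - \<theta>) * D" by (rule power2_le_imp_le) (use that D in simp)
    have "D \<le> d u (c \<theta>) + d (c \<theta>) (c \<theta>') + d v (c \<theta>')"
      unfolding D_def using triangle[of u "c \<theta>" v] triangle[of "c \<theta>" "c \<theta>'" v] c(1)[of \<theta>] c(1)[of \<theta>'] u v that
      by (simp add: commute)
    then show "(\<theta>' - \<theta>) * D \<le> d (c \<theta>) (c \<theta>')"
      using cu'[of \<theta>] cv'[of \<theta>'] that by (simp add: algebra_simps)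
  qed
  let ?\<gamma> = "\<lambda>s. if s \<in> {0..D} then c (s / D) else undefined"
  have "geodesic M d D ?\<gamma>" unfolding geodesic_def
  proof (intro conjI ballI)
    show "0 \<le> D" using D by simp
    show "?\<gamma> \<in> {0..D} \<rightarrow>\<^sub>E M" using c(1) D by auto
    fix s t assume st: "s \<in> {0..D}" "t \<in> {0..D}"
    have le: "d (c (s / D)) (c (t / D)) = t - s" if "s \<in> {0..D}" "t \<in> {0..D}" "s \<le> t" for s t
      using dist[of "s / D" "t / D"] that D by (simp add: divide_right_mono diff_divide_distrib[symmetric])
    show "d (?\<gamma> s) (?\<gamma> t) = \<bar>s - t\<bar>"
    proof (cases "s \<le> t")
      case True
      then show ?thesis using le[OF st True] st by simp
    next
      case False
      then show ?thesis using le[OF st(2,1)] st by (simp add: commute)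
    qed
  qed
  moreover have "?\<gamma> 0 = u" using cu'[of 0] c(1)[of 0] u D zero[of u "c 0"] nonneg[of u "c 0"] by simp
  moreover have "?\<gamma> D = v" using cv'[of 1] c(1)[of 1] v D zero[of v "c 1"] nonneg[of v "c 1"] by simp
  ultimately show ?thesis by blast
qed

section \<open>Tangent cones as metric spaces\<close>

context hadamard begin

text \<open>Only directions are approximated while lengths stay fixed and the apex stays constant.
  This loses nothing, as directions of geodesics are dense, and it leaves the angle as the only
  varying quantity.\<close>

definition cone_conv :: "'b \<Rightarrow> (nat \<Rightarrow> 'b tangent) \<Rightarrow> 'b tangent \<Rightarrow> bool" where
  "cone_conv x U u \<longleftrightarrow> (u = Apex \<and> U = (\<lambda>_. Apex)) \<or>
     (\<exists>t X Xn. u = Ray X t \<and> U = (\<lambda>n. Ray (Xn n) t) \<and> 0 < t \<and> X \<in> Dirs x \<and>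
        (\<forall>n. Xn n \<in> Dirs x) \<and> (\<lambda>n. ang x (Xn n) X) \<longlonglongrightarrow> 0)"

text \<open>The curve \<open>c\<close> issues from \<open>x\<close> with velocity \<open>u\<close>.\<close>

definition represents :: "'b \<Rightarrow> (real \<Rightarrow> 'b) \<Rightarrow> 'b tangent \<Rightarrow> bool" where
  "represents x c u \<longleftrightarrow> (u = Apex \<and> c = (\<lambda>_. x)) \<or>
     (\<exists>a p. 0 < a \<and> p \<in> geodesics_from K \<rho> x \<and> u = Ray (dir x p) a \<and> c = (\<lambda>\<epsilon>. snd p (a * \<epsilon>)))"

lemma representsE:
  assumes "represents x c u"
  obtains "u = Apex" "c = (\<lambda>_. x)"
  | a p where "0 < a" "p \<in> geodesics_from K \<rho> x" "u = Ray (dir x p) a" "c = (\<lambda>\<epsilon>. snd p (a * \<epsilon>))"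
  using assms unfolding represents_def by blast

context
  fixes x assumes x: "x \<in> K"
begin

abbreviation T where "T \<equiv> tangent_cone K \<rho> x"
abbreviation td where "td \<equiv> tdist K \<rho> x"

interpretation D: Metric_space "Dirs x" "ang x"
  by (rule Metric_space_directions[OF x])

lemma tangent_cone_iff: "u \<in> T \<longleftrightarrow> u = Apex \<or> (\<exists>X t. u = Ray X t \<and> 0 < t \<and> X \<in> Dirs x)"
proof
  assume "u \<in> T"
  then show "u = Apex \<or> (\<exists>X t. u = Ray X t \<and> 0 < t \<and> X \<in> Dirs x)"
    unfolding tangent_cone_def tpoint_def by (auto simp: order_less_le split: if_splits)
next
  assume "u = Apex \<or> (\<exists>X t. u = Ray X t \<and> 0 < t \<and> X \<in> Dirs x)"
  then show "u \<in> T"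
  proof (elim disjE exE conjE)
    fix X t assume "u = Ray X t" "0 < t" "X \<in> Dirs x"
    then have "u = tpoint t X" "0 \<le> t" "X \<in> Dirs x" unfolding tpoint_def by auto
    then show ?thesis unfolding tangent_cone_def by blast
  qed (simp add: tangent_cone_def)
qed

lemma tangent_cone_cases:
  assumes "u \<in> T"
  obtains "u = Apex" | X t where "u = Ray X t" "0 < t" "X \<in> Dirs x"
  using assms unfolding tangent_cone_iff by blast

lemma tdist_eq: "u \<in> T \<Longrightarrow> v \<in> T \<Longrightarrow> td u v = sqrt ((tlen u)\<^sup>2 + (tlen v)\<^sup>2 - 2 * inn x u v)"
  unfolding tdist_def by simp

lemma tlen_nonneg: "u \<in> T \<Longrightarrow> 0 \<le> tlen u"
  by (auto simp: tangent_cone_iff)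

lemma tinner_sym: "u \<in> T \<Longrightarrow> v \<in> T \<Longrightarrow> inn x u v = inn x v u"
  by (auto simp: tangent_cone_iff D.commute)

lemma abs_tinner_le:
  assumes "u \<in> T" "v \<in> T"
  shows "\<bar>inn x u v\<bar> \<le> tlen u * tlen v"
  using assms by (auto simp: tangent_cone_iff abs_mult mult_left_le)

lemma tdist_arg_nonneg:
  assumes "u \<in> T" "v \<in> T"
  shows "0 \<le> (tlen u)\<^sup>2 + (tlen v)\<^sup>2 - 2 * inn x u v"
  using abs_tinner_le[OF assms] sum_squares_bound[of "tlen u" "tlen v"] by (simp add: abs_le_iff)

lemma tdist_sq: "u \<in> T \<Longrightarrow> v \<in> T \<Longrightarrow> (td u v)\<^sup>2 = (tlen u)\<^sup>2 + (tlen v)\<^sup>2 - 2 * inn x u v"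
  by (simp only: tdist_eq real_sqrt_pow2[OF tdist_arg_nonneg])

lemma tdist_nonneg: "0 \<le> td u v"
proof (cases "u \<in> T \<and> v \<in> T")
  case True
  then show ?thesis using tdist_arg_nonneg[of u v] unfolding tdist_def by (simp only: if_True simp_thms real_sqrt_ge_zero)
qed (auto simp: tdist_def)

lemma tlen_diff_le_tdist:
  assumes "u \<in> T" "v \<in> T"
  shows "\<bar>tlen u - tlen v\<bar> \<le> td u v"
proof -
  have "(tlen u - tlen v)\<^sup>2 \<le> (td u v)\<^sup>2"
    unfolding tdist_sq[OF assms] using abs_tinner_le[OF assms] by (simp add: power2_diff abs_le_iff)
  moreover have "0 \<le> td u v" by (rule tdist_nonneg)
  ultimately show ?thesis using abs_le_square_iff[of "tlen u - tlen v" "td u v"] by simp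
qed

lemma tdist_eq_0_iff:
  assumes "u \<in> T" "v \<in> T"
  shows "td u v = 0 \<longleftrightarrow> u = v"
proof
  assume "u = v"
  then show "td u v = 0" using assms
    by (auto simp: tdist_eq tangent_cone_iff power2_eq_square)
next
  assume 0: "td u v = 0"
  then have l: "tlen u = tlen v" using tlen_diff_le_tdist[OF assms] by simp
  have i: "inn x u v = (tlen u)\<^sup>2" using tdist_sq[OF assms] 0 l by simp
  from assms(1) show "u = v"
  proof (cases rule: tangent_cone_cases)
    case 1
    then show ?thesis using l assms(2) by (auto simp: tangent_cone_iff)
  next
    case (2 X t)
    with l assms(2) obtain Y where Y: "v = Ray Y t" "Y \<in> Dirs x" by (auto simp: tangent_cone_iff)
    have "cos (ang x X Y) = cos 0" using i 2 Y by (simp add: power2_eq_square)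
    then have "ang x X Y = 0"
      using angle_range[OF x 2(3) Y(2)] cos_inj_pi by auto
    then show ?thesis using 2 Y by simp
  qed
qed

lemma cone_conv_in: "cone_conv x U u \<Longrightarrow> u \<in> T \<and> U n \<in> T"
  unfolding cone_conv_def tangent_cone_iff by auto

lemma cone_conv_tlen: "cone_conv x U u \<Longrightarrow> tlen (U n) = tlen u"
  unfolding cone_conv_def by auto

lemma cone_conv_const:
  assumes "u \<in> T"
  shows "cone_conv x (\<lambda>_. u) u"
  using assms
proof (cases rule: tangent_cone_cases)
  case (2 X t)
  then show ?thesis
    unfolding cone_conv_def by (intro disjI2 exI[of _ t] exI[of _ X] exI[of _ "\<lambda>_. X"]) simp
qed (simp add: cone_conv_def)

lemma tdist_tendsto_if_cone_conv:
  assumes "cone_conv x U u" "cone_conv x V v"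
  shows "(\<lambda>n. td (U n) (V n)) \<longlonglongrightarrow> td u v"
proof -
  have "(\<lambda>n. tlen (U n)) \<longlonglongrightarrow> tlen u" "(\<lambda>n. tlen (V n)) \<longlonglongrightarrow> tlen v"
    using cone_conv_tlen[OF assms(1)] cone_conv_tlen[OF assms(2)] by simp_all
  moreover have "(\<lambda>n. inn x (U n) (V n)) \<longlonglongrightarrow> inn x u v"
  proof (cases "u = Apex \<or> v = Apex")
    case True
    then have "inn x (U n) (V n) = 0 \<and> inn x u v = 0" for n
      using assms unfolding cone_conv_def by auto
    then show ?thesis by simp
  next
    case False
    with assms obtain t X Xn s Y Yn where "u = Ray X t" "U = (\<lambda>n. Ray (Xn n) t)" "X \<in> Dirs x"
      "\<And>n. Xn n \<in> Dirs x" "(\<lambda>n. ang x (Xn n) X) \<longlonglongrightarrow> 0"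
      "v = Ray Y s" "V = (\<lambda>n. Ray (Yn n) s)" "Y \<in> Dirs x"
      "\<And>n. Yn n \<in> Dirs x" "(\<lambda>n. ang x (Yn n) Y) \<longlonglongrightarrow> 0"
      unfolding cone_conv_def by blast
    then show ?thesis using angle_tendsto[OF x, of X Y Xn Yn] by (simp add: tendsto_mult_left tendsto_cos)
  qed
  ultimately have "(\<lambda>n. sqrt ((tlen (U n))\<^sup>2 + (tlen (V n))\<^sup>2 - 2 * inn x (U n) (V n)))
      \<longlonglongrightarrow> sqrt ((tlen u)\<^sup>2 + (tlen v)\<^sup>2 - 2 * inn x u v)"
    by (intro tendsto_intros)
  then show ?thesis
    using cone_conv_in[OF assms(1)] cone_conv_in[OF assms(2)] by (simp add: tdist_eq)
qed

lemma represents_in: "represents x c u \<Longrightarrow> u \<in> T"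
  unfolding represents_def tangent_cone_iff using dir_in[OF x] by blast

text \<open>Together with \<open>represents_tendsto\<close> and
  \<open>tdist_tendsto_if_cone_conv\<close>, this carries closed inequalities between distances from
  \<open>\<rho>\<close> to the cone: a limit in \<open>\<epsilon>\<close> for geodesic directions,
  then a limit in \<open>n\<close> for all directions.\<close>

lemma represents_approx:
  assumes "u \<in> T"
  shows "\<exists>U c. cone_conv x U u \<and> (\<forall>n. represents x (c n) (U n))"
  using assms
proof (cases rule: tangent_cone_cases)
  case 1
  then show ?thesis unfolding cone_conv_def represents_def
    by (intro exI[of _ "\<lambda>_. Apex"] exI[of _ "\<lambda>_ _. x"]) simp
next
  case (2 X t)
  obtain p where p: "\<And>n. p n \<in> geodesics_from K \<rho> x" "(\<lambda>n. ang x (dir x (p n)) X) \<longlonglongrightarrow> 0"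
    using dir_approx[OF x 2(3)] by blast
  have "cone_conv x (\<lambda>n. Ray (dir x (p n)) t) u"
    unfolding cone_conv_def
    by (intro disjI2 exI[of _ t] exI[of _ X] exI[of _ "\<lambda>n. dir x (p n)"]) (simp add: p 2 dir_in[OF x p(1)])
  moreover have "represents x (\<lambda>\<epsilon>. snd (p n) (t * \<epsilon>)) (Ray (dir x (p n)) t)" for n
    unfolding represents_def by (intro disjI2 exI[of _ t] exI[of _ "p n"]) (simp add: p 2)
  ultimately show ?thesis
    by (intro exI[of _ "\<lambda>n. Ray (dir x (p n)) t"] exI[of _ "\<lambda>n \<epsilon>. snd (p n) (t * \<epsilon>)"]) simp
qed

lemma represents_eventually_in:
  assumes "represents x c u"
  shows "\<forall>\<^sub>F \<epsilon> in at_right 0. c \<epsilon> \<in> K"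
  using assms
proof (cases rule: representsE)
  case 1
  then show ?thesis using x by simp
next
  case (2 a p)
  then show ?thesis using eventually_scaled_le[OF x, of a "fst p"] geodesics_fromD[OF 2(2)]
    by (auto elim!: eventually_mono)
qed

lemma tdist_ray_dir:
  assumes "p \<in> geodesics_from K \<rho> x" "q \<in> geodesics_from K \<rho> x" "0 < a" "0 < b"
  shows "td (Ray (dir x p) a) (Ray (dir x q) b) = sqrt (a\<^sup>2 + b\<^sup>2 - 2 * a * b * gcos x p q)"
proof -
  have "Ray (dir x p) a \<in> T" "Ray (dir x q) b \<in> T"
    using assms dir_in[OF x] by (auto simp: tangent_cone_iff)
  then show ?thesis using assms by (simp add: tdist_eq angle_dir[OF x] cos_geo_angle[OF x] mult.assoc)
qed

lemma tdist_Apex: "u \<in> T \<Longrightarrow> td Apex u = tlen u" "u \<in> T \<Longrightarrow> td u Apex = tlen u"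
  by (auto simp: tdist_eq tangent_cone_iff)

lemma represents_tendsto:
  assumes "represents x c u" "represents x c' u'"
  shows "((\<lambda>\<epsilon>. \<rho> (c \<epsilon>) (c' \<epsilon>) / \<epsilon>) \<longlongrightarrow> td u u') (at_right 0)"
  using assms(1)
proof (cases rule: representsE)
  case 1
  note u = this
  from assms(2) show ?thesis
  proof (cases rule: representsE)
    case 1
    then show ?thesis using u x represents_in[OF assms(1)] by (simp add: tdist_Apex)
  next
    case (2 b q)
    have "((\<lambda>\<epsilon>. \<rho> (snd q (0 * \<epsilon>)) (snd q (b * \<epsilon>)) / \<epsilon>) \<longlongrightarrow> sqrt (0\<^sup>2 + b\<^sup>2 - 2 * 0 * b * gcos x q q)) (at_right 0)"
      by (rule dist_geo_tendsto[OF x]) (use 2 in auto)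
    then show ?thesis using u 2 represents_in[OF assms(2)] geodesics_fromD(2)[OF 2(2)] by (simp add: tdist_Apex)
  qed
next
  case (2 a p)
  note u = this
  from assms(2) show ?thesis
  proof (cases rule: representsE)
    case 1
    have "((\<lambda>\<epsilon>. \<rho> (snd p (a * \<epsilon>)) (snd p (0 * \<epsilon>)) / \<epsilon>) \<longlongrightarrow> sqrt (a\<^sup>2 + 0\<^sup>2 - 2 * a * 0 * gcos x p p)) (at_right 0)"
      by (rule dist_geo_tendsto[OF x]) (use u in auto)
    then show ?thesis using u 1 represents_in[OF assms(1)] geodesics_fromD(2)[OF u(2)] by (simp add: tdist_Apex)
  next
    case (2 b q)
    then show ?thesis using u dist_geo_tendsto[OF x u(2) 2(2), of a b] by (simp add: tdist_ray_dir)
  qed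
qed

lemma tdist_triangle:
  assumes "u \<in> T" "v \<in> T" "w \<in> T"
  shows "td u w \<le> td u v + td v w"
proof -
  obtain U cu where u: "cone_conv x U u" "\<And>n. represents x (cu n) (U n)" using represents_approx[OF assms(1)] by blast
  obtain V cv where v: "cone_conv x V v" "\<And>n. represents x (cv n) (V n)" using represents_approx[OF assms(2)] by blast
  obtain W cw where w: "cone_conv x W w" "\<And>n. represents x (cw n) (W n)" using represents_approx[OF assms(3)] by blast
  have "td (U n) (W n) \<le> td (U n) (V n) + td (V n) (W n)" for n
  proof (rule tendsto_le)
    show "((\<lambda>\<epsilon>. \<rho> (cu n \<epsilon>) (cv n \<epsilon>) / \<epsilon> + \<rho> (cv n \<epsilon>) (cw n \<epsilon>) / \<epsilon>) \<longlongrightarrow> td (U n) (V n) + td (V n) (W n)) (at_right 0)"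
      by (intro tendsto_add represents_tendsto u v w)
    show "((\<lambda>\<epsilon>. \<rho> (cu n \<epsilon>) (cw n \<epsilon>) / \<epsilon>) \<longlongrightarrow> td (U n) (W n)) (at_right 0)"
      by (intro represents_tendsto u w)
    show "\<forall>\<^sub>F \<epsilon> in at_right 0. \<rho> (cu n \<epsilon>) (cw n \<epsilon>) / \<epsilon> \<le> \<rho> (cu n \<epsilon>) (cv n \<epsilon>) / \<epsilon> + \<rho> (cv n \<epsilon>) (cw n \<epsilon>) / \<epsilon>"
      using represents_eventually_in[OF u(2)[of n]] represents_eventually_in[OF v(2)[of n]]
        represents_eventually_in[OF w(2)[of n]] eventually_at_right_less[of 0]
      by eventually_elim (simp add: add_divide_distrib[symmetric] divide_right_mono triangle)
  qed simp
  then show ?thesis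
    by (intro LIMSEQ_le[OF tdist_tendsto_if_cone_conv[OF u(1) w(1)]
          tendsto_add[OF tdist_tendsto_if_cone_conv[OF u(1) v(1)] tdist_tendsto_if_cone_conv[OF v(1) w(1)]]]) auto
qed

lemma Metric_space_tangent_cone: "Metric_space T td"
proof
  show "0 \<le> td u v" for u v by (rule tdist_nonneg)
  show "td u v = td v u" for u v unfolding tdist_def using tinner_sym by auto
qed (simp_all add: tdist_eq_0_iff tdist_triangle)

interpretation T: Metric_space T td by (rule Metric_space_tangent_cone)

lemma tdist_tendsto_0_if_cone_conv:
  assumes "cone_conv x U u"
  shows "(\<lambda>n. td (U n) u) \<longlonglongrightarrow> 0"
proof -
  have "u \<in> T" using cone_conv_in[OF assms] by blast
  then show ?thesis using tdist_tendsto_if_cone_conv[OF assms cone_conv_const[of u]] by simp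
qed

text \<open>The lengths converge. If their limit is \<open>0\<close>, the sequence tends to the
  apex. Otherwise lengths eventually exceed half the limit, the squared distance then controls
  \<open>1 - cos\<close> of the angle, and the directions are Cauchy in a complete space.\<close>

lemma mcomplete_tangent_cone: "T.mcomplete"
  unfolding T.mcomplete_def
proof (intro allI impI)
  fix U assume U: "T.MCauchy U"
  then have UT: "U n \<in> T" for n unfolding T.MCauchy_def by auto
  have "Cauchy (\<lambda>n. tlen (U n))"
  proof (rule metric_CauchyI)
    fix e :: real assume "0 < e"
    then obtain N where "\<forall>n n'. N \<le> n \<longrightarrow> N \<le> n' \<longrightarrow> td (U n) (U n') < e" using U unfolding T.MCauchy_def by blast
    then show "\<exists>M. \<forall>m\<ge>M. \<forall>n\<ge>M. dist (tlen (U m)) (tlen (U n)) < e"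
      unfolding dist_real_def using tlen_diff_le_tdist[OF UT UT] by (meson le_less_trans)
  qed
  then obtain t where t: "(\<lambda>n. tlen (U n)) \<longlonglongrightarrow> t" using Cauchy_convergent convergent_def by blast
  have "0 \<le> t" by (rule LIMSEQ_le_const[OF t]) (use tlen_nonneg[OF UT] in auto)
  then consider "t = 0" | "0 < t" by linarith
  then have "\<exists>u\<in>T. (\<lambda>n. td (U n) u) \<longlonglongrightarrow> 0"
  proof cases
    case 1
    then have "(\<lambda>n. td (U n) Apex) \<longlonglongrightarrow> 0" using t by (simp add: tdist_Apex UT)
    then show ?thesis by (auto simp: tangent_cone_iff)
  next
    case 2
    then have "\<forall>\<^sub>F n in sequentially. t / 2 < tlen (U n)" using order_tendstoD(1)[OF t, of "t / 2"] by simp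
    then obtain N0 where N0: "\<And>n. N0 \<le> n \<Longrightarrow> t / 2 < tlen (U n)" unfolding eventually_sequentially by blast
    define X where "X n = ray_dir (U (n + N0))" for n
    define r where "r n = tlen (U (n + N0))" for n
    have UX: "U (n + N0) = Ray (X n) (r n)" "X n \<in> Dirs x" "t / 2 < r n" for n
      using UT[of "n + N0"] N0[of "n + N0"] 2 unfolding X_def r_def by (auto simp: tangent_cone_iff)
    have ang: "1 - cos (ang x (X m) (X n)) \<le> (td (U (m + N0)) (U (n + N0)))\<^sup>2 * (2 / t\<^sup>2)" for m n
    proof -
      let ?c = "cos (ang x (X m) (X n))"
      have "t / 2 * (t / 2) \<le> r m * r n" using UX(3)[of m] UX(3)[of n] 2 by (intro mult_mono) auto
      then have "t / 2 * (t / 2) * (1 - ?c) \<le> r m * r n * (1 - ?c)" by (intro mult_right_mono) auto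
      moreover have "(td (U (m + N0)) (U (n + N0)))\<^sup>2 = (r m - r n)\<^sup>2 + 2 * (r m * r n * (1 - ?c))"
        unfolding tdist_sq[OF UT UT] unfolding UX by (simp add: power2_diff algebra_simps)
      moreover have "0 \<le> (r m - r n)\<^sup>2" by simp
      ultimately have "2 * (t / 2 * (t / 2) * (1 - ?c)) \<le> (td (U (m + N0)) (U (n + N0)))\<^sup>2" by linarith
      then show ?thesis using 2 by (simp add: field_simps power2_eq_square)
    qed
    have "D.MCauchy X" unfolding D.MCauchy_def
    proof (intro conjI allI impI)
      fix e :: real assume e: "0 < e"
      \<comment> \<open>The cosine is strictly decreasing on \<open>[0, pi]\<close> only. The
        tolerance for distances below is chosen so that the bound \<open>ang\<close> gives exactly
        \<open>1 - cos e'\<close>.\<close>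
      define e' where "e' = min e pi"
      have e': "0 < e'" "e' \<le> e" "e' \<le> pi" unfolding e'_def using e by auto
      have "cos e' < 1" using cos_monotone_0_pi[of 0 e'] e' by simp
      then have "0 < sqrt ((1 - cos e') * t\<^sup>2 / 2)" using 2 by simp
      then obtain N where N: "\<And>n n'. N \<le> n \<Longrightarrow> N \<le> n' \<Longrightarrow> td (U n) (U n') < sqrt ((1 - cos e') * t\<^sup>2 / 2)"
        using U unfolding T.MCauchy_def by blast
      show "\<exists>N. \<forall>n n'. N \<le> n \<longrightarrow> N \<le> n' \<longrightarrow> ang x (X n) (X n') < e"
      proof (intro exI allI impI)
        fix n n' assume n: "N \<le> n" "N \<le> n'"
        then have "(td (U (n + N0)) (U (n' + N0)))\<^sup>2 < (sqrt ((1 - cos e') * t\<^sup>2 / 2))\<^sup>2"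
          using N[of "n + N0" "n' + N0"] by (intro power_strict_mono) auto
        also have "\<dots> = (1 - cos e') * t\<^sup>2 / 2" using \<open>cos e' < 1\<close> by simp
        finally have "(td (U (n + N0)) (U (n' + N0)))\<^sup>2 * (2 / t\<^sup>2) < 1 - cos e'"
          using 2 by (simp add: field_simps)
        then have "cos e' < cos (ang x (X n) (X n'))" using ang[of n n'] by simp
        then have "ang x (X n) (X n') < e'"
          using cos_mono_less_eq[of e' "ang x (X n) (X n')"] angle_range[OF x UX(2)[of n] UX(2)[of n']] e' by simp
        then show "ang x (X n) (X n') < e" using e' by simp
      qed
    qed (use UX in auto)
    then obtain Y where "limitin D.mtopology X Y sequentially"
      using mcomplete_directions[OF x] unfolding D.mcomplete_def by blast
    then have Y: "Y \<in> Dirs x" "(\<lambda>n. ang x (X n) Y) \<longlonglongrightarrow> 0"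
      unfolding D.limitin_metric_dist_null by auto
    have YT: "Ray Y t \<in> T" using Y 2 by (simp add: tangent_cone_iff)
    have "(\<lambda>n. sqrt ((r n)\<^sup>2 + t\<^sup>2 - 2 * (r n * t * cos (ang x (X n) Y)))) \<longlonglongrightarrow> sqrt (t\<^sup>2 + t\<^sup>2 - 2 * (t * t * cos 0))"
      using LIMSEQ_ignore_initial_segment[OF t, of N0] unfolding r_def by (intro tendsto_intros Y)
    then have "(\<lambda>n. td (U (n + N0)) (Ray Y t)) \<longlonglongrightarrow> 0"
      unfolding tdist_eq[OF UT YT] unfolding UX by (simp add: power2_eq_square)
    then have "(\<lambda>n. td (U n) (Ray Y t)) \<longlonglongrightarrow> 0" by (rule LIMSEQ_offset)
    then show ?thesis using YT by blast
  qed
  then show "\<exists>u. limitin T.mtopology U u sequentially"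
    unfolding T.limitin_metric_dist_null using UT by auto
qed

end
end

section \<open>Logarithms and geodesics in tangent cones\<close>

context hadamard begin

lemma geo_comb_CN:
  assumes "u \<in> K" "v \<in> K" "z \<in> K" "0 \<le> \<theta>" "\<theta> \<le> 1"
  shows "(\<rho> (geo_comb K \<rho> \<theta> u v) z)\<^sup>2 \<le> (1 - \<theta>) * (\<rho> u z)\<^sup>2 + \<theta> * (\<rho> v z)\<^sup>2 - \<theta> * (1 - \<theta>) * (\<rho> u v)\<^sup>2"
  using CN[OF conjunct1[OF geod_geodesic[OF assms(1,2)]] assms(3), of \<theta>] geod_geodesic[OF assms(1,2)] assms(4,5)
  unfolding geo_comb_def by simp

context
  fixes x assumes x: "x \<in> K"
begin

interpretation T: Metric_space "T x" "td x" by (rule Metric_space_tangent_cone[OF x])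

lemma geod_in_geodesics_from:
  assumes "y \<in> K" "y \<noteq> x"
  shows "(\<rho> x y, geod K \<rho> x y) \<in> geodesics_from K \<rho> x"
  using geod_geodesic[OF x assms(1)] assms x unfolding geodesics_from_def by auto

text \<open>By uniqueness a geodesic is determined by its endpoint, so that every ray in the
  direction of a geodesic is a multiple of a logarithm.\<close>

lemma geodesics_from_eq:
  assumes "p \<in> geodesics_from K \<rho> x"
  shows "p = (\<rho> x (snd p (fst p)), geod K \<rho> x (snd p (fst p)))" "snd p (fst p) \<in> K" "snd p (fst p) \<noteq> x"
proof -
  let ?y = "snd p (fst p)"
  note p = geodesics_fromD[OF assms]
  show y: "?y \<in> K" using p by simp
  have d: "\<rho> x ?y = fst p" using p by simp
  then show "?y \<noteq> x" using p(1) x by auto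
  have "snd p = geod K \<rho> x ?y"
    by (rule geodesic_unique[OF p(3) conjunct1[OF geod_geodesic[OF x y]]])
      (use geod_geodesic[OF x y] p in auto)
  then show "p = (\<rho> x ?y, geod K \<rho> x ?y)" using d by (metis prod.collapse)
qed

lemma tlog_eq:
  assumes "y \<in> K" "y \<noteq> x"
  shows "lg x y = Ray (dir x (\<rho> x y, geod K \<rho> x y)) (\<rho> x y)"
  using assms x unfolding tlog_def tpoint_def direction_to_def dir_def by auto

lemma tlog_in: "y \<in> K \<Longrightarrow> lg x y \<in> T x"
  using tlog_eq[of y] dir_in[OF x geod_in_geodesics_from[of y]] x
  by (cases "y = x") (auto simp: tangent_cone_iff[OF x] tlog_def[of _ _ x x])

lemma tlen_tlog: "y \<in> K \<Longrightarrow> tlen (lg x y) = \<rho> x y"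
  using x by (cases "y = x") (auto simp: tlog_eq tlog_def[of _ _ x x])

lemma tscale_Ray: "0 < c \<Longrightarrow> 0 < t \<Longrightarrow> tscale c (Ray X t) = Ray X (c * t)"
  unfolding tscale_def tpoint_def by simp

lemma tscale_Apex [simp]: "tscale c Apex = Apex"
  unfolding tscale_def by simp

lemma tscale_0 [simp]: "tscale 0 u = Apex"
  unfolding tscale_def tpoint_def by (simp split: tangent.split)

lemma tscale_in:
  assumes "u \<in> T x" "0 \<le> c"
  shows "tscale c u \<in> T x"
  using assms by (cases "c = 0") (auto simp: tangent_cone_iff[OF x] tscale_Ray)

lemma tlen_tscale: "u \<in> T x \<Longrightarrow> 0 \<le> c \<Longrightarrow> tlen (tscale c u) = c * tlen u"
  by (cases "c = 0") (auto simp: tangent_cone_iff[OF x] tscale_Ray)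

lemma tinner_tscale_left:
  assumes "u \<in> T x" "v \<in> T x" "0 \<le> c"
  shows "inn x (tscale c u) v = c * inn x u v"
  using assms by (cases "c = 0") (auto simp: tangent_cone_iff[OF x] tscale_Ray)

lemma tinner_tscale_right:
  assumes "u \<in> T x" "v \<in> T x" "0 \<le> c"
  shows "inn x v (tscale c u) = c * inn x v u"
  using tinner_tscale_left[OF assms] assms by (simp add: tinner_sym[OF x] tscale_in)

lemma tdist_tscale:
  assumes "u \<in> T x" "v \<in> T x" "0 \<le> c"
  shows "td x (tscale c u) (tscale c v) = c * td x u v"
proof -
  have "(td x (tscale c u) (tscale c v))\<^sup>2 = (c * td x u v)\<^sup>2"
    using assms unfolding power_mult_distrib
    by (simp add: tdist_sq[OF x] tscale_in tinner_tscale_left tinner_tscale_right tlen_tscale)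
      (simp add: power2_eq_square algebra_simps)
  then show ?thesis using assms by (simp add: power2_eq_iff_nonneg)
qed

lemma tinner_self: "u \<in> T x \<Longrightarrow> inn x u u = (tlen u)\<^sup>2"
  using tdist_sq[OF x, of u u] by simp

lemma tdist_tscale_same:
  assumes "u \<in> T x" "0 \<le> a" "0 \<le> b"
  shows "td x (tscale a u) (tscale b u) = \<bar>a - b\<bar> * tlen u"
proof -
  have "(td x (tscale a u) (tscale b u))\<^sup>2 = (\<bar>a - b\<bar> * tlen u)\<^sup>2"
    using assms unfolding power_mult_distrib
    by (simp add: tdist_sq[OF x] tscale_in tinner_tscale_left tinner_tscale_right tlen_tscale tinner_self)
      (simp add: power2_eq_square algebra_simps)
  then show ?thesis using assms tlen_nonneg[OF x] by (simp add: power2_eq_iff_nonneg)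
qed

text \<open>The left side is the Euclidean inner product in the comparison triangle. The cosine of
  the angle is a supremum over comparison cosines, and the pair of endpoints is one of its
  arguments.\<close>

lemma tinner_tlog_ge:
  assumes "y \<in> K" "z \<in> K"
  shows "((\<rho> x y)\<^sup>2 + (\<rho> x z)\<^sup>2 - (\<rho> y z)\<^sup>2) / 2 \<le> inn x (lg x y) (lg x z)"
proof (cases "y = x \<or> z = x")
  case True
  then show ?thesis using assms x by (auto simp: tlog_def[of _ _ x x] commute)
next
  case False
  then have pos: "0 < \<rho> x y" "0 < \<rho> x z" using assms x by auto
  let ?p = "(\<rho> x y, geod K \<rho> x y)" and ?q = "(\<rho> x z, geod K \<rho> x z)"
  have pq: "?p \<in> geodesics_from K \<rho> x" "?q \<in> geodesics_from K \<rho> x"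
    using False assms geod_in_geodesics_from by auto
  have "ccos x y z \<le> gcos x ?p ?q"
    using ccos_le_gcos[OF x pq, of "\<rho> x y" "\<rho> x z"] pos geod_geodesic[OF x assms(1)] geod_geodesic[OF x assms(2)] by simp
  then have "\<rho> x y * \<rho> x z * ccos x y z \<le> \<rho> x y * \<rho> x z * gcos x ?p ?q" by (intro mult_left_mono) auto
  moreover have "\<rho> x y * \<rho> x z * ccos x y z = ((\<rho> x y)\<^sup>2 + (\<rho> x z)\<^sup>2 - (\<rho> y z)\<^sup>2) / 2"
    unfolding ccos_def using pos by simp
  ultimately show ?thesis
    using False assms by (simp add: tlog_eq angle_dir[OF x pq] cos_geo_angle[OF x pq])
qed

lemma tdist_tlog_le:
  assumes "y \<in> K" "z \<in> K"
  shows "td x (lg x y) (lg x z) \<le> \<rho> y z"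
proof -
  have "(td x (lg x y) (lg x z))\<^sup>2 \<le> (\<rho> y z)\<^sup>2"
    using tinner_tlog_ge[OF assms] assms by (simp add: tdist_sq[OF x] tlog_in tlen_tlog)
  then show ?thesis by (rule power2_le_imp_le) simp
qed

text \<open>How small \<open>\<epsilon>\<close> must be depends on the curve alone and not on
  \<open>y\<close>. So a point that varies with \<open>\<epsilon>\<close>, such as a convex
  combination of two curves, may be inserted for \<open>y\<close>.\<close>

lemma tdist_scaled_tlog_le:
  assumes "represents x c u"
  shows "\<forall>\<^sub>F \<epsilon> in at_right 0. \<forall>y\<in>K. td x (tscale (1 / \<epsilon>) (lg x y)) u \<le> \<rho> y (c \<epsilon>) / \<epsilon>"
  using assms
proof (cases rule: representsE)
  case 1
  show ?thesis using eventually_at_right_less[of 0]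
    by eventually_elim (simp add: 1 tdist_Apex[OF x] tscale_in tlog_in tlen_tscale tlen_tlog commute)
next
  case (2 a p)
  have uT: "u \<in> T x" using represents_in[OF x assms] .
  show ?thesis using eventually_scaled_le[OF x less_imp_le[OF 2(1)] geodesics_fromD(1)[OF 2(2)]]
  proof (rule eventually_mono, intro ballI)
    fix \<epsilon> y assume e: "0 < \<epsilon> \<and> 0 \<le> a * \<epsilon> \<and> a * \<epsilon> \<le> fst p" and y: "y \<in> K"
    let ?z = "snd p (a * \<epsilon>)"
    have z: "?z \<in> K" "\<rho> x ?z = a * \<epsilon>" using geodesics_fromD[OF 2(2)] e by auto
    have pos: "0 < a * \<epsilon>" using e 2 by simp
    show "td x (tscale (1 / \<epsilon>) (lg x y)) u \<le> \<rho> y (c \<epsilon>) / \<epsilon>"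
    proof (cases "y = x")
      case True
      then show ?thesis using uT 2 z e by (simp add: tlog_def[of _ _ x x] tdist_Apex[OF x])
    next
      case False
      let ?q = "(\<rho> x y, geod K \<rho> x y)"
      have q: "?q \<in> geodesics_from K \<rho> x" using geod_in_geodesics_from[OF y False] .
      have b: "0 < \<rho> x y" using False y x by auto
      have "ccos x y ?z \<le> gcos x ?q p"
        using ccos_le_gcos[OF x q 2(2), of "\<rho> x y" "a * \<epsilon>"] b pos e geod_geodesic[OF x y] by simp
      then have "2 * \<rho> x y * a * \<epsilon> * ccos x y ?z \<le> 2 * \<rho> x y * a * \<epsilon> * gcos x ?q p"
        using b 2 e by (intro mult_left_mono) auto
      moreover have "2 * \<rho> x y * a * \<epsilon> * ccos x y ?z = (\<rho> x y)\<^sup>2 + (a * \<epsilon>)\<^sup>2 - (\<rho> y ?z)\<^sup>2"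
        unfolding ccos_def z(2) using b e 2 by simp
      ultimately have "(\<rho> x y)\<^sup>2 + (a * \<epsilon>)\<^sup>2 - 2 * \<rho> x y * a * \<epsilon> * gcos x ?q p \<le> (\<rho> y ?z)\<^sup>2" by linarith
      then have "((\<rho> x y)\<^sup>2 + (a * \<epsilon>)\<^sup>2 - 2 * \<rho> x y * a * \<epsilon> * gcos x ?q p) / \<epsilon>\<^sup>2 \<le> (\<rho> y ?z)\<^sup>2 / \<epsilon>\<^sup>2"
        by (intro divide_right_mono) auto
      moreover have "((\<rho> x y)\<^sup>2 + (a * \<epsilon>)\<^sup>2 - 2 * \<rho> x y * a * \<epsilon> * gcos x ?q p) / \<epsilon>\<^sup>2
          = (\<rho> x y / \<epsilon>)\<^sup>2 + a\<^sup>2 - 2 * (\<rho> x y / \<epsilon>) * a * gcos x ?q p"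
        using e by (simp add: field_simps power2_eq_square)
      ultimately have "sqrt ((\<rho> x y / \<epsilon>)\<^sup>2 + a\<^sup>2 - 2 * (\<rho> x y / \<epsilon>) * a * gcos x ?q p) \<le> sqrt ((\<rho> y ?z / \<epsilon>)\<^sup>2)"
        by (intro real_sqrt_le_mono) (simp add: power_divide)
      then show ?thesis
        using tdist_ray_dir[OF x q 2(2), of "\<rho> x y / \<epsilon>" a] b e 2 False y by (simp add: tlog_eq tscale_Ray)
    qed
  qed
qed

lemma represented_approx_CN:
  assumes u: "represents x cu u" and v: "represents x cv v" and p: "represents x cp p" and q: "represents x cq q"
    and \<theta>: "0 \<le> \<theta>" "\<theta> \<le> 1" and \<delta>: "0 < \<delta>"
  shows "\<exists>w\<in>T x. \<forall>z\<in>{p, q}. (td x w z)\<^sup>2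
    \<le> (1 - \<theta>) * (td x u z)\<^sup>2 + \<theta> * (td x v z)\<^sup>2 - \<theta> * (1 - \<theta>) * (td x u v)\<^sup>2 + \<delta>"
proof -
  define w where "w \<epsilon> = tscale (1 / \<epsilon>) (lg x (geo_comb K \<rho> \<theta> (cu \<epsilon>) (cv \<epsilon>)))" for \<epsilon>
  have ev: "\<forall>\<^sub>F \<epsilon> in at_right 0. (td x (w \<epsilon>) z)\<^sup>2
      \<le> (1 - \<theta>) * (td x u z)\<^sup>2 + \<theta> * (td x v z)\<^sup>2 - \<theta> * (1 - \<theta>) * (td x u v)\<^sup>2 + \<delta>"
    if z: "represents x cz z" for cz z
  proof -
    let ?R = "\<lambda>\<epsilon>. (1 - \<theta>) * (\<rho> (cu \<epsilon>) (cz \<epsilon>) / \<epsilon>)\<^sup>2 + \<theta> * (\<rho> (cv \<epsilon>) (cz \<epsilon>) / \<epsilon>)\<^sup>2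
      - \<theta> * (1 - \<theta>) * (\<rho> (cu \<epsilon>) (cv \<epsilon>) / \<epsilon>)\<^sup>2"
    have "(?R \<longlongrightarrow> (1 - \<theta>) * (td x u z)\<^sup>2 + \<theta> * (td x v z)\<^sup>2 - \<theta> * (1 - \<theta>) * (td x u v)\<^sup>2) (at_right 0)"
      by (intro tendsto_intros represents_tendsto[OF x] u v z)
    from order_tendstoD(2)[OF this, of "(1 - \<theta>) * (td x u z)\<^sup>2 + \<theta> * (td x v z)\<^sup>2 - \<theta> * (1 - \<theta>) * (td x u v)\<^sup>2 + \<delta>"] \<delta>
    have "\<forall>\<^sub>F \<epsilon> in at_right 0. ?R \<epsilon> < (1 - \<theta>) * (td x u z)\<^sup>2 + \<theta> * (td x v z)\<^sup>2 - \<theta> * (1 - \<theta>) * (td x u v)\<^sup>2 + \<delta>"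
      by simp
    then show ?thesis
      using represents_eventually_in[OF x u] represents_eventually_in[OF x v] represents_eventually_in[OF x z]
        tdist_scaled_tlog_le[OF z] eventually_at_right_less[of 0]
    proof eventually_elim
      case (elim \<epsilon>)
      let ?m = "geo_comb K \<rho> \<theta> (cu \<epsilon>) (cv \<epsilon>)"
      have "td x (w \<epsilon>) z \<le> \<rho> ?m (cz \<epsilon>) / \<epsilon>" using elim comb_in \<theta> unfolding w_def by blast
      then have "(td x (w \<epsilon>) z)\<^sup>2 \<le> (\<rho> ?m (cz \<epsilon>))\<^sup>2 / \<epsilon>\<^sup>2"
        using power_mono[of "td x (w \<epsilon>) z" "\<rho> ?m (cz \<epsilon>) / \<epsilon>" 2] by (simp add: power_divide)
      also have "\<dots> \<le> ((1 - \<theta>) * (\<rho> (cu \<epsilon>) (cz \<epsilon>))\<^sup>2 + \<theta> * (\<rho> (cv \<epsilon>) (cz \<epsilon>))\<^sup>2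
          - \<theta> * (1 - \<theta>) * (\<rho> (cu \<epsilon>) (cv \<epsilon>))\<^sup>2) / \<epsilon>\<^sup>2"
        using elim \<theta> by (intro divide_right_mono geo_comb_CN) auto
      also have "\<dots> = ?R \<epsilon>" by (simp add: power_divide add_divide_distrib diff_divide_distrib)
      finally show ?case using elim by linarith
    qed
  qed
  have inT: "\<forall>\<^sub>F \<epsilon> in at_right 0. w \<epsilon> \<in> T x"
    using represents_eventually_in[OF x u] represents_eventually_in[OF x v] eventually_at_right_less[of 0]
    by eventually_elim (simp add: w_def tscale_in tlog_in \<theta>)
  obtain \<epsilon> where "w \<epsilon> \<in> T x"
    "(td x (w \<epsilon>) p)\<^sup>2 \<le> (1 - \<theta>) * (td x u p)\<^sup>2 + \<theta> * (td x v p)\<^sup>2 - \<theta> * (1 - \<theta>) * (td x u v)\<^sup>2 + \<delta>"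
    "(td x (w \<epsilon>) q)\<^sup>2 \<le> (1 - \<theta>) * (td x u q)\<^sup>2 + \<theta> * (td x v q)\<^sup>2 - \<theta> * (1 - \<theta>) * (td x u v)\<^sup>2 + \<delta>"
    using eventually_happens'[OF _ eventually_conj[OF inT eventually_conj[OF ev[OF p] ev[OF q]]]]
      trivial_limit_at_right_real by blast
  then show ?thesis by blast
qed

text \<open>The admissible \<open>\<epsilon>\<close> and \<open>n\<close> depend on the test points,
  so the inequality is obtained for finitely many of them at once. Two suffice for
  \<open>geodesic_if_approx_CN\<close>.\<close>

lemma tangent_cone_approx_CN:
  assumes u: "u \<in> T x" and v: "v \<in> T x" and p: "p \<in> T x" and q: "q \<in> T x"
    and \<theta>: "0 \<le> \<theta>" "\<theta> \<le> 1" and \<delta>: "0 < \<delta>"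
  shows "\<exists>w\<in>T x. \<forall>z\<in>{p, q}. (td x w z)\<^sup>2
    \<le> (1 - \<theta>) * (td x u z)\<^sup>2 + \<theta> * (td x v z)\<^sup>2 - \<theta> * (1 - \<theta>) * (td x u v)\<^sup>2 + \<delta>"
proof -
  obtain U cu where U: "cone_conv x U u" "\<And>n. represents x (cu n) (U n)" using represents_approx[OF x u] by blast
  obtain V cv where V: "cone_conv x V v" "\<And>n. represents x (cv n) (V n)" using represents_approx[OF x v] by blast
  obtain P cp where P: "cone_conv x P p" "\<And>n. represents x (cp n) (P n)" using represents_approx[OF x p] by blast
  obtain Q cq where Q: "cone_conv x Q q" "\<And>n. represents x (cq n) (Q n)" using represents_approx[OF x q] by blast
  define N where "N u v z = (1 - \<theta>) * (td x u z)\<^sup>2 + \<theta> * (td x v z)\<^sup>2 - \<theta> * (1 - \<theta>) * (td x u v)\<^sup>2" for u v z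
  let ?i = "\<lambda>n. inverse (real (Suc n))"
  have "\<forall>n. \<exists>w. w \<in> T x \<and> (td x w (P n))\<^sup>2 \<le> N (U n) (V n) (P n) + ?i n \<and> (td x w (Q n))\<^sup>2 \<le> N (U n) (V n) (Q n) + ?i n"
  proof
    fix n
    have "0 < ?i n" by simp
    from represented_approx_CN[OF U(2) V(2) P(2) Q(2) \<theta> this, of n n n n]
    show "\<exists>w. w \<in> T x \<and> (td x w (P n))\<^sup>2 \<le> N (U n) (V n) (P n) + ?i n \<and> (td x w (Q n))\<^sup>2 \<le> N (U n) (V n) (Q n) + ?i n"
      unfolding N_def by blast
  qed
  then obtain W where W: "\<And>n. W n \<in> T x" "\<And>n. (td x (W n) (P n))\<^sup>2 \<le> N (U n) (V n) (P n) + ?i n"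
    "\<And>n. (td x (W n) (Q n))\<^sup>2 \<le> N (U n) (V n) (Q n) + ?i n" by metis
  have ev: "\<forall>\<^sub>F n in sequentially. (td x (W n) z)\<^sup>2 \<le> N u v z + \<delta>"
    if Z: "cone_conv x Z z" and WZ: "\<And>n. (td x (W n) (Z n))\<^sup>2 \<le> N (U n) (V n) (Z n) + ?i n" for Z z
  proof -
    have N: "(\<lambda>n. N (U n) (V n) (Z n) + ?i n) \<longlonglongrightarrow> N u v z + 0"
      unfolding N_def by (intro tendsto_intros tdist_tendsto_if_cone_conv[OF x] U V Z LIMSEQ_inverse_real_of_nat)
    have "0 \<le> N (U n) (V n) (Z n) + ?i n" for n by (rule order_trans[OF zero_le_power2 WZ])
    then have N0: "0 \<le> N u v z" using LIMSEQ_le_const[OF N, of 0] by simp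
    have zT: "z \<in> T x" "Z n \<in> T x" for n using cone_conv_in[OF x Z] by blast+
    have "(\<lambda>n. (sqrt (N (U n) (V n) (Z n) + ?i n) + td x (Z n) z)\<^sup>2) \<longlonglongrightarrow> (sqrt (N u v z + 0) + 0)\<^sup>2"
      by (intro tendsto_power tendsto_add tendsto_real_sqrt N tdist_tendsto_0_if_cone_conv[OF x Z])
    then have "\<forall>\<^sub>F n in sequentially. (sqrt (N (U n) (V n) (Z n) + ?i n) + td x (Z n) z)\<^sup>2 < N u v z + \<delta>"
      by (rule order_tendstoD(2)) (use N0 \<delta> in simp)
    then show ?thesis
    proof (rule eventually_mono)
      fix n assume n: "(sqrt (N (U n) (V n) (Z n) + ?i n) + td x (Z n) z)\<^sup>2 < N u v z + \<delta>"
      have "td x (W n) (Z n) \<le> sqrt (N (U n) (V n) (Z n) + ?i n)" using WZ by (rule real_le_rsqrt)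
      then have "td x (W n) z \<le> sqrt (N (U n) (V n) (Z n) + ?i n) + td x (Z n) z"
        using T.triangle[OF W(1) zT(2) zT(1), of n n] by linarith
      then have "(td x (W n) z)\<^sup>2 \<le> (sqrt (N (U n) (V n) (Z n) + ?i n) + td x (Z n) z)\<^sup>2"
        by (intro power_mono) auto
      then show "(td x (W n) z)\<^sup>2 \<le> N u v z + \<delta>" using n by linarith
    qed
  qed
  obtain n where "(td x (W n) p)\<^sup>2 \<le> N u v p + \<delta>" "(td x (W n) q)\<^sup>2 \<le> N u v q + \<delta>"
    using eventually_happens'[OF sequentially_bot eventually_conj[OF ev[OF P(1) W(2)] ev[OF Q(1) W(3)]]] by blast
  then show ?thesis using W(1) unfolding N_def by blast
qed

lemma tangent_cone_geodesic:
  assumes "u \<in> T x" "v \<in> T x"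
  shows "\<exists>l \<gamma>. geodesic (T x) (td x) l \<gamma> \<and> \<gamma> 0 = u \<and> \<gamma> l = v"
  by (rule T.geodesic_if_approx_CN[OF mcomplete_tangent_cone[OF x] assms])
    (rule tangent_cone_approx_CN[OF assms])

lemma flat_hadamard_tangent_cone:
  assumes "flat_space (T x) (td x)"
  shows "flat_hadamard (T x) (td x)"
proof unfold_locales
  show "T.mcomplete" by (rule mcomplete_tangent_cone[OF x])
  show "\<exists>l \<gamma>. geodesic (T x) (td x) l \<gamma> \<and> \<gamma> 0 = u \<and> \<gamma> l = v" if "u \<in> T x" "v \<in> T x" for u v
    by (rule tangent_cone_geodesic[OF that])
qed (use assms in \<open>auto simp: flat_space_def\<close>)

text \<open>Nonnegative rational multiples of logarithms of points of \<open>C\<close> are dense: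
  multiples of logarithms are dense because geodesic directions are, the logarithm does not increase
  distances, and the scale can be moved to a nearby rational.\<close>

lemma tangent_cone_separable:
  assumes C: "countable C" "C \<subseteq> K" "\<And>y e. y \<in> K \<Longrightarrow> 0 < e \<Longrightarrow> \<exists>c\<in>C. \<rho> c y < e"
  shows "\<exists>C'. countable C' \<and> C' \<subseteq> T x \<and> (\<forall>u\<in>T x. \<forall>e>0. \<exists>c\<in>C'. td x c u < e)"
proof (intro exI conjI ballI allI impI)
  let ?C = "(\<lambda>(r, y). tscale r (lg x y)) ` (({0..} \<inter> \<rat>) \<times> C)"
  show "countable ?C" using C(1) countable_rat by (intro countable_image countable_SIGMA) (auto intro: countable_subset)
  show "?C \<subseteq> T x" using C(2) by (auto intro!: tscale_in tlog_in)
  fix u and e :: real assume u: "u \<in> T x" and e: "0 < e"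
  obtain U c where U: "cone_conv x U u" "\<And>n. represents x (c n) (U n)" using represents_approx[OF x u] by blast
  have "\<forall>\<^sub>F n in sequentially. td x (U n) u < e / 3"
    using e by (intro order_tendstoD(2)[OF tdist_tendsto_0_if_cone_conv[OF x U(1)]]) simp
  then obtain n where n: "td x (U n) u < e / 3" using eventually_happens'[OF sequentially_bot] by blast
  from U(2)[of n] have "\<exists>s y. 0 \<le> s \<and> y \<in> K \<and> U n = tscale s (lg x y)"
  proof (cases rule: representsE)
    case 1
    then show ?thesis using x by (intro exI[of _ 0] exI[of _ x]) simp
  next
    case (2 a p)
    have eq: "p = (\<rho> x (snd p (fst p)), geod K \<rho> x (snd p (fst p)))"
      and y: "snd p (fst p) \<in> K" "snd p (fst p) \<noteq> x" by (rule geodesics_from_eq[OF 2(2)])+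
    define y where "y = snd p (fst p)"
    have "0 < \<rho> x y" using y x unfolding y_def by auto
    moreover have "lg x y = Ray (dir x p) (\<rho> x y)"
      using tlog_eq[OF y] eq unfolding y_def by simp
    ultimately have "U n = tscale (a / \<rho> x y) (lg x y)" using 2 by (simp add: tscale_Ray)
    then show ?thesis using y 2(1) unfolding y_def by (meson divide_nonneg_nonneg less_imp_le nonneg)
  qed
  then obtain s y where s: "0 \<le> s" "y \<in> K" "U n = tscale s (lg x y)" by blast
  \<comment> \<open>Changing the scale from \<open>s\<close> to a rational \<open>r\<close> moves
    the vector by \<open>(r - s) * \<rho> x y\<close>, at most a third of \<open>e\<close>. The
    added \<open>1\<close> keeps the denominator positive when \<open>y = x\<close>, and likewise
    for \<open>r\<close> below.\<close>
  have "s < s + e / (3 * (\<rho> x y + 1))" using e by (simp add: add_pos_nonneg add.commute)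
  then obtain r where r: "r \<in> \<rat>" "s < r" "r < s + e / (3 * (\<rho> x y + 1))" using Rats_dense_in_real by blast
  have r0: "0 \<le> r" using r s by simp
  have "0 < e / (3 * (r + 1))" using e r0 by simp
  then obtain y' where y': "y' \<in> C" "\<rho> y' y < e / (3 * (r + 1))" using C(3)[OF s(2)] by blast
  have y'K: "y' \<in> K" using y' C by auto
  let ?w = "tscale r (lg x y')"
  have third: "a * (e / (3 * a)) = e / 3" if "a \<noteq> 0" for a :: real using that by simp
  have "td x ?w (tscale r (lg x y)) = r * td x (lg x y') (lg x y)"
    by (rule tdist_tscale) (use s y'K r0 in \<open>auto intro: tlog_in\<close>)
  also have "\<dots> \<le> r * \<rho> y' y" using tdist_tlog_le[OF y'K s(2)] r0 by (rule mult_left_mono)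
  also have "\<dots> \<le> (r + 1) * (e / (3 * (r + 1)))" using y' r0 by (intro mult_mono) auto
  also have "\<dots> = e / 3" using third[of "r + 1"] r0 by linarith
  finally have 1: "td x ?w (tscale r (lg x y)) \<le> e / 3" .
  have "td x (tscale r (lg x y)) (U n) = \<bar>r - s\<bar> * \<rho> x y"
    unfolding s(3) by (subst tdist_tscale_same) (use s r0 in \<open>auto simp: tlog_in tlen_tlog\<close>)
  also have "\<dots> \<le> e / (3 * (\<rho> x y + 1)) * (\<rho> x y + 1)" using r e by (intro mult_mono) auto
  also have "\<dots> = e / 3"
    using third[of "\<rho> x y + 1"] nonneg[of x y] by (simp only: mult.commute[of "e / (3 * (\<rho> x y + 1))"])
  finally have 2: "td x (tscale r (lg x y)) (U n) \<le> e / 3" .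
  have inT: "?w \<in> T x" "tscale r (lg x y) \<in> T x" "U n \<in> T x"
    using s y'K r0 by (auto intro: tscale_in tlog_in)
  have "td x ?w u \<le> td x ?w (tscale r (lg x y)) + td x (tscale r (lg x y)) (U n) + td x (U n) u"
    using T.triangle[OF inT(1,2) u] T.triangle[OF inT(2,3) u] by linarith
  then have "td x ?w u < e" using 1 2 n by linarith
  moreover have "?w \<in> ?C" using y' r r0 by auto
  ultimately show "\<exists>c\<in>?C. td x c u < e" by blast
qed

end
end

section \<open>Maximal inequality and frequencies for i.i.d. sequences\<close>

locale iid_sequence = prob_space P for P :: "'w measure" +
  fixes \<mu> :: "'e measure" and \<xi> :: "nat \<Rightarrow> 'w \<Rightarrow> 'e"
  assumes indep: "indep_vars (\<lambda>_. \<mu>) \<xi> {1..}"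
    and distr_\<xi>: "\<And>i. i \<ge> 1 \<Longrightarrow> distr P \<mu> (\<xi> i) = \<mu>"
begin

lemma measurable_\<xi> [measurable]: "i \<ge> 1 \<Longrightarrow> \<xi> i \<in> P \<rightarrow>\<^sub>M \<mu>"
  using indep unfolding indep_vars_def by simp

lemma prob_space_\<mu>: "prob_space \<mu>"
  using prob_space_distr[OF measurable_\<xi>[of 1]] distr_\<xi>[of 1] by simp

text \<open>Stationarity: every shift of the sequence has the same product law, by reindexing the
  product over \<open>{1..}\<close>. The condition \<open>k \<ge> 1\<close> is due to the indices
  starting at \<open>1\<close>.\<close>

lemma distr_shift:
  assumes "k \<ge> 1"
  shows "distr P (\<Pi>\<^sub>M i\<in>UNIV. \<mu>) (\<lambda>\<omega> i. \<xi> (i + k) \<omega>) = (\<Pi>\<^sub>M (i::nat)\<in>UNIV. \<mu>)"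
proof -
  interpret \<mu>: prob_space \<mu> by (rule prob_space_\<mu>)
  have 1: "distr P (\<Pi>\<^sub>M i\<in>{1..}. \<mu>) (\<lambda>\<omega>. \<lambda>i\<in>{1..}. \<xi> i \<omega>) = (\<Pi>\<^sub>M i\<in>{1..}. \<mu>)"
  proof -
    have "(\<Pi>\<^sub>M i\<in>{1..}. distr P \<mu> (\<xi> i)) = (\<Pi>\<^sub>M i\<in>{1..}. \<mu>)" by (intro PiM_cong refl distr_\<xi>) simp
    then show ?thesis using indep_vars_iff_distr_eq_PiM'[THEN iffD1, OF _ _ indep] by simp
  qed
  have "(\<Pi>\<^sub>M (i::nat)\<in>UNIV. \<mu>)
      = distr (\<Pi>\<^sub>M i\<in>{1..}. \<mu>) (\<Pi>\<^sub>M i\<in>UNIV. \<mu>) (\<lambda>e. \<lambda>n\<in>UNIV. e (n + k))"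
    by (rule distr_PiM_reindex[symmetric]) (use assms prob_space_\<mu> in \<open>auto simp: inj_on_def\<close>)
  also have "\<dots> = distr (distr P (\<Pi>\<^sub>M i\<in>{1..}. \<mu>) (\<lambda>\<omega>. \<lambda>i\<in>{1..}. \<xi> i \<omega>)) (\<Pi>\<^sub>M i\<in>UNIV. \<mu>) (\<lambda>e. \<lambda>n\<in>UNIV. e (n + k))"
    unfolding 1 ..
  also have "\<dots> = distr P (\<Pi>\<^sub>M i\<in>UNIV. \<mu>) ((\<lambda>e. \<lambda>n\<in>UNIV. e (n + k)) \<circ> (\<lambda>\<omega>. \<lambda>i\<in>{1..}. \<xi> i \<omega>))"
  proof (rule distr_distr)
    show "(\<lambda>e. \<lambda>n\<in>UNIV. e (n + k)) \<in> (\<Pi>\<^sub>M i\<in>{1..}. \<mu>) \<rightarrow>\<^sub>M (\<Pi>\<^sub>M i\<in>UNIV. \<mu>)"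
      by (rule measurable_restrict) (use assms in simp)
    show "(\<lambda>\<omega>. \<lambda>i\<in>{1..}. \<xi> i \<omega>) \<in> P \<rightarrow>\<^sub>M (\<Pi>\<^sub>M i\<in>{1..}. \<mu>)"
      by (rule measurable_restrict) simp
  qed
  also have "(\<lambda>e. \<lambda>n\<in>UNIV. e (n + k)) \<circ> (\<lambda>\<omega>. \<lambda>i\<in>{1..}. \<xi> i \<omega>) = (\<lambda>\<omega> i. \<xi> (i + k) \<omega>)"
    using assms by (auto simp: fun_eq_iff)
  finally show ?thesis by simp
qed

end

text \<open>The maximum of \<open>0\<close> and the first \<open>n\<close> partial sums. The
  recursion through the shifted sequence is the identity that drives Garsia's argument.\<close>

primrec max_partial_sum :: "nat \<Rightarrow> (nat \<Rightarrow> real) \<Rightarrow> real" where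
  "max_partial_sum 0 y = 0"
| "max_partial_sum (Suc n) y = max 0 (y 0 + max_partial_sum n (\<lambda>i. y (Suc i)))"

lemma max_partial_sum_nonneg: "0 \<le> max_partial_sum n y"
  by (cases n) auto

lemma sum_le_max_partial_sum: "j \<le> n \<Longrightarrow> (\<Sum>i<j. y i) \<le> max_partial_sum n y"
proof (induction n arbitrary: y j)
  case (Suc n)
  show ?case
  proof (cases j)
    case 0
    then show ?thesis using max_partial_sum_nonneg by simp
  next
    case (Suc k)
    then have "(\<Sum>i<j. y i) = y 0 + (\<Sum>i<k. y (Suc i))" by (simp only: sum.lessThan_Suc_shift)
    also have "(\<Sum>i<k. y (Suc i)) \<le> max_partial_sum n (\<lambda>i. y (Suc i))" using Suc.IH Suc Suc.prems by simp
    finally show ?thesis by simp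
  qed
qed simp

lemma max_partial_sum_mono: "max_partial_sum n y \<le> max_partial_sum (Suc n) y"
proof (induction n arbitrary: y)
  case (Suc n)
  show ?case using Suc[of "\<lambda>i. y (Suc i)"] by (simp add: max_def)
qed simp

lemma integrable_max_partial_sum:
  assumes "\<And>i. integrable M (\<lambda>\<omega>. Y i \<omega> :: real)"
  shows "integrable M (\<lambda>\<omega>. max_partial_sum n (\<lambda>i. Y i \<omega>))"
  using assms
proof (induction n arbitrary: Y)
  case (Suc n)
  have "integrable M (\<lambda>\<omega>. Y 0 \<omega> + max_partial_sum n (\<lambda>i. Y (Suc i) \<omega>))"
    using Suc.IH[of "\<lambda>i. Y (Suc i)"] Suc.prems by simp
  then show ?case by (simp add: integrable_max)
qed simp

lemma measurable_max_partial_sum: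
  assumes "\<And>i. Y i \<in> borel_measurable M"
  shows "(\<lambda>\<omega>. max_partial_sum n (\<lambda>i. Y i \<omega>)) \<in> borel_measurable M"
  using assms
proof (induction n arbitrary: Y)
  case (Suc n)
  have "(\<lambda>\<omega>. Y 0 \<omega> + max_partial_sum n (\<lambda>i. Y (Suc i) \<omega>)) \<in> borel_measurable M"
    using Suc.IH[of "\<lambda>i. Y (Suc i)"] Suc.prems by simp
  then show ?case by simp
qed simp

section \<open>Maximal ergodic inequality and convergence of frequencies\<close>

context iid_sequence begin

lemma integrable_comp_\<xi>:
  fixes h :: "'e \<Rightarrow> real"
  assumes "integrable \<mu> h" "i \<ge> 1"
  shows "integrable P (\<lambda>\<omega>. h (\<xi> i \<omega>))" "(\<integral>\<omega>. h (\<xi> i \<omega>) \<partial>P) = (\<integral>e. h e \<partial>\<mu>)"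
proof -
  have [measurable]: "h \<in> borel_measurable \<mu>" using assms by auto
  show "integrable P (\<lambda>\<omega>. h (\<xi> i \<omega>))"
    by (rule integrable_distr[of _ _ \<mu>]) (use assms distr_\<xi> in simp_all)
  show "(\<integral>\<omega>. h (\<xi> i \<omega>) \<partial>P) = (\<integral>e. h e \<partial>\<mu>)"
    using integral_distr[OF measurable_\<xi>[OF assms(2)], of h] distr_\<xi>[OF assms(2)] by simp
qed

lemma integral_max_partial_sum_shift:
  assumes [measurable]: "g \<in> borel_measurable \<mu>" and "k \<ge> 1"
  shows "(\<integral>\<omega>. max_partial_sum n (\<lambda>i. g (\<xi> (i + k) \<omega>)) \<partial>P)
    = (\<integral>e. max_partial_sum n (\<lambda>i. g (e i)) \<partial>(\<Pi>\<^sub>M i\<in>UNIV. \<mu>))"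
proof -
  have 1: "(\<lambda>\<omega> i. \<xi> (i + k) \<omega>) \<in> P \<rightarrow>\<^sub>M (\<Pi>\<^sub>M i\<in>UNIV. \<mu>)"
    using measurable_restrict[of UNIV "\<lambda>i. \<xi> (i + k)" P "\<lambda>_. \<mu>", OF measurable_\<xi>] assms(2)
    by (simp add: restrict_UNIV)
  have 2: "(\<lambda>e. max_partial_sum n (\<lambda>i. g (e i))) \<in> borel_measurable (\<Pi>\<^sub>M i\<in>UNIV. \<mu>)"
    by (rule measurable_max_partial_sum) measurable
  show ?thesis using integral_distr[OF 1 2] distr_shift[OF assms(2)] by simp
qed

text \<open>Garsia's argument for the maximal ergodic inequality.\<close>

lemma maximal_inequality:
  assumes h: "integrable \<mu> h" and pos: "\<And>e. e \<in> space \<mu> \<Longrightarrow> (0::real) \<le> h e" and a: "0 < a"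
  shows "{\<omega>\<in>space P. \<exists>n\<ge>1. a * real n < (\<Sum>i=1..n. h (\<xi> i \<omega>))} \<in> events"
    and "prob {\<omega>\<in>space P. \<exists>n\<ge>1. a * real n < (\<Sum>i=1..n. h (\<xi> i \<omega>))} \<le> (\<integral>e. h e \<partial>\<mu>) / a"
proof -
  have [measurable]: "h \<in> borel_measurable \<mu>" using h by auto
  interpret \<mu>: prob_space \<mu> by (rule prob_space_\<mu>)
  \<comment> \<open>An average of \<open>h\<close> exceeds \<open>a\<close> exactly if the
    corresponding partial sum of \<open>g\<close> is positive. \<open>Y\<close> renumbers the
    sequence from \<open>0\<close>.\<close>
  define g where "g e = h e - a" for e
  define Y where "Y \<omega> i = g (\<xi> (i + 1) \<omega>)" for \<omega> i
  define B where "B n = {\<omega>\<in>space P. 0 < max_partial_sum n (Y \<omega>)}" for n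
  have Ym [measurable]: "(\<lambda>\<omega>. Y \<omega> i) \<in> borel_measurable P" for i unfolding Y_def g_def by measurable
  have gint: "integrable \<mu> g" unfolding g_def using h by simp
  have Yint: "integrable P (\<lambda>\<omega>. Y \<omega> i)" for i
    unfolding Y_def by (rule integrable_comp_\<xi>[OF gint]) simp
  have Mint: "integrable P (\<lambda>\<omega>. max_partial_sum n (Y \<omega>))" "integrable P (\<lambda>\<omega>. max_partial_sum n (\<lambda>i. Y \<omega> (Suc i)))" for n
    using integrable_max_partial_sum[of P "\<lambda>i \<omega>. Y \<omega> i" n] integrable_max_partial_sum[of P "\<lambda>i \<omega>. Y \<omega> (Suc i)" n] Yint by simp_all
  have Bm [measurable]: "B n \<in> events" for n
    unfolding B_def using measurable_max_partial_sum[of "\<lambda>i \<omega>. Y \<omega> i" P n, OF Ym] by measurable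
  have shift: "(\<integral>\<omega>. max_partial_sum n (\<lambda>i. Y \<omega> (Suc i)) \<partial>P) = (\<integral>\<omega>. max_partial_sum n (Y \<omega>) \<partial>P)" for n
    using integral_max_partial_sum_shift[of g 1 n] integral_max_partial_sum_shift[of g 2 n] gint
    unfolding Y_def by (simp add: numeral_2_eq_2)
  have le: "prob (B (Suc n)) \<le> (\<integral>e. h e \<partial>\<mu>) / a" for n
  proof -
    let ?I = "\<lambda>\<omega>. indicator (B (Suc n)) \<omega> :: real"
    \<comment> \<open>On \<open>B (Suc n)\<close> the maximum is positive, so the recursion gives
      equality with \<open>Y \<omega> 0\<close>, which is \<open>h (\<xi> 1 \<omega>) - a\<close>.
      Off this set the maximum is \<open>0\<close>, the left side is at most \<open>0\<close>, and
      \<open>h\<close> is nonnegative.\<close>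
    have "max_partial_sum (Suc n) (Y \<omega>) - max_partial_sum n (\<lambda>i. Y \<omega> (Suc i)) \<le> h (\<xi> 1 \<omega>) - a * ?I \<omega>"
      if "\<omega> \<in> space P" for \<omega>
    proof (cases "\<omega> \<in> B (Suc n)")
      case True
      then have "max_partial_sum (Suc n) (Y \<omega>) = Y \<omega> 0 + max_partial_sum n (\<lambda>i. Y \<omega> (Suc i))"
        unfolding B_def by (simp add: max_def split: if_splits)
      then show ?thesis using True unfolding Y_def g_def by simp
    next
      case False
      then have "max_partial_sum (Suc n) (Y \<omega>) \<le> 0" using that unfolding B_def by simp
      moreover have "0 \<le> h (\<xi> 1 \<omega>)" using pos measurable_space[OF measurable_\<xi>[of 1] that] by simp
      ultimately show ?thesis using False max_partial_sum_nonneg[of n "\<lambda>i. Y \<omega> (Suc i)"] by simp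
    qed
    then have "(\<integral>\<omega>. max_partial_sum (Suc n) (Y \<omega>) - max_partial_sum n (\<lambda>i. Y \<omega> (Suc i)) \<partial>P)
        \<le> (\<integral>\<omega>. h (\<xi> 1 \<omega>) - a * ?I \<omega> \<partial>P)"
      by (intro integral_mono Bochner_Integration.integrable_diff Mint integrable_mult_right integrable_comp_\<xi>[OF h])
        (auto intro!: integrable_real_indicator simp: emeasure_eq_measure)
    also have "\<dots> = (\<integral>e. h e \<partial>\<mu>) - a * prob (B (Suc n))"
      using integrable_comp_\<xi>[OF h, of 1] by (subst Bochner_Integration.integral_diff)
        (auto intro!: integrable_real_indicator simp: emeasure_eq_measure)
    \<comment> \<open>Stationarity has replaced the shifted maximum by the unshifted one. The
      subtracted difference is therefore nonnegative, because the maxima increase with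
      \<open>n\<close>.\<close>
    finally have "a * prob (B (Suc n)) \<le> (\<integral>e. h e \<partial>\<mu>)
        - ((\<integral>\<omega>. max_partial_sum (Suc n) (Y \<omega>) \<partial>P) - (\<integral>\<omega>. max_partial_sum n (Y \<omega>) \<partial>P))"
      using Bochner_Integration.integral_diff[OF Mint(1)[of "Suc n"] Mint(2)[of n]] shift[of n] by linarith
    moreover have "(\<integral>\<omega>. max_partial_sum n (Y \<omega>) \<partial>P) \<le> (\<integral>\<omega>. max_partial_sum (Suc n) (Y \<omega>) \<partial>P)"
      by (intro integral_mono Mint max_partial_sum_mono)
    ultimately have "a * prob (B (Suc n)) \<le> (\<integral>e. h e \<partial>\<mu>)" by linarith
    then show ?thesis using a by (simp add: field_simps)
  qed
  let ?S = "{\<omega>\<in>space P. \<exists>n\<ge>1. a * real n < (\<Sum>i=1..n. h (\<xi> i \<omega>))}"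
  show [measurable]: "?S \<in> events"
  proof -
    have [measurable]: "(\<lambda>\<omega>. if n \<ge> 1 then \<Sum>i=1..n. h (\<xi> i \<omega>) else 0) \<in> borel_measurable P" for n by auto
    have "?S = {\<omega>\<in>space P. \<exists>n. n \<ge> 1 \<and> a * real n < (if n \<ge> 1 then \<Sum>i=1..n. h (\<xi> i \<omega>) else 0)}" by auto
    also have "\<dots> \<in> events" by measurable
    finally show ?thesis .
  qed
  have sub: "?S \<subseteq> (\<Union>n. B (Suc n))"
  proof safe
    fix \<omega> n assume \<omega>: "\<omega> \<in> space P" and n: "n \<ge> 1" "a * real n < (\<Sum>i=1..n. h (\<xi> i \<omega>))"
    have "(\<Sum>i<n. Y \<omega> i) = (\<Sum>i=1..n. h (\<xi> i \<omega>)) - a * real n"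
      unfolding Y_def g_def by (simp add: sum_subtractf sum.atLeast1_atMost_eq mult.commute)
    then have "0 < max_partial_sum (Suc n) (Y \<omega>)" using n sum_le_max_partial_sum[of n "Suc n" "Y \<omega>"] by simp
    then show "\<omega> \<in> (\<Union>n. B (Suc n))" using \<omega> unfolding B_def by blast
  qed
  have "incseq (\<lambda>n. B (Suc n))"
    by (rule incseq_SucI) (auto simp: B_def simp del: max_partial_sum.simps intro: less_le_trans[OF _ max_partial_sum_mono])
  then have "(\<lambda>n. prob (B (Suc n))) \<longlonglongrightarrow> prob (\<Union>n. B (Suc n))"
    by (intro finite_Lim_measure_incseq) auto
  then have "prob (\<Union>n. B (Suc n)) \<le> (\<integral>e. h e \<partial>\<mu>) / a"
    by (rule LIMSEQ_le_const2) (use le in auto)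
  moreover have "prob ?S \<le> prob (\<Union>n. B (Suc n))" by (rule finite_measure_mono[OF sub]) measurable
  ultimately show "prob ?S \<le> (\<integral>e. h e \<partial>\<mu>) / a" by linarith
qed

text \<open>For indicators Hoeffding's inequality gives deviation probabilities that decay
  geometrically in \<open>n\<close>. The Borel-Cantelli lemma then applies for each tolerance, and
  countably many tolerances suffice.\<close>

lemma frequency_tendsto:
  assumes B [measurable]: "B \<in> sets \<mu>"
  shows "AE \<omega> in P. (\<lambda>n. (\<Sum>i=1..n. indicator B (\<xi> i \<omega>)) / real n) \<longlonglongrightarrow> measure \<mu> B"
proof -
  define X where "X i \<omega> = (indicator B (\<xi> i \<omega>) :: real)" for i \<omega>
  have Xm [measurable]: "X i \<in> borel_measurable P" if "i \<ge> 1" for i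
    unfolding X_def using that by measurable
  have X1: "expectation (X 1) = measure \<mu> B"
    using integrable_comp_\<xi>(2)[of "indicator B" 1] finite_measure.emeasure_eq_measure[OF prob_space.finite_measure[OF prob_space_\<mu>]]
    unfolding X_def by simp
  have dX: "distr P borel (X i) = distr P borel (X 1)" if "i \<ge> 1" for i
  proof -
    have "distr P borel (X i) = distr \<mu> borel (indicator B :: _ \<Rightarrow> real)" if "i \<ge> 1" for i
    proof -
      have "(indicator B :: 'e \<Rightarrow> real) \<in> borel_measurable \<mu>" by measurable
      from distr_distr[OF this measurable_\<xi>[OF that]] show ?thesis
        using distr_\<xi>[OF that] unfolding X_def by (simp add: comp_def)
    qed
    then show ?thesis using that by simp
  qed
  have iX: "indep_vars (\<lambda>_. borel) X {1..n}" for n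
    using indep_vars_subset[OF indep_vars_compose2[OF indep, of "\<lambda>_. indicator B" "\<lambda>_. borel"], of "{1..n}"]
    unfolding X_def by auto
  have H: "prob {\<omega>\<in>space P. \<bar>(\<Sum>i=1..n. X i \<omega>) / real n - measure \<mu> B\<bar> \<ge> \<epsilon>} \<le> 2 * exp (- 2 * real n * \<epsilon>\<^sup>2)"
    if "n \<ge> 1" "0 \<le> \<epsilon>" for n \<epsilon>
  proof -
    interpret Hoeffding_ineq_iid P "{1..n}" X "X 1" 0 1 "measure \<mu> B"
    proof unfold_locales
      show "indep_vars (\<lambda>_. borel) X {1..n}" by (rule iX)
      show "distr P borel (X i) = distr P borel (X 1)" if "i \<in> {1..n}" for i by (rule dX) (use that in simp)
      show "X 1 \<in> borel_measurable P" by (rule Xm) simp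
      show "AE \<omega> in P. X 1 \<omega> \<in> {0..1}" unfolding X_def by (intro AE_I2) (simp add: indicator_def)
      show "measure \<mu> B \<equiv> expectation (X 1)" using X1 by simp
    qed simp
    show ?thesis using Hoeffding_ineq_abs_ge'[OF that(2)] that(1) by simp
  qed
  have ev: "AE \<omega> in P. \<forall>\<^sub>F n in sequentially. \<bar>(\<Sum>i=1..n. X i \<omega>) / real n - measure \<mu> B\<bar> < \<epsilon>" if \<epsilon>: "0 < \<epsilon>" for \<epsilon>
  proof -
    \<comment> \<open>Indexed by \<open>Suc n\<close> because the Hoeffding bound is available for
      at least one summand.\<close>
    let ?A = "\<lambda>n. {\<omega>\<in>space P. \<bar>(\<Sum>i=1..Suc n. X i \<omega>) / real (Suc n) - measure \<mu> B\<bar> \<ge> \<epsilon>}"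
    have [measurable]: "(\<lambda>\<omega>. \<Sum>i=1..Suc n. X i \<omega>) \<in> borel_measurable P" for n by (intro borel_measurable_sum Xm) auto
    have "summable (\<lambda>n. prob (?A n))"
    proof (rule summable_comparison_test')
      have "summable (\<lambda>n. exp (- 2 * \<epsilon>\<^sup>2) ^ n)" using \<epsilon> by (intro summable_geometric) simp
      then show "summable (\<lambda>n. 2 * exp (- 2 * \<epsilon>\<^sup>2) ^ n)" by (rule summable_mult)
      show "norm (prob (?A n)) \<le> 2 * exp (- 2 * \<epsilon>\<^sup>2) ^ n" if "n \<ge> 0" for n
      proof -
        have "prob (?A n) \<le> 2 * exp (- 2 * real (Suc n) * \<epsilon>\<^sup>2)" using H[of "Suc n" \<epsilon>] \<epsilon> by simp
        also have "\<dots> \<le> 2 * exp (real n * (- 2 * \<epsilon>\<^sup>2))" by (simp add: algebra_simps)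
        finally show ?thesis unfolding exp_of_nat_mult by (simp del: sum.cl_ivl_Suc)
      qed
    qed
    then have "AE \<omega> in P. \<forall>\<^sub>F n in sequentially. \<omega> \<in> space P - ?A n"
      by (intro borel_cantelli_AE1) (auto simp: emeasure_eq_measure)
    then show ?thesis
    proof (rule AE_mp, intro AE_I2 impI)
      fix \<omega> assume "\<forall>\<^sub>F n in sequentially. \<omega> \<in> space P - ?A n"
      then have "\<forall>\<^sub>F n in sequentially. \<bar>(\<Sum>i=1..Suc n. X i \<omega>) / real (Suc n) - measure \<mu> B\<bar> < \<epsilon>"
        by (rule eventually_mono) auto
      then show "\<forall>\<^sub>F n in sequentially. \<bar>(\<Sum>i=1..n. X i \<omega>) / real n - measure \<mu> B\<bar> < \<epsilon>"
        by (subst eventually_sequentially_Suc[symmetric])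
    qed
  qed
  have "AE \<omega> in P. \<forall>k. \<forall>\<^sub>F n in sequentially. \<bar>(\<Sum>i=1..n. X i \<omega>) / real n - measure \<mu> B\<bar> < inverse (real (Suc k))"
    unfolding AE_all_countable using ev by simp
  then show ?thesis
  proof (rule AE_mp, intro AE_I2 impI)
    fix \<omega> assume *: "\<forall>k. \<forall>\<^sub>F n in sequentially. \<bar>(\<Sum>i=1..n. X i \<omega>) / real n - measure \<mu> B\<bar> < inverse (real (Suc k))"
    show "(\<lambda>n. (\<Sum>i=1..n. indicator B (\<xi> i \<omega>)) / real n) \<longlonglongrightarrow> measure \<mu> B"
    proof (rule tendstoI)
      fix e :: real assume "0 < e"
      then obtain k where k: "inverse (real (Suc k)) < e" using reals_Archimedean by blast
      show "\<forall>\<^sub>F n in sequentially. dist ((\<Sum>i=1..n. indicator B (\<xi> i \<omega>)) / real n) (measure \<mu> B) < e"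
        using *[rule_format, of k] by (rule eventually_mono) (use k in \<open>auto simp: dist_real_def X_def\<close>)
    qed
  qed
qed

end

section \<open>Barycenters in flat Hadamard spaces\<close>

context Metric_space begin

lemma sets_mborel: "openin mtopology U \<Longrightarrow> U \<in> sets (mborel M d)"
  and space_mborel: "space (mborel M d) = M"
proof -
  have sub: "{U. openin mtopology U} \<subseteq> Pow M" using openin_subset by fastforce
  show "openin mtopology U \<Longrightarrow> U \<in> sets (mborel M d)" using sub unfolding mborel_def by simp
  show "space (mborel M d) = M" using sub unfolding mborel_def by (rule space_measure_of)
qed

lemma measurable_mborel_in: "\<phi> \<in> \<mu> \<rightarrow>\<^sub>M mborel M d \<Longrightarrow> e \<in> space \<mu> \<Longrightarrow> \<phi> e \<in> M"
  using measurable_space[of \<phi> \<mu> "mborel M d" e] by (simp add: space_mborel)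

lemma measurable_mdist:
  assumes \<phi>: "\<phi> \<in> \<mu> \<rightarrow>\<^sub>M mborel M d" and p: "p \<in> M"
  shows "(\<lambda>e. d (\<phi> e) p) \<in> borel_measurable \<mu>"
  unfolding borel_measurable_iff_less
proof
  fix a :: real
  have "{e \<in> space \<mu>. d (\<phi> e) p < a} = \<phi> -` mball p a \<inter> space \<mu>"
    using measurable_mborel_in[OF \<phi>] p by (auto simp: commute)
  also have "\<dots> \<in> sets \<mu>" by (intro measurable_sets[OF \<phi>] sets_mborel openin_mball)
  finally show "{e \<in> space \<mu>. d (\<phi> e) p < a} \<in> sets \<mu>" .
qed

text \<open>Send \<open>e\<close> to the first point of an enumeration of \<open>C\<close> within
  \<open>\<epsilon> / 2\<close> of \<open>\<phi> e\<close>, or to \<open>z\<close> if the index of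
  that point exceeds \<open>n\<close>. The error is at most \<open>\<epsilon> / 2\<close> plus the
  part of \<open>d (\<phi> e) z\<close> with large index, whose integral vanishes as
  \<open>n\<close> grows by dominated convergence.\<close>

lemma finite_valued_approx:
  assumes "prob_space \<mu>" and \<phi>: "\<phi> \<in> \<mu> \<rightarrow>\<^sub>M mborel M d"
    and C: "countable C" "C \<subseteq> M" "\<And>x e. x \<in> M \<Longrightarrow> 0 < e \<Longrightarrow> \<exists>c\<in>C. d c x < e"
    and z: "z \<in> M" and int: "integrable \<mu> (\<lambda>e. d (\<phi> e) z)" and \<epsilon>: "0 < \<epsilon>"
  obtains F f where "finite F" "F \<subseteq> M" "\<And>e. f e \<in> F" "f \<in> \<mu> \<rightarrow>\<^sub>M count_space UNIV"
    "integrable \<mu> (\<lambda>e. d (\<phi> e) (f e))" "(\<integral>e. d (\<phi> e) (f e) \<partial>\<mu>) < \<epsilon>"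
proof -
  interpret \<mu>: prob_space \<mu> by fact
  have "C \<noteq> {}" using C(3)[OF z, of 1] by auto
  define c where "c = from_nat_into C"
  have c: "range c = C" unfolding c_def using range_from_nat_into[OF \<open>C \<noteq> {}\<close> C(1)] .
  have cM: "c k \<in> M" for k using c C(2) by auto
  note [measurable] = measurable_mdist[OF \<phi> z] measurable_mdist[OF \<phi> cM]
  define N where "N e = (LEAST k. d (\<phi> e) (c k) < \<epsilon> / 2)" for e
  have N: "d (\<phi> e) (c (N e)) < \<epsilon> / 2" if e: "e \<in> space \<mu>" for e
  proof -
    obtain k where "d (\<phi> e) (c k) < \<epsilon> / 2"
      using C(3)[OF measurable_mborel_in[OF \<phi> e], of "\<epsilon> / 2"] \<epsilon> c by (auto simp: commute)
    then show ?thesis unfolding N_def by (rule LeastI)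
  qed
  have Nm [measurable]: "N \<in> \<mu> \<rightarrow>\<^sub>M count_space UNIV" unfolding N_def by measurable
  define g where "g n k = (if k \<le> n then c k else z)" for n k
  have gM: "g n k \<in> M" for n k unfolding g_def using cM z by simp
  have dm [measurable]: "(\<lambda>e. d (\<phi> e) (g n (N e))) \<in> borel_measurable \<mu>" for n
    by (rule measurable_compose_countable[OF measurable_mdist[OF \<phi> gM] Nm])
  define r where "r n e = (if N e \<le> n then 0 else d (\<phi> e) z)" for n e
  have rm [measurable]: "r n \<in> borel_measurable \<mu>" for n
  proof -
    have [measurable]: "Measurable.pred \<mu> (\<lambda>e. N e \<le> n)" by measurable
    show ?thesis unfolding r_def by measurable
  qed
  have le: "d (\<phi> e) (g n (N e)) \<le> \<epsilon> / 2 + r n e" if "e \<in> space \<mu>" for e n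
    using N[OF that] \<epsilon> unfolding g_def r_def by auto
  have rint: "integrable \<mu> (r n)" for n
    by (rule Bochner_Integration.integrable_bound[OF int]) (auto simp: r_def)
  have gint: "integrable \<mu> (\<lambda>e. d (\<phi> e) (g n (N e)))" for n
  proof (rule Bochner_Integration.integrable_bound[of _ "\<lambda>e. \<epsilon> / 2 + r n e"])
    have "0 \<le> r n e" for e unfolding r_def by simp
    then show "AE e in \<mu>. norm (d (\<phi> e) (g n (N e))) \<le> norm (\<epsilon> / 2 + r n e)"
      using le \<epsilon> by (intro AE_I2) (simp add: abs_of_nonneg)
  qed (use rint in auto)
  have "(\<lambda>n. \<integral>e. r n e \<partial>\<mu>) \<longlonglongrightarrow> (\<integral>e. 0 \<partial>\<mu>)"
  proof (rule integral_dominated_convergence[OF _ _ int])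
    show "AE e in \<mu>. (\<lambda>n. r n e) \<longlonglongrightarrow> 0"
    proof (intro AE_I2 tendsto_eventually)
      fix e show "\<forall>\<^sub>F n in sequentially. r n e = 0"
        using eventually_ge_at_top[of "N e"] by eventually_elim (simp add: r_def)
    qed
  qed (auto simp: r_def)
  then have "\<forall>\<^sub>F n in sequentially. (\<integral>e. r n e \<partial>\<mu>) < \<epsilon> / 2" using \<epsilon> by (intro order_tendstoD(2)) auto
  then obtain n where n: "(\<integral>e. r n e \<partial>\<mu>) < \<epsilon> / 2" using eventually_happens'[OF sequentially_bot] by blast
  show ?thesis
  proof (rule that[of "insert z (c ` {..n})" "\<lambda>e. g n (N e)"])
    show "insert z (c ` {..n}) \<subseteq> M" using cM z by auto
    show "g n (N e) \<in> insert z (c ` {..n})" for e unfolding g_def by auto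
    show "(\<lambda>e. g n (N e)) \<in> \<mu> \<rightarrow>\<^sub>M count_space UNIV" using measurable_compose[OF Nm, of "g n"] by simp
    have "(\<integral>e. d (\<phi> e) (g n (N e)) \<partial>\<mu>) \<le> (\<integral>e. \<epsilon> / 2 + r n e \<partial>\<mu>)"
      by (rule integral_mono) (use gint rint le in auto)
    also have "\<dots> < \<epsilon>" using n rint by (simp add: \<mu>.prob_space)
    finally show "(\<integral>e. d (\<phi> e) (g n (N e)) \<partial>\<mu>) < \<epsilon>" .
  qed (use gint in auto)
qed

end

lemma finite_valued_integral:
  fixes G :: "'b \<Rightarrow> real"
  assumes "finite_measure \<mu>" "finite F" "\<And>e. f e \<in> F" "f \<in> \<mu> \<rightarrow>\<^sub>M count_space UNIV"
  defines "B \<equiv> \<lambda>k. f -` {k} \<inter> space \<mu>"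
  shows "\<And>k. B k \<in> sets \<mu>"
    and "\<And>e. e \<in> space \<mu> \<Longrightarrow> G (f e) = (\<Sum>k\<in>F. G k * indicator (B k) e)"
    and "integrable \<mu> (\<lambda>e. G (f e))"
    and "(\<integral>e. G (f e) \<partial>\<mu>) = (\<Sum>k\<in>F. G k * measure \<mu> (B k))"
proof -
  interpret finite_measure \<mu> by fact
  show B [measurable]: "B k \<in> sets \<mu>" for k unfolding B_def using assms(4) by (rule measurable_sets) simp
  show eq: "G (f e) = (\<Sum>k\<in>F. G k * indicator (B k) e)" if "e \<in> space \<mu>" for e
  proof -
    have "(\<Sum>k\<in>F. G k * indicator (B k) e) = (\<Sum>k\<in>F. if k = f e then G k else 0)"
      using that by (intro sum.cong) (auto simp: B_def indicator_def)
    then show ?thesis using assms by simp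
  qed
  have iB: "integrable \<mu> (indicator (B k) :: _ \<Rightarrow> real)" for k
    by (rule integrable_real_indicator) (auto simp: emeasure_eq_measure)
  have "integrable \<mu> (\<lambda>e. \<Sum>k\<in>F. G k * indicator (B k) e)" using iB by auto
  then show "integrable \<mu> (\<lambda>e. G (f e))" using eq by (simp cong: Bochner_Integration.integrable_cong)
  have "(\<integral>e. G (f e) \<partial>\<mu>) = (\<integral>e. (\<Sum>k\<in>F. G k * indicator (B k) e) \<partial>\<mu>)"
    using eq by (intro Bochner_Integration.integral_cong) auto
  also have "\<dots> = (\<Sum>k\<in>F. G k * measure \<mu> (B k))"
    using iB by (subst Bochner_Integration.integral_sum) (auto simp: Int_absorb2 sets.sets_into_space)
  finally show "(\<integral>e. G (f e) \<partial>\<mu>) = (\<Sum>k\<in>F. G k * measure \<mu> (B k))" .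
qed

context flat_hadamard begin

text \<open>A Pettis-type definition: all affine functions \<^term>\<open>\<Delta> p q\<close> are to be integrated.\<close>

definition barycenter :: "'e measure \<Rightarrow> ('e \<Rightarrow> 'b) \<Rightarrow> 'b \<Rightarrow> bool" where
  "barycenter \<mu> \<psi> w \<longleftrightarrow> w \<in> K \<and> (\<forall>p\<in>K. \<forall>q\<in>K. integrable \<mu> (\<lambda>e. \<Delta> p q (\<psi> e)) \<and> \<Delta> p q w = (\<integral>e. \<Delta> p q (\<psi> e) \<partial>\<mu>))"

lemma barycenterD:
  assumes "barycenter \<mu> \<psi> w"
  shows "w \<in> K" "\<And>p q. p \<in> K \<Longrightarrow> q \<in> K \<Longrightarrow> integrable \<mu> (\<lambda>e. \<Delta> p q (\<psi> e))"
    "\<And>p q. p \<in> K \<Longrightarrow> q \<in> K \<Longrightarrow> \<Delta> p q w = (\<integral>e. \<Delta> p q (\<psi> e) \<partial>\<mu>)"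
  using assms unfolding barycenter_def by auto

text \<open>The objective at \<open>z\<close> is the integral of \<open>\<Delta> z y\<close>, so it
  equals \<open>(\<rho> z w)^2 - (\<rho> y w)^2\<close> and is minimal exactly at
  \<open>w\<close>.\<close>

lemma map_integral_eq_if_barycenter:
  assumes "barycenter \<mu> \<phi> w"
  shows "map_integral K \<rho> \<mu> \<phi> = w"
proof -
  have F: "(\<integral>e. (\<rho> z (\<phi> e))\<^sup>2 - (\<rho> y (\<phi> e))\<^sup>2 \<partial>\<mu>) = (\<rho> z w)\<^sup>2 - (\<rho> y w)\<^sup>2" if "z \<in> K" "y \<in> K" for z y
    using barycenterD(3)[OF assms that] unfolding \<Delta>_def by simp
  have wK: "w \<in> K" using assms barycenterD by auto
  show ?thesis unfolding map_integral_def
  proof (rule the_equality)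
    show "\<forall>y\<in>K. is_arg_min (\<lambda>z. \<integral>e. (\<rho> z (\<phi> e))\<^sup>2 - (\<rho> y (\<phi> e))\<^sup>2 \<partial>\<mu>) (\<lambda>z. z \<in> K) w"
      unfolding is_arg_min_linorder using F wK by auto
  next
    fix v assume v: "\<forall>y\<in>K. is_arg_min (\<lambda>z. \<integral>e. (\<rho> z (\<phi> e))\<^sup>2 - (\<rho> y (\<phi> e))\<^sup>2 \<partial>\<mu>) (\<lambda>z. z \<in> K) v"
    then have vK: "v \<in> K" using wK unfolding is_arg_min_def by blast
    have "(\<rho> v w)\<^sup>2 \<le> 0" using v[rule_format, OF wK] F[OF vK wK] F[OF wK wK] wK unfolding is_arg_min_linorder by auto
    then show "v = w" using vK wK by simp
  qed
qed

lemma barycenter_finite_valued: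
  assumes "prob_space \<mu>" "finite F" "F \<subseteq> K" "\<And>e. f e \<in> F" "f \<in> \<mu> \<rightarrow>\<^sub>M count_space UNIV"
  shows "\<exists>w. barycenter \<mu> f w"
proof -
  interpret \<mu>: prob_space \<mu> by fact
  define B where "B k = f -` {k} \<inter> space \<mu>" for k
  note fv = finite_valued_integral[OF \<mu>.finite_measure_axioms assms(2,4,5), folded B_def]
  note B [measurable] = fv(1)
  have int: "integrable \<mu> (\<lambda>e. \<Delta> p q (f e))" "(\<integral>e. \<Delta> p q (f e) \<partial>\<mu>) = (\<Sum>k\<in>F. measure \<mu> (B k) * \<Delta> p q k)" for p q
    using fv(3,4)[of "\<Delta> p q"] by (simp_all add: mult.commute)
  have "(\<Sum>k\<in>F. measure \<mu> (B k)) = measure \<mu> (\<Union>k\<in>F. B k)"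
    by (rule \<mu>.finite_measure_finite_Union[symmetric]) (use assms(2) B in \<open>auto simp: disjoint_family_on_def B_def\<close>)
  also have "(\<Union>k\<in>F. B k) = space \<mu>" unfolding B_def using assms(4) by auto
  finally have 1: "(\<Sum>k\<in>F. measure \<mu> (B k)) = 1" by (simp add: \<mu>.prob_space)
  obtain w where "w \<in> K" "\<And>p q. p \<in> K \<Longrightarrow> q \<in> K \<Longrightarrow> \<Delta> p q w = (\<Sum>k\<in>F. measure \<mu> (B k) * \<Delta> p q k)"
    using finite_barycenter[OF assms(2,3), of "\<lambda>k. measure \<mu> (B k)"] 1 by auto
  then show ?thesis unfolding barycenter_def using int by auto
qed

text \<open>The weights of \<open>ind_mean\<close> and of \<open>w\<close> differ by a signed measure of total mass zero, so the
  values of \<^term>\<open>\<Delta>\<close> may be compared with the one at \<open>k0\<close>.\<close>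

lemma ind_mean_finite_valued_tendsto:
  assumes "iid_sequence P \<mu> \<xi>" "finite F" "F \<subseteq> K" "\<And>e. f e \<in> F" "f \<in> \<mu> \<rightarrow>\<^sub>M count_space UNIV"
    and w: "barycenter \<mu> f w"
  shows "AE \<omega> in P. (\<lambda>n. \<rho> (ind_mean K \<rho> (\<lambda>i. f (\<xi> i \<omega>)) n) w) \<longlonglongrightarrow> 0"
proof -
  interpret iid_sequence P \<mu> \<xi> by fact
  interpret \<mu>: prob_space \<mu> by (rule prob_space_\<mu>)
  define B where "B k = f -` {k} \<inter> space \<mu>" for k
  note fv = finite_valued_integral[OF \<mu>.finite_measure_axioms assms(2,4,5), folded B_def]
  note B [measurable] = fv(1) and eq = fv(2) and Bint = fv(4)
  have wK: "w \<in> K" using w barycenterD by auto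
  have "AE \<omega> in P. \<forall>k\<in>F. (\<lambda>n. (\<Sum>i=1..n. indicator (B k) (\<xi> i \<omega>)) / real n) \<longlonglongrightarrow> measure \<mu> (B k)"
    using assms(2) frequency_tendsto[OF B] by (intro AE_finite_allI) auto
  then show ?thesis
  proof (rule AE_mp, intro AE_I2 impI)
    fix \<omega> assume \<omega>: "\<omega> \<in> space P"
      and fr: "\<forall>k\<in>F. (\<lambda>n. (\<Sum>i=1..n. indicator (B k) (\<xi> i \<omega>)) / real n) \<longlonglongrightarrow> measure \<mu> (B k)"
    have sp: "\<xi> i \<omega> \<in> space \<mu>" if "i \<ge> 1" for i using measurable_space[OF measurable_\<xi>[OF that] \<omega>] .
    define c where "c n k = (\<Sum>i=1..n. indicator (B k) (\<xi> i \<omega>)) / real n - measure \<mu> (B k)" for n k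
    \<comment> \<open>Any reference point of \<open>K\<close> would do; this one is at hand.\<close>
    define k0 where "k0 = f (\<xi> 1 \<omega>)"
    have k0: "k0 \<in> K" unfolding k0_def using assms by auto
    have bound: "\<rho> (ind_mean K \<rho> (\<lambda>i. f (\<xi> i \<omega>)) n) w \<le> (\<Sum>k\<in>F. \<bar>c n k\<bar> * \<rho> k k0)" if n: "n \<ge> 1" for n
    proof (rule dist_le_if_Delta_le[OF _ wK])
      let ?s = "ind_mean K \<rho> (\<lambda>i. f (\<xi> i \<omega>)) n"
      have fK: "f (\<xi> i \<omega>) \<in> K" for i using assms by auto
      show s: "?s \<in> K" by (rule ind_mean_in[OF n fK])
      have mean: "(\<Sum>i=1..n. G (f (\<xi> i \<omega>))) / real n = (\<Sum>k\<in>F. G k * ((\<Sum>i=1..n. indicator (B k) (\<xi> i \<omega>)) / real n))"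
        for G :: "'b \<Rightarrow> real"
      proof -
        have "(\<Sum>i=1..n. G (f (\<xi> i \<omega>))) = (\<Sum>i=1..n. \<Sum>k\<in>F. G k * indicator (B k) (\<xi> i \<omega>))"
          using eq[OF sp] by (intro sum.cong) auto
        also have "\<dots> = (\<Sum>k\<in>F. G k * (\<Sum>i=1..n. indicator (B k) (\<xi> i \<omega>)))"
          by (subst sum.swap) (simp add: sum_distrib_left)
        finally show ?thesis by (simp only: times_divide_eq_right sum_divide_distrib[symmetric])
      qed
      have diff: "(\<Sum>i=1..n. G (f (\<xi> i \<omega>))) / real n - (\<integral>e. G (f e) \<partial>\<mu>) = (\<Sum>k\<in>F. G k * c n k)" for G :: "'b \<Rightarrow> real"
        unfolding mean Bint c_def by (simp add: sum_subtractf right_diff_distrib)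
      have sum0: "(\<Sum>k\<in>F. c n k) = 0" using diff[of "\<lambda>_. 1"] n by (simp add: \<mu>.prob_space)
      have "\<Delta> w ?s ?s - \<Delta> w ?s w = (\<Sum>i=1..n. \<Delta> w ?s (f (\<xi> i \<omega>))) / real n - (\<integral>e. \<Delta> w ?s (f e) \<partial>\<mu>)"
        using ind_mean_Delta[OF n fK] barycenterD(3)[OF w wK s] wK s by simp
      also have "\<dots> = (\<Sum>k\<in>F. \<Delta> w ?s k * c n k)" by (rule diff)
      also have "\<dots> = (\<Sum>k\<in>F. \<Delta> w ?s k * c n k) - \<Delta> w ?s k0 * (\<Sum>k\<in>F. c n k)" unfolding sum0 by simp
      also have "\<dots> = (\<Sum>k\<in>F. (\<Delta> w ?s k - \<Delta> w ?s k0) * c n k)"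
        by (simp add: sum_distrib_left sum_subtractf left_diff_distrib)
      also have "\<dots> \<le> (\<Sum>k\<in>F. 2 * \<rho> ?s w * (\<bar>c n k\<bar> * \<rho> k k0))"
      proof (rule sum_mono)
        fix k assume "k \<in> F"
        then have "\<bar>\<Delta> w ?s k - \<Delta> w ?s k0\<bar> \<le> 2 * \<rho> ?s w * \<rho> k k0"
          using Delta_Lipschitz[OF wK s, of k k0] assms k0 by (auto simp: commute)
        then have "\<bar>\<Delta> w ?s k - \<Delta> w ?s k0\<bar> * \<bar>c n k\<bar> \<le> 2 * \<rho> ?s w * \<rho> k k0 * \<bar>c n k\<bar>" by (rule mult_right_mono) simp
        then show "(\<Delta> w ?s k - \<Delta> w ?s k0) * c n k \<le> 2 * \<rho> ?s w * (\<bar>c n k\<bar> * \<rho> k k0)"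
          using abs_ge_self[of "(\<Delta> w ?s k - \<Delta> w ?s k0) * c n k"] by (simp add: abs_mult mult_ac)
      qed
      finally show "\<Delta> w ?s ?s - \<Delta> w ?s w \<le> 2 * \<rho> ?s w * (\<Sum>k\<in>F. \<bar>c n k\<bar> * \<rho> k k0)" by (simp add: sum_distrib_left)
    qed (auto intro!: sum_nonneg)
    have "(\<lambda>n. \<Sum>k\<in>F. \<bar>c n k\<bar> * \<rho> k k0) \<longlonglongrightarrow> (\<Sum>k\<in>F. \<bar>measure \<mu> (B k) - measure \<mu> (B k)\<bar> * \<rho> k k0)"
      unfolding c_def using fr by (intro tendsto_intros) auto
    then have lim0: "(\<lambda>n. \<Sum>k\<in>F. \<bar>c n k\<bar> * \<rho> k k0) \<longlonglongrightarrow> 0" by simp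
    show "(\<lambda>n. \<rho> (ind_mean K \<rho> (\<lambda>i. f (\<xi> i \<omega>)) n) w) \<longlonglongrightarrow> 0"
      by (rule tendsto_sandwich[OF _ _ tendsto_const lim0])
        (use bound in \<open>auto intro: eventually_mono[OF eventually_ge_at_top[of 1]]\<close>)
  qed
qed

end

section \<open>Strong law of large numbers for inductive means\<close>

context flat_hadamard begin

lemma integrable_Delta:
  assumes "finite_measure \<mu>" and \<phi>: "\<phi> \<in> \<mu> \<rightarrow>\<^sub>M mborel K \<rho>" and z: "z \<in> K" and int: "integrable \<mu> (\<lambda>e. \<rho> (\<phi> e) z)"
    and p: "p \<in> K" and q: "q \<in> K"
  shows "integrable \<mu> (\<lambda>e. \<Delta> p q (\<phi> e))"
proof (rule Bochner_Integration.integrable_bound[of _ "\<lambda>e. \<bar>\<Delta> p q z\<bar> + 2 * \<rho> p q * \<rho> (\<phi> e) z"])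
  interpret finite_measure \<mu> by fact
  show "integrable \<mu> (\<lambda>e. \<bar>\<Delta> p q z\<bar> + 2 * \<rho> p q * \<rho> (\<phi> e) z)" using int by auto
  note [measurable] = measurable_mdist[OF \<phi> p] measurable_mdist[OF \<phi> q]
  show "(\<lambda>e. \<Delta> p q (\<phi> e)) \<in> borel_measurable \<mu>"
    unfolding \<Delta>_def commute[of p] commute[of q] by measurable
  show "AE e in \<mu>. norm (\<Delta> p q (\<phi> e)) \<le> norm (\<bar>\<Delta> p q z\<bar> + 2 * \<rho> p q * \<rho> (\<phi> e) z)"
  proof (rule AE_I2)
    fix e assume "e \<in> space \<mu>"
    then have "\<bar>\<Delta> p q (\<phi> e) - \<Delta> p q z\<bar> \<le> 2 * \<rho> p q * \<rho> (\<phi> e) z"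
      by (intro Delta_Lipschitz p q z measurable_mborel_in[OF \<phi>])
    then show "norm (\<Delta> p q (\<phi> e)) \<le> norm (\<bar>\<Delta> p q z\<bar> + 2 * \<rho> p q * \<rho> (\<phi> e) z)" by simp
  qed
qed

lemma Delta_barycenter_diff_le:
  assumes v: "barycenter \<mu> f v" and p: "p \<in> K" and q: "q \<in> K"
    and \<phi>: "\<And>e. e \<in> space \<mu> \<Longrightarrow> \<phi> e \<in> K" "integrable \<mu> (\<lambda>e. \<Delta> p q (\<phi> e))"
    and f: "\<And>e. e \<in> space \<mu> \<Longrightarrow> f e \<in> K" and int: "integrable \<mu> (\<lambda>e. \<rho> (\<phi> e) (f e))"
  shows "\<bar>\<Delta> p q v - (\<integral>e. \<Delta> p q (\<phi> e) \<partial>\<mu>)\<bar> \<le> 2 * \<rho> p q * (\<integral>e. \<rho> (\<phi> e) (f e) \<partial>\<mu>)"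
proof -
  have "\<Delta> p q v - (\<integral>e. \<Delta> p q (\<phi> e) \<partial>\<mu>) = (\<integral>e. \<Delta> p q (f e) - \<Delta> p q (\<phi> e) \<partial>\<mu>)"
    using barycenterD(2,3)[OF v p q] \<phi> by simp
  also have "\<bar>\<dots>\<bar> \<le> (\<integral>e. 2 * \<rho> p q * \<rho> (\<phi> e) (f e) \<partial>\<mu>)"
  proof (rule order_trans[OF integral_abs_bound integral_mono])
    show "\<bar>\<Delta> p q (f e) - \<Delta> p q (\<phi> e)\<bar> \<le> 2 * \<rho> p q * \<rho> (\<phi> e) (f e)" if "e \<in> space \<mu>" for e
      using Delta_Lipschitz[OF p q f[OF that] \<phi>(1)[OF that]] by (simp add: commute)
  qed (use barycenterD(2)[OF v p q] \<phi> int in auto)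
  finally show ?thesis by simp
qed

text \<open>The barycenter of \<open>\<phi>\<close> is constructed along the way, as the limit of
  the barycenters of the approximations. The maximal inequality bounds the approximation error of
  the means for all \<open>n\<close> simultaneously, so that \<open>j\<close> can be fixed before
  \<open>n\<close> tends to infinity.\<close>

theorem strong_law_of_large_numbers:
  assumes iid: "iid_sequence P \<mu> \<xi>" and \<phi>: "\<phi> \<in> \<mu> \<rightarrow>\<^sub>M mborel K \<rho>"
    and C: "countable C" "C \<subseteq> K" "\<And>x e. x \<in> K \<Longrightarrow> 0 < e \<Longrightarrow> \<exists>c\<in>C. \<rho> c x < e"
    and z: "z \<in> K" and int: "integrable \<mu> (\<lambda>e. \<rho> (\<phi> e) z)"
  shows "\<exists>w. barycenter \<mu> \<phi> w \<and> (AE \<omega> in P. (\<lambda>n. \<rho> (ind_mean K \<rho> (\<lambda>i. \<phi> (\<xi> i \<omega>)) n) w) \<longlonglongrightarrow> 0)"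
proof -
  interpret iid_sequence P \<mu> \<xi> by fact
  interpret \<mu>: prob_space \<mu> by (rule prob_space_\<mu>)
  note \<phi>K = measurable_mborel_in[OF \<phi>]
  have \<phi>int: "integrable \<mu> (\<lambda>e. \<Delta> p q (\<phi> e))" if "p \<in> K" "q \<in> K" for p q
    by (rule integrable_Delta[OF \<mu>.finite_measure_axioms \<phi> z int that])
  \<comment> \<open>The rate \<open>(1 / 4) ^ j\<close> is to be measured against thresholds
    \<open>(1 / 2) ^ j\<close>: the quotient, which bounds the probabilities in the maximal
    inequality, is still summable.\<close>
  define approx where "approx j f F \<longleftrightarrow> finite F \<and> F \<subseteq> K \<and> (\<forall>e. f e \<in> F) \<and> f \<in> \<mu> \<rightarrow>\<^sub>M count_space UNIV \<and>
      integrable \<mu> (\<lambda>e. \<rho> (\<phi> e) (f e)) \<and> (\<integral>e. \<rho> (\<phi> e) (f e) \<partial>\<mu>) < (1 / 4) ^ j" for f F and j :: nat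
  have "\<exists>f F. approx j f F" for j
    unfolding approx_def
    by (rule finite_valued_approx[OF \<mu>.prob_space_axioms \<phi> C z int, of "(1 / 4) ^ j"]) (assumption, assumption, simp, intro exI conjI allI, assumption+)
  then obtain f F where f: "\<And>j. finite (F j)" "\<And>j. F j \<subseteq> K" "\<And>j e. f j e \<in> F j" "\<And>j. f j \<in> \<mu> \<rightarrow>\<^sub>M count_space UNIV"
    "\<And>j. integrable \<mu> (\<lambda>e. \<rho> (\<phi> e) (f j e))" "\<And>j. (\<integral>e. \<rho> (\<phi> e) (f j e) \<partial>\<mu>) < (1 / 4) ^ j" 
  proof -
    obtain f F where "\<And>j. approx j (f j) (F j)" using \<open>\<And>j. \<exists>f F. approx j f F\<close> by metis
    then show ?thesis unfolding approx_def by (intro that[of F f]) blast+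
  qed
  have fK: "f j e \<in> K" for j e using f(2,3) by blast
  define err where "err j = (\<integral>e. \<rho> (\<phi> e) (f j e) \<partial>\<mu>)" for j
  have err0: "0 \<le> err j" for j unfolding err_def by (rule integral_nonneg_AE) simp
  have err: "err \<longlonglongrightarrow> 0"
    by (rule tendsto_sandwich[OF _ _ tendsto_const LIMSEQ_power_zero[of "1 / 4"]])
      (use err0 f(6) in \<open>auto simp: err_def intro!: always_eventually less_imp_le\<close>)
  obtain w where w: "\<And>j. barycenter \<mu> (f j) (w j)"
    using barycenter_finite_valued[OF \<mu>.prob_space_axioms f(1-4)] by metis
  have wK: "w j \<in> K" for j using w barycenterD by auto
  have \<Delta>w: "\<bar>\<Delta> p q (w j) - (\<integral>e. \<Delta> p q (\<phi> e) \<partial>\<mu>)\<bar> \<le> 2 * \<rho> p q * err j" if "p \<in> K" "q \<in> K" for p q j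
    unfolding err_def by (rule Delta_barycenter_diff_le[OF w that \<phi>K \<phi>int[OF that] fK f(5)])
  \<comment> \<open>Under the functional of the pair, both barycenters are close to the integral
    over \<open>\<phi>\<close>, each within its own error.\<close>
  have ww: "\<rho> (w i) (w j) \<le> err i + err j" for i j
  proof (rule dist_le_if_Delta_le[OF wK wK])
    show "\<Delta> (w j) (w i) (w i) - \<Delta> (w j) (w i) (w j) \<le> 2 * \<rho> (w i) (w j) * (err i + err j)"
      using \<Delta>w[OF wK wK, of j i i] \<Delta>w[OF wK wK, of j i j]
      unfolding commute[of "w j" "w i"] abs_le_iff distrib_left by linarith
  qed (use err0 in simp)
  have "MCauchy w" unfolding MCauchy_def
  proof (intro conjI allI impI)
    fix e :: real assume "0 < e"
    then have "\<forall>\<^sub>F j in sequentially. err j < e / 2" by (intro order_tendstoD(2)[OF err]) simp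
    then obtain N where N: "\<And>j. N \<le> j \<Longrightarrow> err j < e / 2" unfolding eventually_sequentially by blast
    show "\<exists>N. \<forall>n n'. N \<le> n \<longrightarrow> N \<le> n' \<longrightarrow> \<rho> (w n) (w n') < e"
    proof (intro exI allI impI)
      fix n n' assume "N \<le> n" "N \<le> n'"
      then show "\<rho> (w n) (w n') < e" using N[of n] N[of n'] ww[of n n'] by linarith
    qed
  qed (use wK in auto)
  then obtain l where "limitin mtopology w l sequentially" using complete unfolding mcomplete_def by blast
  then have l: "l \<in> K" "(\<lambda>j. \<rho> (w j) l) \<longlonglongrightarrow> 0" unfolding limitin_metric_dist_null by auto
  have bl: "barycenter \<mu> \<phi> l"
    unfolding barycenter_def
  proof (intro conjI ballI l \<phi>int)
    fix p q assume pq: "p \<in> K" "q \<in> K"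
    have "(\<lambda>j. \<Delta> p q (w j) - \<Delta> p q l) \<longlonglongrightarrow> 0"
      by (rule Lim_null_comparison[of _ "\<lambda>j. 2 * \<rho> p q * \<rho> (w j) l"])
        (use Delta_Lipschitz[OF pq wK l(1)] l(2) in \<open>auto intro!: tendsto_mult_right_zero always_eventually\<close>)
    moreover have "(\<lambda>j. \<Delta> p q (w j) - (\<integral>e. \<Delta> p q (\<phi> e) \<partial>\<mu>)) \<longlonglongrightarrow> 0"
      by (rule Lim_null_comparison[of _ "\<lambda>j. 2 * \<rho> p q * err j"])
        (use \<Delta>w[OF pq] err in \<open>auto intro!: tendsto_mult_right_zero always_eventually\<close>)
    ultimately show "\<Delta> p q l = (\<integral>e. \<Delta> p q (\<phi> e) \<partial>\<mu>)"
      unfolding LIM_zero_iff by (rule LIMSEQ_unique)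
  qed
  define h where "h j e = \<rho> (\<phi> e) (f j e)" for j e
  \<comment> \<open>Outside \<open>?A j\<close> every average of the distances between
    \<open>\<phi>\<close> and \<open>f j\<close> is at most \<open>(1 / 2) ^ j\<close>; by
    Borel-Cantelli this holds for all large \<open>j\<close>, almost surely.\<close>
  let ?A = "\<lambda>j. {\<omega>\<in>space P. \<exists>n\<ge>1. (1 / 2) ^ j * real n < (\<Sum>i=1..n. h j (\<xi> i \<omega>))}"
  have A: "?A j \<in> events" "prob (?A j) \<le> err j / (1 / 2) ^ j" for j
    using maximal_inequality[of "h j" "(1 / 2) ^ j"] f(5)[of j] unfolding h_def err_def by auto
  have summ: "summable (\<lambda>j. prob (?A j))"
  proof (rule summable_comparison_test'[of "\<lambda>j. (1 / 2) ^ j" 0])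
    show "norm (prob (?A j)) \<le> (1 / 2) ^ j" if "j \<ge> 0" for j
    proof -
      have "prob (?A j) \<le> (1 / 4) ^ j / (1 / 2) ^ j"
        using f(6)[of j] by (intro order_trans[OF A(2)] divide_right_mono) (auto simp: err_def)
      also have "\<dots> = (1 / 2) ^ j" by (simp add: power_divide[symmetric])
      finally show ?thesis by simp
    qed
  qed (simp add: summable_geometric)
  have "AE \<omega> in P. \<forall>\<^sub>F j in sequentially. \<omega> \<in> space P - ?A j"
    by (rule borel_cantelli_AE1[OF A(1) _ summ]) (simp only: emeasure_eq_measure infinity_ennreal_def ennreal_less_top)
  moreover have "AE \<omega> in P. \<forall>j. (\<lambda>n. \<rho> (ind_mean K \<rho> (\<lambda>i. f j (\<xi> i \<omega>)) n) (w j)) \<longlonglongrightarrow> 0"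
    unfolding AE_all_countable using ind_mean_finite_valued_tendsto[OF iid f(1-4) w] by blast
  ultimately have "AE \<omega> in P. (\<lambda>n. \<rho> (ind_mean K \<rho> (\<lambda>i. \<phi> (\<xi> i \<omega>)) n) l) \<longlonglongrightarrow> 0"
  proof eventually_elim
    case (elim \<omega>)
    have \<omega>: "\<omega> \<in> space P" using eventually_happens'[OF sequentially_bot elim(1)] by blast
    have \<xi>s: "\<phi> (\<xi> i \<omega>) \<in> K" if "i \<ge> 1" for i using \<phi>K[OF measurable_space[OF measurable_\<xi>[OF that] \<omega>]] .
    show ?case
    proof (rule order_tendstoI)
      fix e :: real assume "0 < e"
      then have e3: "0 < e / 3" by simp
      have half: "(\<lambda>j. (1 / 2 :: real) ^ j) \<longlonglongrightarrow> 0" by (rule LIMSEQ_power_zero) simp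
      obtain j where j: "\<omega> \<in> space P - ?A j" "(1 / 2) ^ j < e / 3" "\<rho> (w j) l < e / 3"
        using eventually_happens'[OF sequentially_bot eventually_conj[OF elim(1)
            eventually_conj[OF order_tendstoD(2)[OF half e3] order_tendstoD(2)[OF l(2) e3]]]] by blast
      have "\<forall>\<^sub>F n in sequentially. \<rho> (ind_mean K \<rho> (\<lambda>i. f j (\<xi> i \<omega>)) n) (w j) < e / 3"
        using elim(2) e3 by (intro order_tendstoD(2)) auto
      then show "\<forall>\<^sub>F n in sequentially. \<rho> (ind_mean K \<rho> (\<lambda>i. \<phi> (\<xi> i \<omega>)) n) l < e"
        using eventually_ge_at_top[of 1]
      proof eventually_elim
        case (elim n)
        let ?s = "ind_mean K \<rho> (\<lambda>i. \<phi> (\<xi> i \<omega>)) n" and ?t = "ind_mean K \<rho> (\<lambda>i. f j (\<xi> i \<omega>)) n"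
        have st: "?s \<in> K" "?t \<in> K" using elim(2) \<xi>s fK by (auto intro!: ind_mean_in)
        have "\<rho> ?s ?t \<le> (\<Sum>i=1..n. h j (\<xi> i \<omega>)) / real n"
          unfolding h_def using elim(2) \<xi>s fK by (intro dist_ind_mean_le) auto
        also have "\<dots> \<le> (1 / 2) ^ j"
        proof -
          have "(\<Sum>i=1..n. h j (\<xi> i \<omega>)) \<le> (1 / 2) ^ j * real n" using j(1) elim(2) \<omega> not_le by blast
          then show ?thesis using elim(2) by (simp add: divide_le_eq)
        qed
        finally have "\<rho> ?s ?t \<le> (1 / 2) ^ j" .
        moreover have "\<rho> ?s l \<le> \<rho> ?s ?t + \<rho> ?t (w j) + \<rho> (w j) l"
          using triangle[OF st(1,2) l(1)] triangle[OF st(2) wK l(1), of j] by linarith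
        ultimately show ?case using elim(1) j(2,3) by linarith
      qed
    qed (auto intro!: always_eventually intro: less_le_trans)
  qed
  then show ?thesis using bl by blast
qed

end

section \<open>Resolvents\<close>

text \<open>Stability of \<open>resolvent_estimate\<close>. \<open>D\<close> is the distance of the
  resolvents \<open>z\<close> at \<open>(x, l)\<close> and \<open>z'\<close> at
  \<open>(y, m)\<close>, \<open>a\<close> and \<open>b\<close> are their distances to
  \<open>x\<close> and \<open>y\<close>, \<open>r\<close> and \<open>s\<close> the crossed
  distances, \<open>\<delta>\<close> is the distance of \<open>x\<close> and \<open>y\<close>, and
  \<open>e\<close> is the defect in the tangent cone. Without perturbation the inequality forces
  \<open>D = 0\<close>. A bound on one of \<open>a\<close> and \<open>b\<close> is enough, as they
  differ by at most \<open>D + \<delta>\<close>.\<close>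

lemma perturbation_bound:
  fixes \<epsilon> M l :: real
  assumes \<epsilon>: "0 < \<epsilon>" and M: "0 \<le> M" and l: "0 < l"
  obtains \<eta> where "0 < \<eta>" "\<eta> \<le> 1"
    "\<And>m \<delta> e D a b r s. \<lbrakk>0 < m; \<bar>l - m\<bar> \<le> \<eta>; 0 \<le> \<delta>; \<delta> \<le> \<eta>; e \<le> \<eta>; 0 \<le> D; 0 \<le> a; 0 \<le> b; 0 \<le> r; 0 \<le> s;
      r \<le> b + \<delta>; s \<le> a + \<delta>; \<bar>a - b\<bar> \<le> D + \<delta>; a \<le> M \<or> b \<le> M;
      (l + m) * D\<^sup>2 \<le> m * (r\<^sup>2 - a\<^sup>2) + l * (s\<^sup>2 - b\<^sup>2) + 2 * l * m * e * D\<rbrakk> \<Longrightarrow> D < \<epsilon>"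
proof -
  \<comment> \<open>Made for a contradiction: \<open>D \<ge> \<epsilon>\<close> makes fixed
    quantities multiples of \<open>D\<close>, as \<open>1 \<le> D / \<epsilon>\<close>. Then
    \<open>D + \<delta> \<le> c1 * D\<close>, \<open>M + D + \<delta> \<le> c2 * D\<close>, and the
    terms with \<open>\<delta>\<close> are at most \<open>\<eta> * c3 * D^2\<close>.
    \<open>C\<close> collects the total, and \<open>\<eta> * C \<le> l / 2\<close> makes it too
    small to dominate \<open>(l + m) * D^2\<close>.\<close>
  define c1 c2 c3 where "c1 = 1 + 1 / \<epsilon>" and "c2 = 1 + (M + 1) / \<epsilon>" and "c3 = (2 * c2 + 1 / \<epsilon>) / \<epsilon>"
  define C where "C = 2 * c1 * c2 + (2 * l + 1) * c3 + 2 * l * (l + 1) / \<epsilon>"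
  have pos: "0 < c1" "0 < c2" "0 < c3" unfolding c1_def c2_def c3_def using \<epsilon> M by (auto intro!: add_pos_nonneg divide_pos_pos)
  then have C: "0 < C" unfolding C_def using \<epsilon> l by (auto intro!: add_pos_nonneg add_pos_pos)
  define \<eta> where "\<eta> = min 1 (l / (2 * C))"
  have \<eta>: "0 < \<eta>" "\<eta> \<le> 1" "\<eta> * C \<le> l / 2" unfolding \<eta>_def using l C by (auto simp: min_def field_simps)
  show thesis
  proof (rule that[OF \<eta>(1,2)], rule ccontr)
    fix m \<delta> e D a b r s :: real
    assume m: "0 < m" "\<bar>l - m\<bar> \<le> \<eta>" and \<delta>: "0 \<le> \<delta>" "\<delta> \<le> \<eta>" and e: "e \<le> \<eta>" and D0: "0 \<le> D"
      and a: "0 \<le> a" and b: "0 \<le> b" and r: "0 \<le> r" "r \<le> b + \<delta>" and s: "0 \<le> s" "s \<le> a + \<delta>"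
      and ab: "\<bar>a - b\<bar> \<le> D + \<delta>" "a \<le> M \<or> b \<le> M"
      and main: "(l + m) * D\<^sup>2 \<le> m * (r\<^sup>2 - a\<^sup>2) + l * (s\<^sup>2 - b\<^sup>2) + 2 * l * m * e * D"
      and "\<not> D < \<epsilon>"
    then have D: "\<epsilon> \<le> D" "0 < D" using \<epsilon> by auto
    have one: "1 \<le> D / \<epsilon>" using D \<epsilon> by simp
    define S where "S = M + D + \<delta>"
    have S: "a \<le> S" "b \<le> S" "0 \<le> S" unfolding S_def using ab D \<delta> M by (auto simp: abs_le_iff)
    have Dd: "D + \<delta> \<le> c1 * D"
      using one \<delta> \<eta> unfolding c1_def by (simp add: distrib_right)
    have Sd: "S \<le> c2 * D"
    proof -
      have "M + 1 \<le> (M + 1) * (D / \<epsilon>)" using mult_left_mono[OF one, of "M + 1"] M by simp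
      then show ?thesis unfolding S_def c2_def using \<delta> \<eta> by (simp add: distrib_right)
    qed
    have DD: "D \<le> D\<^sup>2 / \<epsilon>"
      using mult_left_mono[OF one, of D] D by (simp add: power2_eq_square)
    have T3: "2 * S * \<delta> + \<delta>\<^sup>2 \<le> \<eta> * (c3 * D\<^sup>2)"
    proof -
      have "2 * S * \<delta> + \<delta>\<^sup>2 = \<delta> * (2 * S + \<delta>)" by (simp add: power2_eq_square algebra_simps)
      also have "\<dots> \<le> \<eta> * (2 * (c2 * D) + D / \<epsilon>)"
        using \<delta> \<eta> S Sd one D pos by (intro mult_mono add_mono) auto
      also have "2 * (c2 * D) + D / \<epsilon> = (2 * c2 + 1 / \<epsilon>) * D" by (simp add: algebra_simps)
      also have "\<eta> * \<dots> \<le> \<eta> * ((2 * c2 + 1 / \<epsilon>) * (D\<^sup>2 / \<epsilon>))"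
        using DD \<eta> pos \<epsilon> by (intro mult_left_mono) (auto intro!: add_nonneg_nonneg)
      also have "\<dots> = \<eta> * (c3 * D\<^sup>2)" unfolding c3_def by simp
      finally show ?thesis .
    qed
    have "r\<^sup>2 \<le> (b + \<delta>)\<^sup>2" "s\<^sup>2 \<le> (a + \<delta>)\<^sup>2" using r s by (auto intro: power_mono)
    then have "m * (r\<^sup>2 - a\<^sup>2) + l * (s\<^sup>2 - b\<^sup>2) \<le> m * ((b + \<delta>)\<^sup>2 - a\<^sup>2) + l * ((a + \<delta>)\<^sup>2 - b\<^sup>2)"
      using m l by (intro add_mono mult_left_mono) auto
    \<comment> \<open>The unperturbed squares cancel up to a multiple of \<open>l - m\<close>, so
      every term now carries a small factor.\<close>
    also have "\<dots> = (l - m) * ((a - b) * (a + b)) + m * (2 * b * \<delta> + \<delta>\<^sup>2) + l * (2 * a * \<delta> + \<delta>\<^sup>2)"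
      by (simp add: power2_eq_square algebra_simps)
    also have "\<dots> \<le> \<eta> * ((D + \<delta>) * (2 * S)) + m * (2 * S * \<delta> + \<delta>\<^sup>2) + l * (2 * S * \<delta> + \<delta>\<^sup>2)"
    proof (intro add_mono mult_left_mono)
      have "(l - m) * ((a - b) * (a + b)) \<le> \<bar>l - m\<bar> * (\<bar>a - b\<bar> * \<bar>a + b\<bar>)"
        using abs_ge_self[of "(l - m) * ((a - b) * (a + b))"] by (simp add: abs_mult)
      also have "\<dots> \<le> \<eta> * ((D + \<delta>) * (2 * S))"
        using m ab S a b D \<delta> by (intro mult_mono) auto
      finally show "(l - m) * ((a - b) * (a + b)) \<le> \<eta> * ((D + \<delta>) * (2 * S))" .
    qed (use S \<delta> m l in \<open>auto intro: mult_right_mono\<close>)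
    also have "\<dots> = \<eta> * ((D + \<delta>) * (2 * S)) + (m + l) * (2 * S * \<delta> + \<delta>\<^sup>2)" by (simp add: algebra_simps)
    also have "\<dots> \<le> \<eta> * ((c1 * D) * (2 * (c2 * D))) + (2 * l + 1) * (\<eta> * (c3 * D\<^sup>2))"
    proof (rule add_mono)
      show "\<eta> * ((D + \<delta>) * (2 * S)) \<le> \<eta> * ((c1 * D) * (2 * (c2 * D)))"
        using \<eta> Dd Sd S D \<delta> pos by (intro mult_mono mult_left_mono) auto
      have "m + l \<le> 2 * l + 1" using m \<eta> by linarith
      then show "(m + l) * (2 * S * \<delta> + \<delta>\<^sup>2) \<le> (2 * l + 1) * (\<eta> * (c3 * D\<^sup>2))"
        using T3 l S \<delta> by (intro mult_mono) auto
    qed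
    finally have 1: "m * (r\<^sup>2 - a\<^sup>2) + l * (s\<^sup>2 - b\<^sup>2) \<le> \<eta> * ((c1 * D) * (2 * (c2 * D))) + (2 * l + 1) * (\<eta> * (c3 * D\<^sup>2))" .
    have "2 * l * m * e * D \<le> 2 * l * m * \<eta> * D" using l m e D by (intro mult_right_mono mult_left_mono) auto
    also have "\<dots> \<le> 2 * l * (l + 1) * \<eta> * (D\<^sup>2 / \<epsilon>)"
      using l m \<eta> DD D by (intro mult_mono) (auto simp: abs_le_iff)
    finally have 2: "2 * l * m * e * D \<le> 2 * l * (l + 1) * \<eta> * (D\<^sup>2 / \<epsilon>)" .
    have "\<eta> * ((c1 * D) * (2 * (c2 * D))) + (2 * l + 1) * (\<eta> * (c3 * D\<^sup>2)) + 2 * l * (l + 1) * \<eta> * (D\<^sup>2 / \<epsilon>)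
        = \<eta> * C * D\<^sup>2"
      unfolding C_def by (simp add: power2_eq_square distrib_left distrib_right add_divide_distrib mult_ac)
    then have "(l + m) * D\<^sup>2 \<le> \<eta> * C * D\<^sup>2" using main 1 2 by linarith
    then have "l + m \<le> \<eta> * C" using D by simp
    then show False using \<eta>(3) l m(1) by linarith
  qed
qed

section \<open>Monotone fields and estimates for their resolvents\<close>

context hadamard begin

lemma resolvent_setD:
  assumes "z \<in> resolvent_set K \<rho> A r x"
  shows "z \<in> K" "tscale (1 / r) (lg z x) \<in> A z"
  using assms unfolding resolvent_set_def by auto

lemma monotone_vfieldD:
  assumes "monotone_vfield K \<rho> A" "x \<in> K"
  shows "u \<in> A x \<Longrightarrow> u \<in> T x"
    and "y \<in> K \<Longrightarrow> u \<in> A x \<Longrightarrow> v \<in> A y \<Longrightarrow> inn x u (lg x y) \<le> - inn y v (lg y x)"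
  using assms unfolding monotone_vfield_def by auto

lemma Apex_in: "Apex \<in> T x"
  unfolding tangent_cone_def by simp

text \<open>Functionals based at the apex are inner products up to constants, which makes the affine
  calculus of flat spaces available for \<open>inn\<close>.\<close>

lemma Delta_Apex:
  assumes z: "z \<in> K" and flat: "flat_space (T z) (td z)" and u: "u \<in> T z" and q: "q \<in> T z"
  shows "flat_hadamard.\<Delta> (td z) Apex q u = 2 * inn z u q - (tlen q)\<^sup>2"
proof -
  interpret F: flat_hadamard "T z" "td z" by (rule flat_hadamard_tangent_cone[OF z flat])
  show ?thesis
    unfolding F.\<Delta>_def using u q Apex_in by (simp add: tdist_Apex[OF z] tdist_sq[OF z] tinner_sym[OF z q])
qed

text \<open>Monotonicity between \<open>z\<close> and \<open>z'\<close>, with both inner products of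
  logarithms bounded below by their Euclidean counterparts. The vector \<open>v\<close> may differ
  from the rescaled logarithm towards \<open>y\<close>; by Cauchy-Schwarz in the flat cone at
  \<open>z'\<close> the defect costs at most the last term.\<close>

lemma resolvent_estimate:
  assumes A: "monotone_vfield K \<rho> A" and z: "z \<in> resolvent_set K \<rho> A l x" and z': "z' \<in> K" and v: "v \<in> A z'"
    and x: "x \<in> K" and y: "y \<in> K" and l: "0 < l" and m: "0 < m"
    and flat: "flat_space (T z') (td z')"
  shows "(l + m) * (\<rho> z z')\<^sup>2 \<le> m * ((\<rho> x z')\<^sup>2 - (\<rho> x z)\<^sup>2) + l * ((\<rho> y z)\<^sup>2 - (\<rho> y z')\<^sup>2)
    + 2 * l * m * td z' (tscale (1 / m) (lg z' y)) v * \<rho> z z'"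
proof -
  interpret F: flat_hadamard "T z'" "td z'" by (rule flat_hadamard_tangent_cone[OF z' flat])
  have zK: "z \<in> K" using resolvent_setD[OF z] by blast
  let ?u = "tscale (1 / l) (lg z x)" and ?w = "tscale (1 / m) (lg z' y)" and ?q = "lg z' z"
  have vT: "v \<in> T z'" by (rule monotone_vfieldD(1)[OF A z' v])
  have wT: "?w \<in> T z'" using m by (intro tscale_in[OF z'] tlog_in[OF z'] y) simp
  have qT: "?q \<in> T z'" by (rule tlog_in[OF z' zK])
  have mono: "inn z ?u (lg z z') \<le> - inn z' v ?q"
    by (rule monotone_vfieldD(2)[OF A zK z' _ v]) (use resolvent_setD[OF z] in simp)
  have "((\<rho> z x)\<^sup>2 + (\<rho> z z')\<^sup>2 - (\<rho> x z')\<^sup>2) / 2 \<le> l * inn z ?u (lg z z')"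
    using tinner_tlog_ge[OF zK x z'] tinner_tscale_left[OF zK tlog_in[OF zK x] tlog_in[OF zK z'], of "1 / l"] l by simp
  then have 1: "m * (((\<rho> z x)\<^sup>2 + (\<rho> z z')\<^sup>2 - (\<rho> x z')\<^sup>2) / 2) \<le> m * (l * inn z ?u (lg z z'))"
    using m by (intro mult_left_mono) auto
  have "((\<rho> z' y)\<^sup>2 + (\<rho> z' z)\<^sup>2 - (\<rho> y z)\<^sup>2) / 2 \<le> m * inn z' ?w ?q"
    using tinner_tlog_ge[OF z' y zK] tinner_tscale_left[OF z' tlog_in[OF z' y] qT, of "1 / m"] m by simp
  then have 2: "l * (((\<rho> z' y)\<^sup>2 + (\<rho> z' z)\<^sup>2 - (\<rho> y z)\<^sup>2) / 2) \<le> l * (m * inn z' ?w ?q)"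
    using l by (intro mult_left_mono) auto
  note \<Delta> = Delta_Apex[OF z' flat _ qT]
  have ApexT: "Apex \<in> T z'" by (rule Apex_in)
  have "inn z' ?w ?q - inn z' v ?q \<le> \<rho> z z' * td z' ?w v"
    using F.Delta_Lipschitz[OF ApexT qT wT vT] \<Delta>[OF wT] \<Delta>[OF vT] tdist_Apex[OF z' qT] tlen_tlog[OF z' zK]
    by (simp add: abs_le_iff commute)
  then have "inn z' ?w ?q + inn z ?u (lg z z') \<le> \<rho> z z' * td z' ?w v"
    using mono by linarith
  then have "l * m * (inn z' ?w ?q + inn z ?u (lg z z')) \<le> l * m * (\<rho> z z' * td z' ?w v)"
    using l m by (intro mult_left_mono) auto
  then have "m * ((\<rho> z x)\<^sup>2 + (\<rho> z z')\<^sup>2 - (\<rho> x z')\<^sup>2) + l * ((\<rho> z' y)\<^sup>2 + (\<rho> z' z)\<^sup>2 - (\<rho> y z)\<^sup>2)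
      \<le> 2 * (l * m * (\<rho> z z' * td z' ?w v))"
    using 1 2 by (simp add: algebra_simps)
  then show ?thesis by (simp add: commute algebra_simps)
qed

lemma tangent_cone_ind_mean:
  assumes z: "z \<in> K" and flat: "flat_space (T z) (td z)" and n: "n \<ge> 1" and u: "\<And>i. i \<in> {1..n} \<Longrightarrow> u i \<in> T z" and q: "q \<in> T z"
  shows "ind_mean (T z) (td z) u n \<in> T z"
    and "inn z (ind_mean (T z) (td z) u n) q = (\<Sum>i=1..n. inn z (u i) q) / real n"
proof -
  interpret F: flat_hadamard "T z" "td z" by (rule flat_hadamard_tangent_cone[OF z flat])
  note \<Delta> = Delta_Apex[OF z flat _ q]
  have ApexT: "Apex \<in> T z" by (rule Apex_in)
  show s: "ind_mean (T z) (td z) u n \<in> T z" by (rule F.ind_mean_in[OF n u])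
  have "F.\<Delta> Apex q (ind_mean (T z) (td z) u n) = (\<Sum>i=1..n. F.\<Delta> Apex q (u i)) / real n"
    using F.ind_mean_Delta[of n u] n u ApexT q by blast
  also have "\<dots> = (\<Sum>i=1..n. 2 * inn z (u i) q - (tlen q)\<^sup>2) / real n"
    using \<Delta>[OF u] by (intro arg_cong2[of _ _ _ _ "(/)"] sum.cong) auto
  also have "\<dots> = 2 * ((\<Sum>i=1..n. inn z (u i) q) / real n) - (tlen q)\<^sup>2"
    using n by (simp add: sum_subtractf sum_distrib_left[symmetric] diff_divide_distrib)
  finally show "inn z (ind_mean (T z) (td z) u n) q = (\<Sum>i=1..n. inn z (u i) q) / real n"
    unfolding \<Delta>[OF s] by simp
qed

text \<open>Inner products with a fixed vector turn inductive means into averages with equal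
  weights, so the inequalities for the single fields average.\<close>

lemma monotone_ind_mean_vfield:
  assumes flat: "\<And>z. z \<in> K \<Longrightarrow> flat_space (T z) (td z)" and n: "n \<ge> 1"
    and A: "\<And>i. i \<in> {1..n} \<Longrightarrow> monotone_vfield K \<rho> (A i)"
  shows "monotone_vfield K \<rho> (ind_mean_vfield K \<rho> A n)"
  unfolding monotone_vfield_def
proof (intro conjI ballI subsetI)
  have ex: "\<exists>u. (\<forall>i\<in>{1..n}. u i \<in> A i x) \<and> s = ind_mean (T x) (td x) u n" if "s \<in> ind_mean_vfield K \<rho> A n x" for s x
    using that unfolding ind_mean_vfield_def ind_mean_set_def by blast
  show "s \<in> T x" if x: "x \<in> K" and s: "s \<in> ind_mean_vfield K \<rho> A n x" for x s
  proof -
    obtain u where u: "\<And>i. i \<in> {1..n} \<Longrightarrow> u i \<in> A i x" "s = ind_mean (T x) (td x) u n" using ex[OF s] by blast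
    show ?thesis unfolding u(2)
      by (rule tangent_cone_ind_mean(1)[OF x flat[OF x] n, of _ Apex])
        (use monotone_vfieldD(1)[OF A x] u in \<open>auto simp: tangent_cone_def\<close>)
  qed
  fix x y s t assume x: "x \<in> K" and y: "y \<in> K" and s: "s \<in> ind_mean_vfield K \<rho> A n x" and t: "t \<in> ind_mean_vfield K \<rho> A n y"
  obtain u where u: "\<And>i. i \<in> {1..n} \<Longrightarrow> u i \<in> A i x" "s = ind_mean (T x) (td x) u n" using ex[OF s] by blast
  obtain v where v: "\<And>i. i \<in> {1..n} \<Longrightarrow> v i \<in> A i y" "t = ind_mean (T y) (td y) v n" using ex[OF t] by blast
  have uT: "\<And>i. i \<in> {1..n} \<Longrightarrow> u i \<in> T x" and vT: "\<And>i. i \<in> {1..n} \<Longrightarrow> v i \<in> T y"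
    using monotone_vfieldD(1)[OF A x] monotone_vfieldD(1)[OF A y] u v by blast+
  have "inn x s (lg x y) = (\<Sum>i=1..n. inn x (u i) (lg x y)) / real n"
    unfolding u(2) by (rule tangent_cone_ind_mean(2)[OF x flat[OF x] n uT tlog_in[OF x y]])
  also have "\<dots> \<le> (\<Sum>i=1..n. - inn y (v i) (lg y x)) / real n"
    using monotone_vfieldD(2)[OF A x y] u v by (intro divide_right_mono sum_mono) auto
  also have "\<dots> = - inn y t (lg y x)"
    unfolding v(2) using tangent_cone_ind_mean(2)[OF y flat[OF y] n vT tlog_in[OF y x]] by (simp add: sum_negf)
  finally show "inn x s (lg x y) \<le> - inn y t (lg y x)" .
qed

text \<open>Uniqueness makes \<open>the_elem\<close> meaningful. It is
  \<open>resolvent_estimate\<close> with equal parameters and zero defect, where the right side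
  vanishes.\<close>

lemma resolvent_in:
  assumes flat: "\<And>z. z \<in> K \<Longrightarrow> flat_space (T z) (td z)"
    and A: "monotone_vfield K \<rho> A" and surj: "surjectivity_condition K \<rho> A" and x: "x \<in> K" and r: "0 < r"
  shows "resolvent K \<rho> A r x \<in> resolvent_set K \<rho> A r x"
proof -
  obtain z where z: "z \<in> resolvent_set K \<rho> A r x" using surj x r unfolding surjectivity_condition_def by blast
  have "z' = z" if z': "z' \<in> resolvent_set K \<rho> A r x" for z'
  proof -
    note zK = resolvent_setD[OF z] and z'K = resolvent_setD[OF z']
    interpret T: Metric_space "T z" "td z" by (rule Metric_space_tangent_cone[OF zK(1)])
    have "(r + r) * (\<rho> z' z)\<^sup>2 \<le> 0"
      using resolvent_estimate[OF A z' zK x x r r flat[OF zK(1)]] monotone_vfieldD(1)[OF A zK]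
      by (simp add: algebra_simps)
    then show ?thesis using r zK z'K by (simp add: mult_le_0_iff)
  qed
  then have "resolvent_set K \<rho> A r x = {z}" using z by blast
  then show ?thesis unfolding resolvent_def by simp
qed

text \<open>The point \<open>z\<close> is asymptotically a resolvent of the fields at
  \<open>(y, m)\<close>: the required vector is a limit of vectors taken from their graphs over
  \<open>z\<close>. The index \<open>0\<close> is left out since the mean of no terms has no
  meaning.\<close>

definition graph_approx :: "(nat \<Rightarrow> 'b vfield) \<Rightarrow> 'b \<Rightarrow> real \<Rightarrow> 'b \<Rightarrow> bool" where
  "graph_approx An y m z \<longleftrightarrow> z \<in> K \<and> (\<exists>v. (\<forall>n\<ge>1. v n \<in> An n z) \<and>
     (\<lambda>n. td z (tscale (1 / m) (lg z y)) (v n)) \<longlonglongrightarrow> 0)"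

text \<open>The radius \<open>\<eta>\<close> is fixed before the fields, the nearby parameter and
  \<open>z\<close>, so that one radius serves all \<open>\<omega>\<close>. The alternative in the
  last premise matters: the bound is at first known for the resolvents only, and later for
  \<open>z\<close>.\<close>

lemma resolvents_close_if_graph_approx:
  assumes flat: "\<And>z. z \<in> K \<Longrightarrow> flat_space (T z) (td z)"
    and \<epsilon>: "0 < \<epsilon>" and B: "0 \<le> B" and l: "0 < l" and x: "x \<in> K"
  obtains \<eta> where "0 < \<eta>" "\<eta> \<le> 1"
    "\<And>An y m z. \<lbrakk>\<And>n. n \<ge> 1 \<Longrightarrow> monotone_vfield K \<rho> (An n); \<And>n. n \<ge> 1 \<Longrightarrow> surjectivity_condition K \<rho> (An n);
      graph_approx An y m z; y \<in> K; 0 < m; \<bar>l - m\<bar> \<le> \<eta>; \<rho> x y \<le> \<eta>;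
      \<rho> y z \<le> B \<or> (\<forall>\<^sub>F n in sequentially. \<rho> x (resolvent K \<rho> (An n) l x) \<le> B)\<rbrakk>
      \<Longrightarrow> \<forall>\<^sub>F n in sequentially. \<rho> (resolvent K \<rho> (An n) l x) z < \<epsilon>"
proof (rule perturbation_bound[OF \<epsilon> B l])
  fix \<eta> :: real
  assume \<eta>: "0 < \<eta>" "\<eta> \<le> 1"
    and P: "\<And>m \<delta> e D a b r s. \<lbrakk>0 < m; \<bar>l - m\<bar> \<le> \<eta>; 0 \<le> \<delta>; \<delta> \<le> \<eta>; e \<le> \<eta>; 0 \<le> D; 0 \<le> a; 0 \<le> b; 0 \<le> r; 0 \<le> s;
      r \<le> b + \<delta>; s \<le> a + \<delta>; \<bar>a - b\<bar> \<le> D + \<delta>; a \<le> B \<or> b \<le> B;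
      (l + m) * D\<^sup>2 \<le> m * (r\<^sup>2 - a\<^sup>2) + l * (s\<^sup>2 - b\<^sup>2) + 2 * l * m * e * D\<rbrakk> \<Longrightarrow> D < \<epsilon>"
  show thesis
  proof (rule that[OF \<eta>])
    fix An y m z
    assume mono: "\<And>n. n \<ge> 1 \<Longrightarrow> monotone_vfield K \<rho> (An n)" and surj: "\<And>n. n \<ge> 1 \<Longrightarrow> surjectivity_condition K \<rho> (An n)"
      and g: "graph_approx An y m z" and y: "y \<in> K" and m: "0 < m" "\<bar>l - m\<bar> \<le> \<eta>" and xy: "\<rho> x y \<le> \<eta>"
      and B': "\<rho> y z \<le> B \<or> (\<forall>\<^sub>F n in sequentially. \<rho> x (resolvent K \<rho> (An n) l x) \<le> B)"
    obtain v where z: "z \<in> K" and v: "\<And>n. n \<ge> 1 \<Longrightarrow> v n \<in> An n z"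
      and lim: "(\<lambda>n. td z (tscale (1 / m) (lg z y)) (v n)) \<longlonglongrightarrow> 0"
      using g unfolding graph_approx_def by blast
    have ev: "\<forall>\<^sub>F n in sequentially. \<rho> x (resolvent K \<rho> (An n) l x) \<le> B \<or> \<rho> y z \<le> B"
      using B' by (auto elim: eventually_mono)
    show "\<forall>\<^sub>F n in sequentially. \<rho> (resolvent K \<rho> (An n) l x) z < \<epsilon>"
      using ev order_tendstoD(2)[OF lim \<eta>(1)] eventually_ge_at_top[of 1]
    proof eventually_elim
      case (elim n)
      let ?J = "resolvent K \<rho> (An n) l x"
      have J: "?J \<in> resolvent_set K \<rho> (An n) l x" by (rule resolvent_in[OF flat mono surj x l]) (use elim in auto)
      then have JK: "?J \<in> K" by (rule resolvent_setD)
      show ?case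
      proof (rule P[OF m nonneg xy less_imp_le[OF elim(2)] nonneg nonneg nonneg nonneg nonneg])
        show "\<rho> x z \<le> \<rho> y z + \<rho> x y" using triangle[OF x y z] by simp
        show "\<rho> y ?J \<le> \<rho> x ?J + \<rho> x y" using triangle[OF y x JK] by (simp add: commute)
        show "\<bar>\<rho> x ?J - \<rho> y z\<bar> \<le> \<rho> ?J z + \<rho> x y"
          using triangle[OF x y JK] triangle[OF y z JK] triangle[OF y x z] triangle[OF x JK z] by (simp add: commute abs_le_iff)
        show "\<rho> x ?J \<le> B \<or> \<rho> y z \<le> B" by (rule elim(1))
        show "(l + m) * (\<rho> ?J z)\<^sup>2 \<le> m * ((\<rho> x z)\<^sup>2 - (\<rho> x ?J)\<^sup>2) + l * ((\<rho> y ?J)\<^sup>2 - (\<rho> y z)\<^sup>2)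
            + 2 * l * m * td z (tscale (1 / m) (lg z y)) (v n) * \<rho> ?J z"
          by (rule resolvent_estimate[OF mono J z v x y l m(1) flat[OF z]]) (use elim in auto)
      qed
    qed
  qed
qed

end

section \<open>Almost sure convergence of resolvents\<close>

text \<open>The vectors approximating \<open>(1 / m)\<close> times the logarithm are inductive means
  of one measurable selection at the sampled points. The exceptional null set depends on
  \<open>z\<close>, \<open>m\<close> and \<open>y\<close>.\<close>

lemma (in hadamard) AE_graph_approx:
  assumes iid: "iid_sequence P \<mu> \<xi>" and flat: "flat_space (T z) (td z)"
    and C: "countable C" "C \<subseteq> K" "\<And>x e. x \<in> K \<Longrightarrow> 0 < e \<Longrightarrow> \<exists>c\<in>C. \<rho> c x < e"
    and z: "z \<in> resolvent_set K \<rho> (integral_vfield K \<rho> \<mu> A) m y"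
  shows "AE \<omega> in P. graph_approx (\<lambda>n. ind_mean_vfield K \<rho> (\<lambda>i. A (\<xi> i \<omega>)) n) y m z"
proof -
  interpret iid_sequence P \<mu> \<xi> by fact
  have zK: "z \<in> K" using resolvent_setD[OF z] by blast
  interpret F: flat_hadamard "T z" "td z" by (rule flat_hadamard_tangent_cone[OF zK flat])
  let ?w = "tscale (1 / m) (lg z y)"
  have "?w \<in> multi_integral (T z) (td z) \<mu> (\<lambda>e. A e z)"
    using resolvent_setD(2)[OF z] unfolding integral_vfield_def .
  then obtain \<phi> where \<phi>: "?w = map_integral (T z) (td z) \<mu> \<phi>" "integrable_map (T z) (td z) \<mu> \<phi>"
    "\<And>e. e \<in> space \<mu> \<Longrightarrow> \<phi> e \<in> A e z"
    unfolding multi_integral_def by blast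
  obtain u where u: "u \<in> T z" "integrable \<mu> (\<lambda>e. td z (\<phi> e) u)" and \<phi>m: "\<phi> \<in> \<mu> \<rightarrow>\<^sub>M mborel (T z) (td z)"
    using \<phi>(2) unfolding integrable_map_def by blast
  obtain C' where C': "countable C'" "C' \<subseteq> T z" "\<And>u e. u \<in> T z \<Longrightarrow> 0 < e \<Longrightarrow> \<exists>c\<in>C'. td z c u < e"
    using tangent_cone_separable[OF zK C] by metis
  obtain w where w: "F.barycenter \<mu> \<phi> w"
    and lln: "AE \<omega> in P. (\<lambda>n. td z (ind_mean (T z) (td z) (\<lambda>i. \<phi> (\<xi> i \<omega>)) n) w) \<longlonglongrightarrow> 0"
    using F.strong_law_of_large_numbers[OF iid \<phi>m C' u] by blast
  \<comment> \<open>The limit in the strong law is identified with the integral of the selection,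
    hence with the rescaled logarithm.\<close>
  have w_eq: "w = ?w" using F.map_integral_eq_if_barycenter[OF w] \<phi>(1) by simp
  from lln AE_space show ?thesis
  proof eventually_elim
    case (elim \<omega>)
    show ?case unfolding graph_approx_def
    proof (intro conjI zK exI[of _ "\<lambda>n. ind_mean (T z) (td z) (\<lambda>i. \<phi> (\<xi> i \<omega>)) n"] allI impI)
      fix n :: nat assume "n \<ge> 1"
      have "\<phi> (\<xi> i \<omega>) \<in> A (\<xi> i \<omega>) z" if "i \<ge> 1" for i
        by (rule \<phi>(3)[OF measurable_space[OF measurable_\<xi>[OF that] elim(2)]])
      then show "ind_mean (T z) (td z) (\<lambda>i. \<phi> (\<xi> i \<omega>)) n \<in> ind_mean_vfield K \<rho> (\<lambda>i. A (\<xi> i \<omega>)) n z"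
        unfolding ind_mean_vfield_def ind_mean_set_def by auto
    next
      show "(\<lambda>n. td z ?w (ind_mean (T z) (td z) (\<lambda>i. \<phi> (\<xi> i \<omega>)) n)) \<longlonglongrightarrow> 0"
        using elim(1) w_eq by (simp add: F.commute)
    qed
  qed
qed

lemma hadamard_if_hadamard_space:
  assumes "hadamard_space M d"
  shows "hadamard M d"
proof -
  interpret Metric_space M d using assms unfolding hadamard_space_def by blast
  show ?thesis
    by unfold_locales (use assms in \<open>unfold hadamard_space_def, blast+\<close>)
qed

lemma separable_space_dense_sequence:
  assumes "Metric_space M d" "separable_space (Metric_space.mtopology M d)"
  shows "\<exists>C. countable C \<and> C \<subseteq> M \<and> (\<forall>x\<in>M. \<forall>e>0. \<exists>c\<in>C. d c x < e)"
proof -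
  interpret Metric_space M d by fact
  obtain C where C: "countable C" "C \<subseteq> M" "mtopology closure_of C = M"
    using assms(2) unfolding separable_space_def by auto
  have "\<exists>c\<in>C. d c x < e" if H: "x \<in> M" "0 < e" for x e
  proof -
    have "x \<in> mtopology closure_of C" using C H by simp
    then obtain c where "c \<in> C" "c \<in> mball x e" using H unfolding metric_closure_of by blast
    then show ?thesis by (auto simp: commute)
  qed
  then show ?thesis using C by blast
qed

theorem theorem5p3:
  fixes P :: "'w measure" and \<mu> :: "'e measure"
    and M :: "'a set" and d :: "'a \<Rightarrow> 'a \<Rightarrow> real"
    and \<xi> :: "nat \<Rightarrow> 'w \<Rightarrow> 'e" and A :: "'e \<Rightarrow> 'a vfield"
  assumes "prob_space P" and "prob_space \<mu>"
    and "hilbert_hadamard_space M d"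
    and "separable_space (Metric_space.mtopology M d)"
    and "prob_space.indep_vars P (\<lambda>_. \<mu>) \<xi> {1..}"
    and "\<And>i. i \<ge> 1 \<Longrightarrow> distr P \<mu> (\<xi> i) = \<mu>"
    and "random_monotone_vfield M d \<mu> A"
    and "integrable_vfield M d \<mu> A"
    and "AE \<omega> in P. \<forall>n\<ge>1. surjectivity_condition M d (ind_mean_vfield M d (\<lambda>i. A (\<xi> i \<omega>)) n)"
  shows "AE \<omega> in P. resolvent_converges M d
           (\<lambda>n. ind_mean_vfield M d (\<lambda>i. A (\<xi> i \<omega>)) n) (integral_vfield M d \<mu> A)"
proof -
  interpret P: prob_space P by fact
  have iid: "iid_sequence P \<mu> \<xi>" using assms(5,6) by unfold_locales
  interpret I: iid_sequence P \<mu> \<xi> by fact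
  interpret H: hadamard M d
    using hadamard_if_hadamard_space assms(3) unfolding hilbert_hadamard_space_def by blast
  have flat: "flat_space (tangent_cone M d z) (tdist M d z)" if "z \<in> M" for z
    using assms(3) that unfolding hilbert_hadamard_space_def by blast
  obtain C where C: "countable C" "C \<subseteq> M" "\<And>x e. x \<in> M \<Longrightarrow> 0 < e \<Longrightarrow> \<exists>c\<in>C. d c x < e"
    using separable_space_dense_sequence[OF H.Metric_space_axioms assms(4)] by blast
  define An where "An \<omega> n = ind_mean_vfield M d (\<lambda>i. A (\<xi> i \<omega>)) n" for \<omega> n
  define J where "J \<omega> n r x = resolvent M d (An \<omega> n) r x" for \<omega> n r x
  let ?R = "resolvent_set M d (integral_vfield M d \<mu> A)"
  have "?R r x \<noteq> {}" if "x \<in> M" "0 < r" for r x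
    using assms(8) that unfolding integrable_vfield_def surjectivity_condition_def by blast
  \<comment> \<open>A choice of resolvents of the integral field, whose uniqueness is not yet
    established at this point.\<close>
  then have "\<exists>Z. \<forall>r x. x \<in> M \<longrightarrow> 0 < r \<longrightarrow> Z r x \<in> ?R r x" by (intro exI[of _ "\<lambda>r x. SOME z. z \<in> ?R r x"]) (simp add: some_in_eq)
  then obtain Z where Z: "\<And>r x. x \<in> M \<Longrightarrow> 0 < r \<Longrightarrow> Z r x \<in> ?R r x" by blast
  have RM: "z \<in> M" if "z \<in> ?R r x" for z r x using H.resolvent_setD[OF that] by blast
  have mono: "monotone_vfield M d (An \<omega> n)" if "\<omega> \<in> space P" "n \<ge> 1" for \<omega> n
    unfolding An_def
  proof (rule H.monotone_ind_mean_vfield[OF flat that(2)])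
    fix i assume "i \<in> {1..n}"
    then show "monotone_vfield M d (A (\<xi> i \<omega>))"
      using assms(7) measurable_space[OF I.measurable_\<xi> that(1), of i] unfolding random_monotone_vfield_def by simp
  qed
  define S where "S \<omega> \<longleftrightarrow> \<omega> \<in> space P \<and> (\<forall>n\<ge>1. surjectivity_condition M d (An \<omega> n))" for \<omega>
  have AS: "AE \<omega> in P. S \<omega>" unfolding S_def An_def using assms(9) AE_space by eventually_elim blast
  define Q where "Q = C \<times> ({0<..} \<inter> \<rat> :: real set)"
  have "countable Q" unfolding Q_def using C(1) countable_rat by (auto intro: countable_subset)
  define good where "good \<omega> \<longleftrightarrow> (\<forall>(y, m)\<in>Q. H.graph_approx (An \<omega>) y m (Z m y))" for \<omega>
  have ga: "AE \<omega> in P. H.graph_approx (An \<omega>) y m z" if "z \<in> ?R m y" for y m z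
    unfolding An_def using H.AE_graph_approx[OF iid flat[OF RM[OF that]] C that] by simp
  have Agood: "AE \<omega> in P. good \<omega>"
    unfolding good_def using \<open>countable Q\<close> ga Z C(2) by (subst AE_ball_countable) (auto simp: Q_def)
  \<comment> \<open>A single \<open>\<eta>\<close> for all \<open>\<omega>\<close> is essential: it
    is used below for two different ones.\<close>
  have close: "\<exists>\<eta>. 0 < \<eta> \<and> \<eta> \<le> 1 \<and> (\<forall>\<omega> y m z. S \<omega> \<longrightarrow> H.graph_approx (An \<omega>) y m z \<longrightarrow> y \<in> M \<longrightarrow> 0 < m \<longrightarrow>
      \<bar>l - m\<bar> \<le> \<eta> \<longrightarrow> d x y \<le> \<eta> \<longrightarrow> d y z \<le> B \<or> (\<forall>\<^sub>F n in sequentially. d x (J \<omega> n l x) \<le> B) \<longrightarrow>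
      (\<forall>\<^sub>F n in sequentially. d (J \<omega> n l x) z < \<epsilon>))"
    if "0 < \<epsilon>" "0 \<le> B" "0 < l" "x \<in> M" for \<epsilon> B l x
  proof (rule H.resolvents_close_if_graph_approx[OF flat that])
    fix \<eta> :: real
    assume \<eta>: "0 < \<eta>" "\<eta> \<le> 1"
      and *: "\<And>An y m z. \<lbrakk>\<And>n. n \<ge> 1 \<Longrightarrow> monotone_vfield M d (An n); \<And>n. n \<ge> 1 \<Longrightarrow> surjectivity_condition M d (An n);
        H.graph_approx An y m z; y \<in> M; 0 < m; \<bar>l - m\<bar> \<le> \<eta>; d x y \<le> \<eta>;
        d y z \<le> B \<or> (\<forall>\<^sub>F n in sequentially. d x (resolvent M d (An n) l x) \<le> B)\<rbrakk>
        \<Longrightarrow> \<forall>\<^sub>F n in sequentially. d (resolvent M d (An n) l x) z < \<epsilon>"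
    show ?thesis
    proof (intro exI[of _ \<eta>] conjI \<eta> allI impI)
      fix \<omega> y m z
      assume S\<omega>: "S \<omega>" and h: "H.graph_approx (An \<omega>) y m z" "y \<in> M" "0 < m" "\<bar>l - m\<bar> \<le> \<eta>" "d x y \<le> \<eta>"
        "d y z \<le> B \<or> (\<forall>\<^sub>F n in sequentially. d x (J \<omega> n l x) \<le> B)"
      show "\<forall>\<^sub>F n in sequentially. d (J \<omega> n l x) z < \<epsilon>"
        unfolding J_def by (rule *[OF _ _ h[unfolded J_def]]) (use S\<omega> mono in \<open>auto simp: S_def\<close>)
    qed
  qed
  have JM: "J \<omega> n l x \<in> M" if "S \<omega>" "n \<ge> 1" "x \<in> M" "0 < l" for \<omega> n l x
    unfolding J_def
    by (rule H.resolvent_setD(1)[OF H.resolvent_in[OF flat]]) (use that mono in \<open>auto simp: S_def\<close>)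
  \<comment> \<open>The case of the same parameters, \<open>y = x\<close> and \<open>m = l\<close>,
    where \<open>B = d x z\<close> is an admissible bound.\<close>
  have pointwise: "\<forall>\<^sub>F n in sequentially. d (J \<omega> n l x) z < \<epsilon>"
    if "S \<omega>" "H.graph_approx (An \<omega>) x l z" "x \<in> M" "0 < l" "0 < \<epsilon>" for \<omega> x l z \<epsilon>
    using close[of \<epsilon> "d x z" l x] that by auto
  \<comment> \<open>Sets of full measure are nonempty, so some \<open>\<omega>\<close> is good for
    both candidates, and the resolvents of the mean fields converge to both of them.\<close>
  have unique: "z = z'" if z: "z \<in> ?R l x" and z': "z' \<in> ?R l x" and x: "x \<in> M" and l: "0 < l" for z z' l x
  proof (rule ccontr)
    assume "z \<noteq> z'"
    then have e: "0 < d z z' / 2" using RM z z' by simp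
    obtain \<omega> where \<omega>: "S \<omega>" "H.graph_approx (An \<omega>) x l z" "H.graph_approx (An \<omega>) x l z'"
      using eventually_happens'[OF P.ae_filter_bot eventually_conj[OF AS eventually_conj[OF ga[OF z] ga[OF z']]]] by blast
    obtain n where n: "n \<ge> 1" "d (J \<omega> n l x) z < d z z' / 2" "d (J \<omega> n l x) z' < d z z' / 2"
      using eventually_happens'[OF sequentially_bot eventually_conj[OF eventually_ge_at_top[of 1]
          eventually_conj[OF pointwise[OF \<omega>(1,2) x l e] pointwise[OF \<omega>(1,3) x l e]]]] by blast
    show False using H.triangle[OF RM[OF z] JM[OF \<omega>(1) n(1) x l] RM[OF z']] n by (simp add: H.commute)
  qed
  have main: "\<forall>\<^sub>F n in sequentially. d (J \<omega> n l x) (Z l x) < \<epsilon>"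
    if S\<omega>: "S \<omega>" and g\<omega>: "good \<omega>" and x: "x \<in> M" and l: "0 < l" and \<epsilon>: "0 < \<epsilon>" for \<omega> x l \<epsilon>
  proof -
    let ?z = "Z l x"
    have z: "?z \<in> ?R l x" "?z \<in> M" using Z[OF x l] RM by auto
    define \<epsilon>' where "\<epsilon>' = min 1 (\<epsilon> / 3)"
    have \<epsilon>': "0 < \<epsilon>'" "\<epsilon>' \<le> 1" "3 * \<epsilon>' \<le> \<epsilon>" unfolding \<epsilon>'_def using \<epsilon> by auto
    \<comment> \<open>Large enough for both uses of \<open>cl\<close>: it exceeds
      \<open>d x ?z + \<epsilon>'\<close>, which bounds the resolvents at \<open>\<omega>0\<close>,
      and \<open>\<eta> + d x ?z + 2 * \<epsilon>'\<close>, which bounds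
      \<open>d y ?y\<close>.\<close>
    define B where "B = d x ?z + 3"
    have B: "0 \<le> B" unfolding B_def by simp
    obtain \<eta> where \<eta>: "0 < \<eta>" "\<eta> \<le> 1" and cl: "\<And>\<omega> y m z. \<lbrakk>S \<omega>; H.graph_approx (An \<omega>) y m z; y \<in> M; 0 < m;
      \<bar>l - m\<bar> \<le> \<eta>; d x y \<le> \<eta>; d y z \<le> B \<or> (\<forall>\<^sub>F n in sequentially. d x (J \<omega> n l x) \<le> B)\<rbrakk> \<Longrightarrow>
      \<forall>\<^sub>F n in sequentially. d (J \<omega> n l x) z < \<epsilon>'"
      using close[OF \<epsilon>'(1) B l x] by blast
    obtain y where y: "y \<in> C" "d y x < \<eta>" using C(3)[OF x \<eta>(1)] by blast
    obtain m where m: "m \<in> \<rat>" "l < m" "m < l + \<eta>" using Rats_dense_in_real[of l "l + \<eta>"] \<eta> by auto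
    have ym: "y \<in> M" "0 < m" "\<bar>l - m\<bar> \<le> \<eta>" "d x y \<le> \<eta>" "(y, m) \<in> Q"
      using y m l C(2) by (auto simp: Q_def H.commute)
    let ?y = "Z m y"
    have zy: "?y \<in> M" using RM[OF Z[OF ym(1,2)]] .
    \<comment> \<open>The given \<open>\<omega>\<close> need not be good for \<open>(x, l)\<close>,
      but some \<open>\<omega>0\<close> is good for it and for all of \<open>Q\<close>. Comparing
      \<open>?y\<close> and \<open>?z\<close> with the same resolvents there gives a bound on
      \<open>d ?y ?z\<close> that no longer involves \<open>\<omega>0\<close>.\<close>
    obtain \<omega>0 where \<omega>0: "S \<omega>0" "good \<omega>0" "H.graph_approx (An \<omega>0) x l ?z"
      using eventually_happens'[OF P.ae_filter_bot eventually_conj[OF AS eventually_conj[OF Agood ga[OF z(1)]]]] by blast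
    have near: "\<forall>\<^sub>F n in sequentially. d (J \<omega>0 n l x) ?z < \<epsilon>'" by (rule pointwise[OF \<omega>0(1,3) x l \<epsilon>'(1)])
    then have "\<forall>\<^sub>F n in sequentially. d x (J \<omega>0 n l x) \<le> B" using eventually_ge_at_top[of 1]
    proof eventually_elim
      case (elim n)
      then show ?case using H.triangle[OF x z(2) JM[OF \<omega>0(1) elim(2) x l]] \<epsilon>' unfolding B_def by (simp add: H.commute)
    qed
    then have "\<forall>\<^sub>F n in sequentially. d (J \<omega>0 n l x) ?y < \<epsilon>'"
      using \<omega>0 ym by (intro cl[OF \<omega>0(1) _ ym(1-4)]) (auto simp: good_def)
    then obtain n where n: "n \<ge> 1" "d (J \<omega>0 n l x) ?y < \<epsilon>'" "d (J \<omega>0 n l x) ?z < \<epsilon>'"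
      using eventually_happens'[OF sequentially_bot eventually_conj[OF eventually_ge_at_top[of 1] eventually_conj[OF _ near]]] by blast
    have yz: "d ?y ?z < 2 * \<epsilon>'"
      using H.triangle[OF zy JM[OF \<omega>0(1) n(1) x l] z(2)] n by (simp add: H.commute)
    have "d y ?y \<le> B"
      using H.triangle[OF ym(1) x zy] H.triangle[OF x z(2) zy] yz \<epsilon>' \<eta> ym(4) unfolding B_def by (simp add: H.commute)
    \<comment> \<open>Back at the given \<open>\<omega>\<close>: now the point \<open>?y\<close> is
      known to be bounded, which is the other alternative of the premise of
      \<open>cl\<close>.\<close>
    then have "\<forall>\<^sub>F n in sequentially. d (J \<omega> n l x) ?y < \<epsilon>'"
      using g\<omega> ym by (intro cl[OF S\<omega> _ ym(1-4)]) (auto simp: good_def)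
    then show ?thesis using eventually_ge_at_top[of 1]
    proof eventually_elim
      case (elim n)
      then show ?case using H.triangle[OF JM[OF S\<omega> elim(2) x l] zy z(2)] yz \<epsilon>'(3) by linarith
    qed
  qed
  from AS Agood show ?thesis
  proof eventually_elim
    case (elim \<omega>)
    show ?case unfolding resolvent_converges_def
    proof (intro ballI allI impI)
      fix x r assume x: "x \<in> M" and r: "(0::real) < r"
      have "?R r x = {Z r x}" using unique[OF _ Z[OF x r] x r] Z[OF x r] by blast
      then have eq: "resolvent M d (integral_vfield M d \<mu> A) r x = Z r x" unfolding resolvent_def by simp
      show "limitin H.mtopology (\<lambda>n. resolvent M d (ind_mean_vfield M d (\<lambda>i. A (\<xi> i \<omega>)) n) r x)
          (resolvent M d (integral_vfield M d \<mu> A) r x) sequentially"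
        unfolding eq H.limitin_metric
      proof (intro conjI allI impI RM[OF Z[OF x r]])
        fix \<epsilon> :: real assume "0 < \<epsilon>"
        from main[OF elim(1,2) x r this] eventually_ge_at_top[of 1]
        show "\<forall>\<^sub>F n in sequentially. resolvent M d (ind_mean_vfield M d (\<lambda>i. A (\<xi> i \<omega>)) n) r x \<in> M \<and>
            d (resolvent M d (ind_mean_vfield M d (\<lambda>i. A (\<xi> i \<omega>)) n) r x) (Z r x) < \<epsilon>"
          by eventually_elim (use JM[OF elim(1) _ x r] in \<open>simp add: J_def An_def\<close>)
      qed
    qed
  qed
qed

end
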